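(* Let $0<p_1\le\infty$, $0<p_2\le\infty$, $0<\theta\le\infty$, $v_1,v_2\in\mathcal W(\mathbb{R}^n)$ and $\omega\in\Omega_\theta$. Write $I:=\|\mathrm{Id}\|_{L_{p_1}(\mathbb{R}^n,v_1)\to LM_{p_2\theta,\omega}(\mathbb{R}^n,v_2)}$. Then, uniformly in $\omega\in\Omega_\theta$: (i) if $p_2<p_1\le\theta<\infty$: $I\approx \sup_{t>0}\|\omega\|_{\theta,(t,\infty)}\,\big\|v_1^{-1/p_1}v_2^{1/p_2}\big\|_{\frac{p_1p_2}{p_1-p_2},B(0,t)}$; (ii) if $p_2<p_1<\infty$ and $0<\theta<p_1$: $I\approx \Big\|\,\|\omega\|_{\theta,(t,\infty)}^{\theta/p_1}\big\|v_1^{-1/p_1}v_2^{1/p_2}\big\|_{\frac{p_1p_2}{p_1-p_2},B(0,t)}\Big\|_{\frac{\theta p_1}{p_1-\theta},(0,\infty),\omega^\theta}$ (the outer norm taken in the variable $t$); (iii) if $p_2<p_1<\infty$ and $\theta=\infty$: $I\approx \sup_{t>0}\|\omega\|_{\theta,(t,\infty)}\,\big\|v_1^{-1/p_1}v_2^{1/p_2}\big\|_{\frac{p_1p_2}{p_1-p_2},B(0,t)}$; (iv) if $p_1=\theta=\infty$ and $0<p_2<\infty$: $I\approx\sup_{t>0}\|\omega\|_{\theta,(t,\infty)}\,\big\|v_1^{-1}v_2^{1/p_2}\big\|_{p_2,B(0,t)}$; (v) if $p_1=\infty$, $0<p_2<\infty$, $0<\theta<\infty$: $I\approx\Big\|\omega(t)\,\big\|v_1^{-1}v_2^{1/p_2}\big\|_{p_2,B(0,t)}\Big\|_{\theta,(0,\infty)}$;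 (vi) if $p:=p_1=p_2\le\theta<\infty$: $I\approx\sup_{t>0}\|\omega\|_{\theta,(t,\infty)}\,\big\|v_1^{-1/p}v_2^{1/p}\big\|_{\infty,B(0,t)}$; (vii) if $0<p:=p_1=p_2<\infty$ and $0<\theta<p$: $I\approx\Big\|\,\|\omega\|_{\theta,(t,\infty)}^{\theta/p}\big\|v_1^{-1/p}v_2^{1/p}\big\|_{\infty,B(0,t)}\Big\|_{\frac{\theta p}{p-\theta},(0,\infty),\omega^\theta}$; (viii) if $0<p:=p_1=p_2<\infty$ and $\theta=\infty$: $I\approx\sup_{t>0}\|\omega\|_{\theta,(t,\infty)}\,\big\|v_1^{-1/p}v_2^{1/p}\big\|_{\infty,B(0,t)}$; (ix) if $p:=p_1=p_2=\infty$ and $0<\theta<\infty$: $I\approx\Big\|\omega(t)\,\big\|v_1^{-1}v_2\big\|_{\infty,B(0,t)}\Big\|_{\theta,(0,\infty)}$. (Both sides may equal $+\infty$.)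
   Context: $B(0,r)$ is the open ball in $\mathbb{R}^n$ centered at $0$ of radius $r$. For a measurable set $A$, $0<p\le\infty$ and a measurable $w\ge0$ on $A$: $\|f\|_{p,A,w}:=(\int_A|f|^pw)^{1/p}$ if $p<\infty$ and $\operatorname{ess\,sup}_A|f|w$ if $p=\infty$; $\|f\|_{p,A}:=\|f\|_{p,A,1}$. $\mathcal W(\mathbb{R}^n)$ is the set of measurable functions on $\mathbb{R}^n$ which are positive and finite a.e. Conventions: $0/0=0$, $0\cdot(\pm\infty)=0$, $1/(\pm\infty)=0$. $L_p(\mathbb{R}^n,v)$ is the set of measurable $f$ with $\|f\|_{p,\mathbb{R}^n,v}<\infty$. For $0<p,\theta\le\infty$, measurable $\omega\ge0$ on $(0,\infty)$ and $v\in\mathcal W(\mathbb{R}^n)$, the weighted local Morrey-type space $LM_{p\theta,\omega}(\mathbb{R}^n,v)$ is the set of $f\in L^{\mathrm{loc}}_{p,v}(\mathbb{R}^n)$ with $\|f\|_{LM_{p\theta,\omega}(\mathbb{R}^n,v)}:=\big\|\omega(r)\|f\|_{p,B(0,r),v}\big\|_{\theta,(0,\infty)}<\infty$. $\Omega_\theta$ is the set of measurable $\omega\ge0$ on $(0,\infty)$ with $0<\|\omega\|_{\theta,(t,\infty)}<\infty$ for all $t>0$. $\|\mathrm{Id}\|_{X\to Y}:=\sup_{f\in X,\,f\not\sim0}\|f\|_Y/\|f\|_X\in[0,\infty]$ (the best embedding constant). "$A(\omega)\approx B(\omega)$ uniformly in $\omega\in\Omega_\theta$" means there are constants $0<c\le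 C$, which may depend on $n,p_1,p_2,\theta,v_1,v_2$ but not on $\omega$, with $cA(\omega)\le B(\omega)\le CA(\omega)$ for all $\omega\in\Omega_\theta$. *)

theory Defs
  imports "HOL-Analysis.Analysis"
begin

text \<open>Real powers of extended nonnegative reals, used only with exponent a > 0:
  infinity to the a is infinity, 0 to the a is 0.\<close>
definition enn_powr :: "ennreal \<Rightarrow> real \<Rightarrow> ennreal" where
  "enn_powr x a = (if x = top then top else ennreal (enn2real x powr a))"

definition ess_sup_on :: "'a measure \<Rightarrow> 'a set \<Rightarrow> ('a \<Rightarrow> ennreal) \<Rightarrow> ennreal" where
  "ess_sup_on M A g = Inf {c. AE x in M. x \<in> A \<longrightarrow> g x \<le> c}"

definition wnorm :: "'a measure \<Rightarrow> ennreal \<Rightarrow> 'a set \<Rightarrow> ('a \<Rightarrow> ennreal) \<Rightarrow> ('a \<Rightarrow> ennreal) \<Rightarrow> ennreal" where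
  "wnorm M p A w g =
     (if p = top then ess_sup_on M A (\<lambda>x. g x * w x)
      else enn_powr (\<integral>\<^sup>+ x \<in> A. enn_powr (g x) (enn2real p) * w x \<partial>M) (1 / enn2real p))"

definition weights :: "('a::euclidean_space \<Rightarrow> real) set" where
  "weights = {v. v \<in> borel_measurable lebesgue \<and> (AE x in lebesgue. 0 < v x)}"

definition Lp_norm :: "ennreal \<Rightarrow> ('a::euclidean_space \<Rightarrow> real) \<Rightarrow> ('a \<Rightarrow> real) \<Rightarrow> ennreal" where
  "Lp_norm p v f = wnorm lebesgue p UNIV (\<lambda>x. ennreal (v x)) (\<lambda>x. ennreal \<bar>f x\<bar>)"

definition LM_norm :: "ennreal \<Rightarrow> ennreal \<Rightarrow> (real \<Rightarrow> ennreal) \<Rightarrow> ('a::euclidean_space \<Rightarrow> real)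
    \<Rightarrow> ('a \<Rightarrow> real) \<Rightarrow> ennreal" where
  "LM_norm p \<theta> \<omega> v f =
     wnorm lebesgue \<theta> {0<..} (\<lambda>_. 1)
       (\<lambda>r. \<omega> r * wnorm lebesgue p (ball 0 r) (\<lambda>x. ennreal (v x)) (\<lambda>x. ennreal \<bar>f x\<bar>))"

definition embed_const :: "ennreal \<Rightarrow> ('a::euclidean_space \<Rightarrow> real) \<Rightarrow> ennreal \<Rightarrow> ennreal
    \<Rightarrow> (real \<Rightarrow> ennreal) \<Rightarrow> ('a \<Rightarrow> real) \<Rightarrow> ennreal" where
  "embed_const p1 v1 p2 \<theta> \<omega> v2 =
     (SUP f \<in> {f. f \<in> borel_measurable lebesgue \<and> Lp_norm p1 v1 f < top
                  \<and> \<not> (AE x in lebesgue. f x = 0)}.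
        LM_norm p2 \<theta> \<omega> v2 f / Lp_norm p1 v1 f)"

definition Omega :: "ennreal \<Rightarrow> (real \<Rightarrow> ennreal) set" where
  "Omega \<theta> = {\<omega>. \<omega> \<in> borel_measurable lebesgue \<and>
     (\<forall>t>0. 0 < wnorm lebesgue \<theta> {t<..} (\<lambda>_. 1) \<omega> \<and> wnorm lebesgue \<theta> {t<..} (\<lambda>_. 1) \<omega> < top)}"

definition unif_equiv :: "ennreal \<Rightarrow> ((real \<Rightarrow> ennreal) \<Rightarrow> ennreal) \<Rightarrow> ((real \<Rightarrow> ennreal) \<Rightarrow> ennreal) \<Rightarrow> bool" where
  "unif_equiv \<theta> B A \<longleftrightarrow> (\<exists>c C :: real. 0 < c \<and> c \<le> C \<and>
     (\<forall>\<omega> \<in> Omega \<theta>. ennreal c * A \<omega> \<le> B \<omega> \<and> B \<omega> \<le> ennreal C * A \<omega>))"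

end

theory Submission
  imports Defs
begin

text \<open>
  Let \<open>K(t)\<close> be the best constant of the embedding of \<open>L\<^sub>p\<^sub>1(v\<^sub>1)\<close> into \<open>L\<^sub>p\<^sub>2(B(0,t), v\<^sub>2)\<close>.
  Hoelder's inequality and its sharpness identify \<open>K(t)\<close> with the norm of
  \<open>v\<^sub>1\<^sup>-\<^sup>1\<^sup>/\<^sup>p\<^sup>1 v\<^sub>2\<^sup>1\<^sup>/\<^sup>p\<^sup>2\<close> over the ball, so everything is expressed by \<open>K\<close> and by
  the tail \<open>W(t)\<close>, the integral of \<open>\<omega>\<^sup>\<theta>\<close> over \<open>(t,\<infinity>)\<close>. If \<open>p\<^sub>1 = \<infinity>\<close>, the function \<open>1/v\<^sub>1\<close> is
  extremal; if \<open>\<theta> = \<infinity>\<close>, two suprema are interchanged.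

  Otherwise, for the upper bound, cut \<open>(0,\<infinity>)\<close> along the dyadic levels of
  the mass \<open>g(t)\<close> of \<open>|f|\<^sup>p\<^sup>2 v\<^sub>2\<close> in \<open>B(0,t)\<close>. At the radius \<open>r\<close> with
  \<open>g(r) = 2\<^sup>k\<^sup>+\<^sup>1\<close> at least \<open>2\<^sup>k\<close> of the mass lies in the layer \<open>2\<^sup>k < g(|x|) \<le> 2\<^sup>k\<^sup>+\<^sup>1\<close>, hence is
  controlled by \<open>K(r)\<close> and by the \<open>L\<^sub>p\<^sub>1(v\<^sub>1)\<close> norm of \<open>f\<close> on that layer. The layers are disjoint
  and the estimates are summed by \<open>\<ell>\<^sub>1 \<subseteq> \<ell>\<^sub>q\<close> (if \<open>p\<^sub>1 \<le> \<theta>\<close>) or by Hoelder's inequality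
  (if \<open>\<theta> < p\<^sub>1\<close>). The lower bound is obtained from functions nearly extremal for a single ball or,
  if \<open>\<theta> < p\<^sub>1\<close>, from a superposition of those belonging to the dyadic levels of \<open>W\<close>.
\<close>

section \<open>Powers of extended nonnegative reals\<close>

text \<open>Keeping K as a supremum lets p2 < p1 and p2 = p1 share one argument. Neither K nor W
  need be doubling, so cutting at the radii 2^k would give no control; levels of g or W are used
  because one dyadic step there costs a known factor. That a level is attained requires continuity,
  which holds because spheres and points are null sets, and finiteness of g, which follows from
  finiteness of the right-hand side: g(s) = infinity forces K(s) = infinity. Every "half of the
  mass" step rests on one fact, \<open>nn_integral_sublevel_le\<close>: the mass of the region where
  a distribution function is at most c is itself at most c, even if the function has flat pieces or
  jumps to infinity. In the upper bounds a layer of f is paired with the radii of the next level,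
  2^(k+1) < g(s) <= 2^(k+2), so g(s) is at most 4 times the guaranteed mass 2^k; hence 4^(1/p2). For
  \<theta> < p1 put R = \<theta> p1 / (p1 - \<theta>). Then 1 + R/p1 = R/\<theta>, so a dyadic block
  of W^(R/p1) \<omega>^\<theta> has size about W^(R/\<theta>), and \<theta>/R + \<theta>/p1 = 1 is
  the conjugacy used in Hoelder's inequality.\<close>

lemma enn_powr_ennreal: "0 \<le> r \<Longrightarrow> enn_powr (ennreal r) a = ennreal (r powr a)"
  by (simp add: enn_powr_def)

lemma enn_powr_top [simp]: "enn_powr top a = top"
  by (simp add: enn_powr_def)

lemma enn_powr_0 [simp]: "enn_powr 0 a = 0"
  by (simp add: enn_powr_def)

lemma enn_powr_1 [simp]: "enn_powr 1 a = 1"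
  by (simp add: enn_powr_def)

lemma enn_powr_one [simp]: "enn_powr x 1 = x"
  by (cases x) (auto simp: enn_powr_ennreal)

lemma enn_powr_eq_0_iff [simp]: "enn_powr x a = 0 \<longleftrightarrow> x = 0"
  by (cases x) (auto simp: enn_powr_ennreal)

lemma enn_powr_eq_top_iff [simp]: "enn_powr x a = top \<longleftrightarrow> x = top"
  by (cases x) (auto simp: enn_powr_ennreal)

lemma enn_powr_pos_iff [simp]: "0 < enn_powr x a \<longleftrightarrow> 0 < x"
  by (simp add: zero_less_iff_neq_zero)

lemma enn_powr_less_top_iff [simp]: "enn_powr x a < top \<longleftrightarrow> x < top"
  by (simp add: less_top[symmetric])

lemma enn_powr_mono: "0 \<le> a \<Longrightarrow> x \<le> y \<Longrightarrow> enn_powr x a \<le> enn_powr y a"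
  by (cases x; cases y) (auto simp: enn_powr_ennreal top_unique intro!: ennreal_leI powr_mono2)

text \<open>Every exponent fixes 0 and \<open>top\<close>, and 0 * \<open>top\<close> = 0; hence
  this law and the two that follow hold for arbitrary real exponents and arguments.\<close>

lemma enn_powr_mult: "enn_powr (x * y) a = enn_powr x a * enn_powr y a"
proof (cases "x = top \<or> y = top")
  case True
  then show ?thesis
    by (auto simp: ennreal_top_mult ennreal_mult_top)
next
  case False
  then show ?thesis
    by (cases x; cases y) (auto simp: enn_powr_ennreal powr_mult simp flip: ennreal_mult)
qed

lemma enn_powr_powr: "enn_powr (enn_powr x a) b = enn_powr x (a * b)"
  by (cases x) (auto simp: enn_powr_ennreal powr_powr)

lemma enn_powr_add: "enn_powr x (a + b) = enn_powr x a * enn_powr x b"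
  by (cases x) (auto simp: enn_powr_ennreal powr_add ennreal_top_mult simp flip: ennreal_mult)

lemma enn_powr_cancel: "0 < a \<Longrightarrow> enn_powr (enn_powr x a) (1 / a) = x"
  "0 < a \<Longrightarrow> enn_powr (enn_powr x (1 / a)) a = x"
  by (simp_all add: enn_powr_powr)

lemma enn_powr_le_cancel: "0 < a \<Longrightarrow> enn_powr x a \<le> enn_powr y a \<longleftrightarrow> x \<le> y"
  using enn_powr_mono[of "1 / a" "enn_powr x a" "enn_powr y a"] enn_powr_mono[of a x y]
  by (auto simp only: enn_powr_cancel less_imp_le divide_nonneg_pos zero_le_one)

lemma enn_powr_le_iff: "0 < a \<Longrightarrow> enn_powr x a \<le> y \<longleftrightarrow> x \<le> enn_powr y (1 / a)"
  using enn_powr_le_cancel[of a x "enn_powr y (1 / a)"] by (simp only: enn_powr_cancel)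

text \<open>For a > 0 the power is an order isomorphism with inverse exponent 1/a, hence preserves
  suprema.\<close>

lemma enn_powr_SUP:
  assumes "0 < a"
  shows "enn_powr (SUP i\<in>I. f i) a = (SUP i\<in>I. enn_powr (f i) a)"
proof (rule antisym)
  have "(SUP i\<in>I. f i) \<le> enn_powr (SUP i\<in>I. enn_powr (f i) a) (1 / a)"
    using assms by (intro SUP_least) (auto simp: enn_powr_le_iff[symmetric] intro: SUP_upper)
  then show "enn_powr (SUP i\<in>I. f i) a \<le> (SUP i\<in>I. enn_powr (f i) a)"
    using assms by (simp add: enn_powr_le_iff)
qed (use assms in \<open>auto intro!: SUP_least enn_powr_mono SUP_upper\<close>)

lemma measurable_enn_powr [measurable]:
  assumes [measurable]: "f \<in> borel_measurable M"
  shows "(\<lambda>x. enn_powr (f x) a) \<in> borel_measurable M"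
  unfolding enn_powr_def by measurable

lemma enn_powr_Young:
  assumes "0 < a" "0 < b" "a + b = 1"
  shows "enn_powr x a * enn_powr y b \<le> ennreal a * x + ennreal b * y"
proof (cases "x = 0 \<or> y = 0 \<or> x = top \<or> y = top")
  case True
  then show ?thesis
    using assms by (auto simp: ennreal_mult_top ennreal_top_mult)
next
  case False
  then obtain r s where "x = ennreal r" "y = ennreal s" "r > 0" "s > 0"
    by (cases x; cases y) (auto simp: less_le)
  then show ?thesis
    using Youngs_inequality_0[of a b r s] assms
    by (auto simp: enn_powr_ennreal simp flip: ennreal_mult ennreal_plus intro!: ennreal_leI)
qed

text \<open>Young's inequality for f and g normalised to integral 1. With the exponents outside, one
  statement serves Lebesgue integrals and, over \<open>count_space\<close>, sums over the dyadic
  levels.\<close>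

lemma nn_integral_Hoelder:
  assumes "0 < a" "0 < b" "a + b = 1"
    and [measurable]: "f \<in> borel_measurable M" "g \<in> borel_measurable M"
  shows "(\<integral>\<^sup>+x. enn_powr (f x) a * enn_powr (g x) b \<partial>M)
    \<le> enn_powr (\<integral>\<^sup>+x. f x \<partial>M) a * enn_powr (\<integral>\<^sup>+x. g x \<partial>M) b"
proof -
  define X where "X = (\<integral>\<^sup>+x. f x \<partial>M)"
  define Y where "Y = (\<integral>\<^sup>+x. g x \<partial>M)"
  \<comment> \<open>Normalisation divides by X and Y. A zero integral makes the integrand vanish
    a.e.; an infinite one beside a nonzero one makes the right side infinite.\<close>
  consider "X = 0 \<or> Y = 0" | "X \<noteq> 0" "Y \<noteq> 0" "X = top \<or> Y = top" | "X \<noteq> 0" "Y \<noteq> 0" "X \<noteq> top" "Y \<noteq> top"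
    by blast
  then show ?thesis
  proof cases
    case 1
    then have "(AE x in M. f x = 0) \<or> (AE x in M. g x = 0)"
      by (auto simp: X_def Y_def nn_integral_0_iff_AE)
    then have "AE x in M. enn_powr (f x) a * enn_powr (g x) b = 0"
      by auto
    then have "(\<integral>\<^sup>+x. enn_powr (f x) a * enn_powr (g x) b \<partial>M) = 0"
      by (subst nn_integral_0_iff_AE) auto
    then show ?thesis by simp
  next
    case 2
    then show ?thesis
      by (auto simp: X_def[symmetric] Y_def[symmetric] ennreal_mult_top ennreal_top_mult)
  next
    case 3
    define c where "c = enn_powr X a * enn_powr Y b"
    have "(\<integral>\<^sup>+x. enn_powr (f x / X) a * enn_powr (g x / Y) b \<partial>M)
      \<le> (\<integral>\<^sup>+x. ennreal a * (f x / X) + ennreal b * (g x / Y) \<partial>M)"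
      using assms by (intro nn_integral_mono enn_powr_Young) auto
    also have "\<dots> = ennreal a * (X / X) + ennreal b * (Y / Y)"
      by (simp add: nn_integral_add nn_integral_cmult nn_integral_divide X_def Y_def)
    also have "\<dots> = 1"
      using 3 assms by (simp add: less_top flip: ennreal_plus)
    finally have le: "(\<integral>\<^sup>+x. enn_powr (f x / X) a * enn_powr (g x / Y) b \<partial>M) \<le> 1" .
    have "enn_powr (f x) a * enn_powr (g x) b = c * (enn_powr (f x / X) a * enn_powr (g x / Y) b)" for x
    proof -
      have "f x = X * (f x / X)" "g x = Y * (g x / Y)"
        using 3 by (auto simp: ennreal_times_divide mult.commute[of X] mult.commute[of Y] ennreal_mult_divide_eq)
      then have "enn_powr (f x) a * enn_powr (g x) b
          = enn_powr (X * (f x / X)) a * enn_powr (Y * (g x / Y)) b" by simp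
      then show ?thesis by (simp only: enn_powr_mult c_def ac_simps)
    qed
    then have "(\<integral>\<^sup>+x. enn_powr (f x) a * enn_powr (g x) b \<partial>M)
       = c * (\<integral>\<^sup>+x. enn_powr (f x / X) a * enn_powr (g x / Y) b \<partial>M)"
      by (simp add: nn_integral_cmult)
    also have "\<dots> \<le> c * 1"
      by (intro mult_left_mono le) auto
    finally show ?thesis
      by (simp add: c_def X_def Y_def)
  qed
qed

section \<open>Dyadic decomposition and distribution functions\<close>

text \<open>Open on the left, so that what remains below a block is a closed sublevel set {..2^k},
  the form bounded by \<open>nn_integral_sublevel_le\<close>. The values 0 and \<open>top\<close>
  lie in no block.\<close>

definition dyadic :: "int \<Rightarrow> ennreal set" where
  "dyadic k = {ennreal (2 powr k)<..ennreal (2 powr (k + 1))}"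

lemma dyadic_measurable [measurable]: "dyadic k \<in> sets borel"
  by (simp add: dyadic_def)

lemma dyadic_unique:
  assumes "x \<in> dyadic k" "x \<in> dyadic l"
  shows "k = l"
proof (rule ccontr)
  assume "k \<noteq> l"
  then have "k + 1 \<le> l \<or> l + 1 \<le> k" by linarith
  then have "ennreal (2 powr (k + 1)) \<le> ennreal (2 powr l) \<or> ennreal (2 powr (l + 1)) \<le> ennreal (2 powr k)"
    by (auto intro!: ennreal_leI powr_mono)
  then show False
  proof
    assume "ennreal (2 powr (k + 1)) \<le> ennreal (2 powr l)"
    moreover have "x \<le> ennreal (2 powr (k + 1))" "ennreal (2 powr l) < x"
      using assms by (simp_all add: dyadic_def)
    ultimately have "x < x" by (blast intro: order.strict_trans1 order.trans)
    then show False by simp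
  next
    assume "ennreal (2 powr (l + 1)) \<le> ennreal (2 powr k)"
    moreover have "x \<le> ennreal (2 powr (l + 1))" "ennreal (2 powr k) < x"
      using assms by (simp_all add: dyadic_def)
    ultimately have "x < x" by (blast intro: order.strict_trans1 order.trans)
    then show False by simp
  qed
qed

lemma dyadic_exists:
  assumes "0 < x" "x < top"
  shows "\<exists>k. x \<in> dyadic k"
proof -
  obtain r where r: "x = ennreal r" "0 < r"
    using assms by (cases x) auto
  define k where "k = \<lceil>log 2 r\<rceil> - 1"
  have "k < log 2 r" "log 2 r \<le> k + 1"
    unfolding k_def by linarith+
  then have "2 powr k < r" "r \<le> 2 powr (k + 1)"
    using r by (simp_all add: less_log_iff log_le_iff)
  then show ?thesis
    using r by (auto simp: dyadic_def ennreal_less_iff intro!: exI[of _ k] ennreal_leI)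
qed

lemma nn_integral_indicator_dyadic:
  "(\<integral>\<^sup>+k. indicator (dyadic (k + j)) x \<partial>count_space UNIV) = indicator {0<..<top} x"
proof (cases "0 < x \<and> x < top")
  case True
  then obtain k where k: "x \<in> dyadic k"
    using dyadic_exists by blast
  have "x \<in> dyadic (i + j) \<longleftrightarrow> i \<in> {k - j}" for i
  proof
    assume "x \<in> dyadic (i + j)"
    from dyadic_unique[OF k this] show "i \<in> {k - j}" by simp
  qed (use k in simp)
  then have "indicator (dyadic (i + j)) x = (indicator {k - j} i :: ennreal)" for i
    unfolding indicator_def by presburger
  with True show ?thesis by (simp add: one_ennreal_def[symmetric])
next
  case False
  then have "x \<notin> dyadic i" for i
    unfolding dyadic_def using False
    by (metis ennreal_less_top greaterThanAtMost_iff le_less_trans zero_le)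
  with False show ?thesis by (auto simp: indicator_def)
qed

text \<open>Tonelli, with the sum over levels written as an integral over
  \<open>count_space\<close>. The shift j later pairs layer k of f with the radii of level k +
  1.\<close>

lemma nn_integral_dyadic:
  assumes [measurable]: "F \<in> borel_measurable M" "G \<in> borel_measurable M"
  shows "(\<integral>\<^sup>+k. (\<integral>\<^sup>+x. F x * indicator (dyadic (k + j)) (G x) \<partial>M) \<partial>count_space UNIV)
    = (\<integral>\<^sup>+x. F x * indicator {0<..<top} (G x) \<partial>M)"
proof -
  have "(\<integral>\<^sup>+k. (\<integral>\<^sup>+x. F x * indicator (dyadic (k + j)) (G x) \<partial>M) \<partial>count_space UNIV)
    = (\<integral>\<^sup>+x. (\<integral>\<^sup>+k. F x * indicator (dyadic (k + j)) (G x) \<partial>count_space UNIV) \<partial>M)"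
    by (rule nn_integral_count_space_nn_integral[symmetric]) auto
  also have "\<dots> = (\<integral>\<^sup>+x. F x * indicator {0<..<top} (G x) \<partial>M)"
    by (simp add: nn_integral_cmult nn_integral_indicator_dyadic)
  finally show ?thesis .
qed

section \<open>Monotone functions and distribution functions\<close>

lemma mono_borel_measurable:
  fixes f :: "real \<Rightarrow> 'b::{linorder_topology, second_countable_topology}"
  assumes "mono f"
  shows "f \<in> borel_measurable borel"
proof (rule borel_measurableI_greater)
  fix y
  have "is_interval {x. y < f x}"
    unfolding is_interval_1 using assms by (auto simp: mono_def intro: less_le_trans)
  then show "{x \<in> space borel. y < f x} \<in> sets borel"
    using real_interval_borel_measurable by simp
qed

text \<open>A ray (-inf, b) or (-inf, b], or the whole line, is exhausted by countably many rays
  with end in S, up to the endpoint b, which will be a null event.\<close>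

lemma down_closed_real_exhaustion:
  fixes S :: "real set"
  assumes down: "\<And>x y. y \<in> S \<Longrightarrow> x \<le> y \<Longrightarrow> x \<in> S" and "S \<noteq> {}"
  obtains s :: "nat \<Rightarrow> real" and b where "incseq s" "\<And>n. s n \<in> S"
    "\<And>x. x \<in> S \<Longrightarrow> x \<noteq> b \<Longrightarrow> \<exists>n. x < s n"
proof (cases "bdd_above S")
  case True
  define b where "b = Sup S"
  show ?thesis
  proof (rule that[of "\<lambda>n. b - 1 / Suc n" b])
    show "incseq (\<lambda>n. b - 1 / Suc n)"
      by (auto simp: incseq_def field_simps)
  next
    fix n
    have "b - 1 / Suc n < Sup S" by (simp add: b_def)
    then obtain y where "y \<in> S" "b - 1 / Suc n < y"
      using less_cSup_iff[OF \<open>S \<noteq> {}\<close> True] by blast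
    then show "b - 1 / Suc n \<in> S" using down[of y "b - 1 / Suc n"] by simp
  next
    fix x assume "x \<in> S" "x \<noteq> b"
    then have "0 < b - x"
      using cSup_upper[OF _ True, of x] by (simp add: b_def)
    then obtain n where "inverse (real (Suc n)) < b - x"
      using reals_Archimedean by blast
    then show "\<exists>n. x < b - 1 / Suc n"
      by (intro exI[of _ n]) (simp add: field_simps)
  qed
next
  case False
  then have "x \<in> S" for x
    using down by (meson bdd_above.I linorder_le_cases)
  then show ?thesis
    using that[of real 0] by (auto simp: incseq_def intro: reals_Archimedean2)
qed

text \<open>G is increasing, so G(h x) <= c says that h x lies in a down-closed set. Rays {h < s n}
  with G(s n) <= c exhaust this set up to the null event h = b, and monotone convergence carries the
  bound over.\<close>

lemma nn_integral_sublevel_le: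
  fixes h :: "'a \<Rightarrow> real" and F :: "'a \<Rightarrow> ennreal"
  assumes [measurable]: "F \<in> borel_measurable M" "h \<in> borel_measurable M"
    and null: "\<And>r. AE x in M. h x \<noteq> r"
  defines "G \<equiv> (\<lambda>r. \<integral>\<^sup>+x. F x * indicator {..<r} (h x) \<partial>M)"
  shows "(\<integral>\<^sup>+x. F x * indicator {..c} (G (h x)) \<partial>M) \<le> c"
proof (cases "{r. G r \<le> c} = {}")
  case True
  then have "\<And>r. \<not> G r \<le> c" by blast
  then show ?thesis by simp
next
  case False
  have mono: "G r \<le> G s" if "r \<le> s" for r s
    unfolding G_def using that by (intro nn_integral_mono) (auto simp: indicator_def)
  obtain s b where s: "incseq s" "\<And>n. s n \<in> {r. G r \<le> c}"
    and ex: "\<And>x. x \<in> {r. G r \<le> c} \<Longrightarrow> x \<noteq> b \<Longrightarrow> \<exists>n. x < s n"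
    by (rule down_closed_real_exhaustion[OF _ False]) (auto intro: order.trans mono)
  have "AE x in M. F x * indicator {..c} (G (h x)) \<le> (SUP n. F x * indicator {..<s n} (h x))"
    using null[of b]
  proof eventually_elim
    case (elim x)
    show ?case
    proof (cases "G (h x) \<le> c")
      case True
      with ex elim obtain n where "h x < s n" by blast
      then have "F x * indicator {..c} (G (h x)) = F x * indicator {..<s n} (h x)"
        using True by simp
      then show ?thesis by (auto intro: SUP_upper)
    qed simp
  qed
  then have "(\<integral>\<^sup>+x. F x * indicator {..c} (G (h x)) \<partial>M)
      \<le> (\<integral>\<^sup>+x. (SUP n. F x * indicator {..<s n} (h x)) \<partial>M)"
    by (rule nn_integral_mono_AE)
  also have "\<dots> = (SUP n. G (s n))"
    unfolding G_def using s(1)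
    by (intro nn_integral_monotone_convergence_SUP)
       (auto simp: incseq_def le_fun_def indicator_def intro: less_le_trans)
  also have "\<dots> \<le> c"
    using s(2) by (auto intro: SUP_least)
  finally show ?thesis .
qed

text \<open>Dominated convergence: as r tends to a, the indicator of {h < r} can fail to converge
  only where h = a, a null event. The finite mass below b is the majorant, so b itself is
  included.\<close>

lemma continuous_on_distribution:
  fixes h :: "'a \<Rightarrow> real" and F :: "'a \<Rightarrow> ennreal"
  assumes [measurable]: "F \<in> borel_measurable M" "h \<in> borel_measurable M"
    and null: "\<And>r. AE x in M. h x \<noteq> r"
    and fin: "(\<integral>\<^sup>+x. F x * indicator {..<b} (h x) \<partial>M) < top"
  shows "continuous_on {..b} (\<lambda>r. \<integral>\<^sup>+x. F x * indicator {..<r} (h x) \<partial>M)"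
proof (rule continuous_on_sequentiallyI)
  fix u a assume u: "\<forall>n. u n \<in> {..b}" and lim: "u \<longlonglongrightarrow> a"
  show "(\<lambda>n. \<integral>\<^sup>+x. F x * indicator {..<u n} (h x) \<partial>M) \<longlonglongrightarrow> (\<integral>\<^sup>+x. F x * indicator {..<a} (h x) \<partial>M)"
  proof (rule nn_integral_dominated_convergence[where w="\<lambda>x. F x * indicator {..<b} (h x)"])
    show "AE x in M. F x * indicator {..<u j} (h x) \<le> F x * indicator {..<b} (h x)" for j
      using u by (auto simp: indicator_def intro: less_le_trans)
    show "AE x in M. (\<lambda>i. F x * indicator {..<u i} (h x)) \<longlonglongrightarrow> F x * indicator {..<a} (h x)"
      using null[of a]
    proof eventually_elim
      case (elim x)
      then consider "h x < a" | "a < h x" by linarith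
      then have "eventually (\<lambda>i. h x < u i \<longleftrightarrow> h x < a) sequentially"
      proof cases
        case 1
        from order_tendstoD(1)[OF lim 1] show ?thesis by eventually_elim (use 1 in simp)
      next
        case 2
        from order_tendstoD(2)[OF lim 2] show ?thesis by eventually_elim (use 2 in simp)
      qed
      then show ?case
        by (intro tendsto_eventually, elim eventually_mono) (simp add: indicator_def)
    qed
  qed (use fin in auto)
qed

section \<open>Weighted norms and the local embedding constant\<close>

text \<open>The infimum is a limit of countably many admissible bounds, whose exceptional null sets
  can be united.\<close>

lemma AE_le_ess_sup_on: "AE x in M. x \<in> A \<longrightarrow> g x \<le> ess_sup_on M A g"
proof -
  have ne: "{c. AE x in M. x \<in> A \<longrightarrow> g x \<le> c} \<noteq> {}"
    by (auto intro!: exI[of _ top])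
  obtain c :: "nat \<Rightarrow> ennreal" where c: "range c \<subseteq> {c. AE x in M. x \<in> A \<longrightarrow> g x \<le> c}"
    "ess_sup_on M A g = (INF n. c n)"
    using ennreal_Inf_countable_INF[OF ne] unfolding ess_sup_on_def by auto
  then have "AE x in M. \<forall>n. x \<in> A \<longrightarrow> g x \<le> c n"
    unfolding AE_all_countable by auto
  then show ?thesis
    unfolding c(2) by eventually_elim (auto intro: INF_greatest)
qed

lemma ess_sup_on_le_iff: "ess_sup_on M A g \<le> c \<longleftrightarrow> (AE x in M. x \<in> A \<longrightarrow> g x \<le> c)"
proof
  assume "ess_sup_on M A g \<le> c"
  with AE_le_ess_sup_on[of A g M] show "AE x in M. x \<in> A \<longrightarrow> g x \<le> c"
    by (auto elim!: eventually_mono intro: order.trans)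
qed (simp add: ess_sup_on_def Inf_lower)

lemma wnorm_ennreal:
  "0 \<le> p \<Longrightarrow> wnorm M (ennreal p) A w g = enn_powr (\<integral>\<^sup>+x\<in>A. enn_powr (g x) p * w x \<partial>M) (1 / p)"
  by (simp add: wnorm_def)

lemma wnorm_top: "wnorm M top A w g = ess_sup_on M A (\<lambda>x. g x * w x)"
  by (simp add: wnorm_def)

lemma wnorm_mono_AE:
  assumes "AE x in M. x \<in> A \<longrightarrow> x \<in> B \<and> g x \<le> h x"
  shows "wnorm M p A w g \<le> wnorm M p B w h"
proof (cases "p = top")
  case True
  have "AE x in M. x \<in> A \<longrightarrow> g x * w x \<le> ess_sup_on M B (\<lambda>x. h x * w x)"
    using assms AE_le_ess_sup_on[of B "\<lambda>x. h x * w x" M]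
    by eventually_elim (use mult_right_mono[OF _ zero_le] in \<open>blast intro: order.trans\<close>)
  then show ?thesis
    using True by (simp add: wnorm_top ess_sup_on_le_iff)
next
  case False
  then show ?thesis
    unfolding wnorm_def using assms
    by (auto intro!: enn_powr_mono nn_integral_mono_AE mult_right_mono elim!: eventually_mono simp: indicator_def)
qed

lemma wnorm_cong_AE:
  assumes "AE x in M. x \<in> A \<longrightarrow> g x = h x"
  shows "wnorm M p A w g = wnorm M p A w h"
  using assms by (intro antisym wnorm_mono_AE) (auto elim!: eventually_mono)

lemma ennreal_divide_le_iff: "0 < b \<Longrightarrow> b < top \<Longrightarrow> a / b \<le> c \<longleftrightarrow> a \<le> c * (b :: ennreal)"
  by (cases a; cases b; cases c)
     (auto simp: divide_ennreal field_simps ennreal_top_divide ennreal_mult_less_top top_unique ennreal_mult_eq_top_iff simp flip: ennreal_mult)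

lemma ennreal_le_divide_iff: "0 < b \<Longrightarrow> b < top \<Longrightarrow> c \<le> a / b \<longleftrightarrow> c * b \<le> (a :: ennreal)"
  by (cases a; cases b; cases c)
     (auto simp: divide_ennreal field_simps ennreal_top_divide ennreal_mult_less_top top_unique ennreal_mult_eq_top_iff simp flip: ennreal_mult)

text \<open>The one-sided form includes c = 0 and c = \<open>top\<close>, as required when c is a
  norm over a ball. For 0 < c < \<open>top\<close>, applying it to c and to 1/c gives
  \<open>wnorm_mult_const\<close>.\<close>

lemma wnorm_mult_const_le:
  assumes [measurable]: "g \<in> borel_measurable M" "w \<in> borel_measurable M" "A \<in> sets M"
    and "0 < p"
  shows "wnorm M p A w g * c \<le> wnorm M p A w (\<lambda>x. g x * c)"
proof (cases "p = top")
  case True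
  define d where "d = ess_sup_on M A (\<lambda>x. g x * c * w x)"
  have d: "AE x in M. x \<in> A \<longrightarrow> g x * c * w x \<le> d"
    unfolding d_def by (rule AE_le_ess_sup_on)
  have "ess_sup_on M A (\<lambda>x. g x * w x) * c \<le> d"
  proof (cases "c = 0 \<or> d = top")
    case False
    show ?thesis
    proof (cases "c = top")
      case True
      \<comment> \<open>An infinite factor with a finite bound d leaves only g x * w x = 0.\<close>
      have "AE x in M. x \<in> A \<longrightarrow> g x * w x \<le> 0"
        using d by eventually_elim (use False True in \<open>auto simp: ennreal_mult_top ennreal_top_mult top_unique split: if_splits\<close>)
      then show ?thesis
        by (subst (asm) ess_sup_on_le_iff[symmetric]) simp
    next
      case cfin: False
      have c: "0 < c" "c < top" using False cfin by (auto simp: zero_less_iff_neq_zero less_top)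
      have "AE x in M. x \<in> A \<longrightarrow> g x * w x \<le> d / c"
        using d by eventually_elim (use c in \<open>simp add: ennreal_le_divide_iff ac_simps\<close>)
      then show ?thesis
        by (subst (asm) ess_sup_on_le_iff[symmetric]) (use c in \<open>simp add: ennreal_le_divide_iff\<close>)
    qed
  qed auto
  then show ?thesis using True by (simp add: wnorm_top d_def)
next
  case False
  define r where "r = enn2real p"
  have eq: "(\<integral>\<^sup>+x\<in>A. enn_powr (g x * c) r * w x \<partial>M) = (\<integral>\<^sup>+x\<in>A. enn_powr (g x) r * w x \<partial>M) * enn_powr c r"
    by (subst nn_integral_multc[symmetric]) (auto simp: enn_powr_mult ac_simps)
  have "r > 0" using assms(4) False by (simp add: r_def enn2real_positive_iff less_top)
  then show ?thesis
    using False by (simp add: wnorm_def eq enn_powr_mult[of _ "enn_powr c r"] enn_powr_cancel flip: r_def)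
qed

section \<open>Admissible functions and the local embedding constant\<close>

definition admissible :: "ennreal \<Rightarrow> ('a::euclidean_space \<Rightarrow> real) \<Rightarrow> ('a \<Rightarrow> real) set" where
  "admissible p v = {f. f \<in> borel_measurable lebesgue \<and> Lp_norm p v f < top \<and> \<not> (AE x in lebesgue. f x = 0)}"

text \<open>For A = \<open>ball 0 t\<close> this is the K(t) of the overview.\<close>

definition local_const :: "ennreal \<Rightarrow> ('a::euclidean_space \<Rightarrow> real) \<Rightarrow> ennreal \<Rightarrow> ('a \<Rightarrow> real) \<Rightarrow> 'a set \<Rightarrow> ennreal" where
  "local_const p1 v1 p2 v2 A = (SUP f\<in>admissible p1 v1.
     wnorm lebesgue p2 A (\<lambda>x. ennreal (v2 x)) (\<lambda>x. ennreal \<bar>f x\<bar>) / Lp_norm p1 v1 f)"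

lemma embed_const_eq:
  "embed_const p1 v1 p2 \<theta> \<omega> v2 = (SUP f\<in>admissible p1 v1. LM_norm p2 \<theta> \<omega> v2 f / Lp_norm p1 v1 f)"
  by (simp add: embed_const_def admissible_def)

lemma local_const_mono: "A \<subseteq> B \<Longrightarrow> local_const p1 v1 p2 v2 A \<le> local_const p1 v1 p2 v2 B"
  unfolding local_const_def by (intro SUP_mono' divide_right_mono_ennreal wnorm_mono_AE) auto

lemma weights_measurable: "v \<in> weights \<Longrightarrow> v \<in> borel_measurable lebesgue"
  by (simp add: weights_def)

text \<open>A weight positive a.e. makes the norm definite; hence the quotients defining the
  embedding constants have positive finite denominators.\<close>

lemma Lp_norm_eq_0D:
  assumes v: "v \<in> weights" and [measurable]: "f \<in> borel_measurable lebesgue"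
    and "0 < p" "Lp_norm p v f = 0"
  shows "AE x in lebesgue. f x = 0"
proof -
  note [measurable] = weights_measurable[OF v]
  have pos: "AE x in lebesgue. 0 < v x" using v by (simp add: weights_def)
  show ?thesis
  proof (cases "p = top")
    case True
    then have "ess_sup_on lebesgue UNIV (\<lambda>x. ennreal \<bar>f x\<bar> * ennreal (v x)) \<le> 0"
      using assms by (simp add: Lp_norm_def wnorm_top)
    then have "AE x in lebesgue. ennreal \<bar>f x\<bar> * ennreal (v x) \<le> 0"
      by (subst (asm) ess_sup_on_le_iff) simp
    then show ?thesis
      using pos by eventually_elim auto
  next
    case False
    have "(\<integral>\<^sup>+x. enn_powr (ennreal \<bar>f x\<bar>) (enn2real p) * ennreal (v x) \<partial>lebesgue) = 0"
      using assms False by (simp add: Lp_norm_def wnorm_def)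
    then have "AE x in lebesgue. enn_powr (ennreal \<bar>f x\<bar>) (enn2real p) * ennreal (v x) = 0"
      by (subst (asm) nn_integral_0_iff_AE) auto
    then show ?thesis
      using pos by eventually_elim auto
  qed
qed

lemma admissibleD:
  assumes "f \<in> admissible p v" "v \<in> weights" "0 < p"
  shows "f \<in> borel_measurable lebesgue" "0 < Lp_norm p v f" "Lp_norm p v f < top"
  using assms Lp_norm_eq_0D[of v f p] by (auto simp: admissible_def zero_less_iff_neq_zero)

text \<open>Includes functions vanishing a.e., which are not admissible; restrictions of f to a
  dyadic layer may be of this kind.\<close>

lemma local_const_bound:
  assumes v: "v1 \<in> weights" and "0 < p1" and p2: "0 < p2" and [measurable]: "f \<in> borel_measurable lebesgue"
    and "Lp_norm p1 v1 f < top"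
  shows "wnorm lebesgue p2 A (\<lambda>x. ennreal (v2 x)) (\<lambda>x. ennreal \<bar>f x\<bar>) \<le> local_const p1 v1 p2 v2 A * Lp_norm p1 v1 f"
proof (cases "AE x in lebesgue. f x = 0")
  case True
  have "wnorm lebesgue p2 A (\<lambda>x. ennreal (v2 x)) (\<lambda>x. ennreal \<bar>f x\<bar>) = wnorm lebesgue p2 A (\<lambda>x. ennreal (v2 x)) (\<lambda>x. 0)"
    by (rule wnorm_cong_AE) (use True in \<open>auto elim!: eventually_mono\<close>)
  also have "\<dots> = 0"
    using ess_sup_on_le_iff[of lebesgue A "\<lambda>x. 0" 0] by (simp add: wnorm_def)
  finally show ?thesis by simp
next
  case False
  then have f: "f \<in> admissible p1 v1" using assms by (simp add: admissible_def)
  note fD = admissibleD[OF f v \<open>0 < p1\<close>]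
  have "wnorm lebesgue p2 A (\<lambda>x. ennreal (v2 x)) (\<lambda>x. ennreal \<bar>f x\<bar>) / Lp_norm p1 v1 f \<le> local_const p1 v1 p2 v2 A"
    unfolding local_const_def using f by (rule SUP_upper)
  then show ?thesis using fD by (simp add: ennreal_divide_le_iff)
qed

text \<open>Only the radii r > t are kept, and for these \<open>ball 0 r\<close> contains
  \<open>ball 0 t\<close>.\<close>

lemma LM_norm_ge:
  assumes [measurable]: "\<omega> \<in> borel_measurable lebesgue" and "0 \<le> t" "0 < \<theta>"
  shows "wnorm lebesgue \<theta> {t<..} (\<lambda>_. 1) \<omega> * wnorm lebesgue p (ball 0 t) (\<lambda>x. ennreal (v x)) (\<lambda>x. ennreal \<bar>f x\<bar>)
    \<le> LM_norm p \<theta> \<omega> v f"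
proof -
  have "wnorm lebesgue \<theta> {t<..} (\<lambda>_. 1) \<omega> * wnorm lebesgue p (ball 0 t) (\<lambda>x. ennreal (v x)) (\<lambda>x. ennreal \<bar>f x\<bar>)
    \<le> wnorm lebesgue \<theta> {t<..} (\<lambda>_. 1) (\<lambda>r. \<omega> r * wnorm lebesgue p (ball 0 t) (\<lambda>x. ennreal (v x)) (\<lambda>x. ennreal \<bar>f x\<bar>))"
    using assms by (intro wnorm_mult_const_le) auto
  also have "\<dots> \<le> LM_norm p \<theta> \<omega> v f"
    unfolding LM_norm_def using assms
    by (intro wnorm_mono_AE AE_I2) (auto intro!: mult_left_mono wnorm_mono_AE)
  finally show ?thesis .
qed

lemma embed_const_ge:
  assumes [measurable]: "\<omega> \<in> borel_measurable lebesgue" and "0 \<le> t" "0 < \<theta>"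
  shows "wnorm lebesgue \<theta> {t<..} (\<lambda>_. 1) \<omega> * local_const p1 v1 p2 v2 (ball 0 t) \<le> embed_const p1 v1 p2 \<theta> \<omega> v2"
  unfolding embed_const_eq local_const_def SUP_mult_left_ennreal
  using assms by (intro SUP_mono') (simp add: ennreal_times_divide divide_right_mono_ennreal LM_norm_ge)

section \<open>The case of infinite \<theta>: interchange of suprema\<close>

lemma ball_in_sets_lebesgue [measurable]: "ball c r \<in> sets lebesgue"
  by simp

text \<open>An open ball is the union of the balls of radius r - 1/(n+1). This left continuity is
  the hypothesis \<open>left\<close> of the next lemma.\<close>

lemma wnorm_ball_left_continuous:
  fixes f v :: "'a::euclidean_space \<Rightarrow> real"
  assumes [measurable]: "f \<in> borel_measurable lebesgue" "v \<in> borel_measurable lebesgue" and "0 < p"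
  shows "wnorm lebesgue p (ball 0 r) (\<lambda>x. ennreal (v x)) (\<lambda>x. ennreal \<bar>f x\<bar>)
    \<le> (SUP n. wnorm lebesgue p (ball 0 (r - 1 / Suc n)) (\<lambda>x. ennreal (v x)) (\<lambda>x. ennreal \<bar>f x\<bar>))"
    (is "?N r \<le> (SUP n. ?N (r - 1 / Suc n))")
proof -
  have ex: "\<exists>n. x \<in> ball 0 (r - 1 / Suc n)" if "x \<in> ball (0::'a) r" for x
  proof -
    have "0 < r - norm x" using that by simp
    then obtain n where "inverse (real (Suc n)) < r - norm x"
      using reals_Archimedean by blast
    then show ?thesis by (intro exI[of _ n]) (simp add: field_simps)
  qed
  show ?thesis
  proof (cases "p = top")
    case True
    have "AE x in lebesgue. \<forall>n. x \<in> ball 0 (r - 1 / Suc n) \<longrightarrow> ennreal \<bar>f x\<bar> * ennreal (v x) \<le> ?N (r - 1 / Suc n)"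
      unfolding AE_all_countable True wnorm_top by (intro allI AE_le_ess_sup_on)
    then have "AE x in lebesgue. x \<in> ball 0 r \<longrightarrow> ennreal \<bar>f x\<bar> * ennreal (v x) \<le> (SUP n. ?N (r - 1 / Suc n))"
      by eventually_elim (meson ex SUP_upper2 UNIV_I)
    then show ?thesis
      by (subst True, subst wnorm_top, subst ess_sup_on_le_iff)
  next
    case False
    define q where "q = enn2real p"
    have q: "q > 0" using assms False by (simp add: q_def enn2real_positive_iff less_top)
    have mono: "ball 0 (r - 1 / Suc m) \<subseteq> ball (0::'a) (r - 1 / Suc n)" if "m \<le> n" for m n
    proof -
      have "1 / real (Suc n) \<le> 1 / real (Suc m)"
        using that by (intro divide_left_mono) auto
      then show ?thesis by (intro subset_ball) linarith
    qed
    have "(\<integral>\<^sup>+x\<in>ball 0 r. enn_powr (ennreal \<bar>f x\<bar>) q * ennreal (v x) \<partial>lebesgue)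
      \<le> (\<integral>\<^sup>+x. (SUP n. enn_powr (ennreal \<bar>f x\<bar>) q * ennreal (v x) * indicator (ball 0 (r - 1 / Suc n)) x) \<partial>lebesgue)"
    proof (rule nn_integral_mono)
      fix x :: 'a
      show "enn_powr (ennreal \<bar>f x\<bar>) q * ennreal (v x) * indicator (ball 0 r) x
        \<le> (SUP n. enn_powr (ennreal \<bar>f x\<bar>) q * ennreal (v x) * indicator (ball 0 (r - 1 / Suc n)) x)"
      proof (cases "x \<in> ball 0 r")
        case True
        then obtain n where "x \<in> ball 0 (r - 1 / Suc n)" using ex by blast
        with True show ?thesis by (intro SUP_upper2[of n]) (auto simp del: mem_ball)
      qed simp
    qed
    also have "\<dots> = (SUP n. (\<integral>\<^sup>+x\<in>ball 0 (r - 1 / Suc n). enn_powr (ennreal \<bar>f x\<bar>) q * ennreal (v x) \<partial>lebesgue))"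
    proof (rule nn_integral_monotone_convergence_SUP)
      show "incseq (\<lambda>n x. enn_powr (ennreal \<bar>f x\<bar>) q * ennreal (v x) * indicator (ball 0 (r - 1 / Suc n)) x)"
        unfolding incseq_def le_fun_def
        by (intro allI impI mult_left_mono indicator_leI, use mono in blast) simp
    qed measurable
    finally show ?thesis
      using False q by (simp add: wnorm_def enn_powr_SUP[symmetric] enn_powr_mono flip: q_def)
  qed
qed

text \<open>The null set on which \<omega> exceeds its essential supremum over (t, inf) depends on
  t. Rational t share one null set; monotonicity and left continuity of g recover the other
  radii.\<close>

lemma ess_sup_on_mult_mono_eq:
  fixes \<omega> g :: "real \<Rightarrow> ennreal"
  assumes [measurable]: "\<omega> \<in> borel_measurable lebesgue"
    and mono: "\<And>s t. s \<le> t \<Longrightarrow> g s \<le> g t" and left: "\<And>r. g r \<le> (SUP n. g (r - 1 / Suc n))"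
  shows "ess_sup_on lebesgue {0<..} (\<lambda>r. \<omega> r * g r) = (SUP t\<in>{0<..}. ess_sup_on lebesgue {t<..} \<omega> * g t)" (is "?L = ?R")
proof (rule antisym)
  have 1: "AE r in lebesgue. \<forall>q\<in>\<rat> \<inter> {0<..}. r \<in> {q<..} \<longrightarrow> \<omega> r \<le> ess_sup_on lebesgue {q<..} \<omega>"
    by (subst AE_ball_countable)
       (use AE_le_ess_sup_on[of "{_<..}" \<omega> lebesgue] in \<open>auto intro: countable_subset[OF _ countable_rat]\<close>)
  have "AE r in lebesgue. r \<in> {0<..} \<longrightarrow> \<omega> r * g r \<le> ?R"
    using 1
  proof (eventually_elim, intro impI)
    fix r :: real
    assume r: "\<forall>q\<in>\<rat> \<inter> {0<..}. r \<in> {q<..} \<longrightarrow> \<omega> r \<le> ess_sup_on lebesgue {q<..} \<omega>" and "r \<in> {0<..}"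
    have "\<omega> r * g (r - 1 / Suc n) \<le> ?R" for n
    proof -
      \<comment> \<open>A rational q between r - 1/(n+1) and r satisfies both demands: r > q bounds
        \<omega> r by the tail at q, and g (r - 1/(n+1)) <= g q.\<close>
      have "max 0 (r - 1 / Suc n) < r" using \<open>r \<in> {0<..}\<close> by auto
      then obtain q where q: "q \<in> \<rat>" "max 0 (r - 1 / Suc n) < q" "q < r"
        using Rats_dense_in_real by blast
      then have "\<omega> r * g (r - 1 / Suc n) \<le> ess_sup_on lebesgue {q<..} \<omega> * g q"
        using r by (intro mult_mono mono) auto
      also have "\<dots> \<le> ?R" using q by (intro SUP_upper) auto
      finally show ?thesis .
    qed
    then have "(SUP n. \<omega> r * g (r - 1 / Suc n)) \<le> ?R" by (rule SUP_least)
    moreover have "\<omega> r * g r \<le> (SUP n. \<omega> r * g (r - 1 / Suc n))"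
      unfolding SUP_mult_left_ennreal[symmetric] by (intro mult_left_mono left) simp
    ultimately show "\<omega> r * g r \<le> ?R" by order
  qed
  then show "?L \<le> ?R" by (simp add: ess_sup_on_le_iff)
next
  show "?R \<le> ?L"
  proof (rule SUP_least)
    fix t :: real assume t: "t \<in> {0<..}"
    have "ess_sup_on lebesgue {t<..} \<omega> * g t \<le> ess_sup_on lebesgue {t<..} (\<lambda>r. \<omega> r * g t)"
      using wnorm_mult_const_le[where g=\<omega> and M=lebesgue and w="\<lambda>_. 1" and A="{t<..}" and p=top and c="g t"] by (simp add: wnorm_top)
    also have "\<dots> \<le> ?L"
      using wnorm_mono_AE[where M=lebesgue and A="{t<..}" and B="{0<..}" and g="\<lambda>r. \<omega> r * g t" and h="\<lambda>r. \<omega> r * g r" and p=top and w="\<lambda>_. 1"] t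
      by (simp add: wnorm_top mult_left_mono mono)
    finally show "ess_sup_on lebesgue {t<..} \<omega> * g t \<le> ?L" .
  qed
qed

lemma LM_norm_top:
  assumes "\<omega> \<in> borel_measurable lebesgue" "v \<in> weights" "f \<in> borel_measurable lebesgue" "0 < p"
  shows "LM_norm p top \<omega> v f = (SUP t\<in>{0<..}. wnorm lebesgue top {t<..} (\<lambda>_. 1) \<omega>
    * wnorm lebesgue p (ball 0 t) (\<lambda>x. ennreal (v x)) (\<lambda>x. ennreal \<bar>f x\<bar>))"
  unfolding LM_norm_def wnorm_top[of lebesgue "{0<..}"] mult_1_right
  by (subst ess_sup_on_mult_mono_eq)
     (use assms in \<open>auto intro!: wnorm_mono_AE AE_I2 wnorm_ball_left_continuous weights_measurable simp: wnorm_top simp del: of_nat_Suc\<close>)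

lemma embed_const_theta_top:
  assumes \<omega>: "\<omega> \<in> borel_measurable lebesgue" and v: "v1 \<in> weights" "v2 \<in> weights" and p: "0 < p1" "0 < p2"
  shows "embed_const p1 v1 p2 top \<omega> v2
    = (SUP t\<in>{0<..}. wnorm lebesgue top {t<..} (\<lambda>_. 1) \<omega> * local_const p1 v1 p2 v2 (ball 0 t))"
proof (rule antisym)
  show "embed_const p1 v1 p2 top \<omega> v2
    \<le> (SUP t\<in>{0<..}. wnorm lebesgue top {t<..} (\<lambda>_. 1) \<omega> * local_const p1 v1 p2 v2 (ball 0 t))"
    unfolding embed_const_eq
  proof (rule SUP_least)
    fix f assume f: "f \<in> admissible p1 v1"
    note fD = admissibleD[OF f v(1) p(1)]
    show "LM_norm p2 top \<omega> v2 f / Lp_norm p1 v1 f \<le> (SUP t\<in>{0<..}. wnorm lebesgue top {t<..} (\<lambda>_. 1) \<omega> * local_const p1 v1 p2 v2 (ball 0 t))"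
      unfolding LM_norm_top[OF \<omega> v(2) fD(1) p(2)] SUP_divide_ennreal
      by (intro SUP_mono bexI)
         (auto simp: ennreal_times_divide[symmetric] local_const_def intro!: mult_left_mono SUP_upper f)
  qed
qed (use \<omega> in \<open>auto intro!: SUP_least embed_const_ge\<close>)

lemma ess_sup_on_cong_AE:
  assumes "AE x in M. x \<in> A \<longrightarrow> g x = h x"
  shows "ess_sup_on M A g = ess_sup_on M A h"
proof (rule antisym)
  have "AE x in M. x \<in> A \<longrightarrow> g x \<le> ess_sup_on M A h"
    using assms AE_le_ess_sup_on[of A h M] by eventually_elim auto
  then show "ess_sup_on M A g \<le> ess_sup_on M A h" by (simp add: ess_sup_on_le_iff)
  have "AE x in M. x \<in> A \<longrightarrow> h x \<le> ess_sup_on M A g"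
    using assms AE_le_ess_sup_on[of A g M] by eventually_elim auto
  then show "ess_sup_on M A h \<le> ess_sup_on M A g" by (simp add: ess_sup_on_le_iff)
qed

lemma wnorm_mult_const:
  assumes [measurable]: "g \<in> borel_measurable M" "w \<in> borel_measurable M" "A \<in> sets M"
    and "0 < p" "0 < c" "c < top"
  shows "wnorm M p A w (\<lambda>x. g x * c) = wnorm M p A w g * c"
proof (rule antisym)
  have 1: "y * c / c = y" for y
    using assms by (intro ennreal_mult_divide_eq) auto
  have "wnorm M p A w (\<lambda>x. g x * c) * (1 / c) \<le> wnorm M p A w (\<lambda>x. g x * c * (1 / c))"
    using assms by (intro wnorm_mult_const_le) auto
  then have "wnorm M p A w (\<lambda>x. g x * c) / c \<le> wnorm M p A w g"
    by (simp add: 1 ennreal_times_divide)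
  then show "wnorm M p A w (\<lambda>x. g x * c) \<le> wnorm M p A w g * c"
    using assms by (simp add: ennreal_divide_le_iff)
qed (rule wnorm_mult_const_le; fact)

lemma borel_measurable_wnorm_ball [measurable]:
  "(\<lambda>r. wnorm M p (ball 0 r) w g) \<in> borel_measurable lebesgue"
  by (rule measurable_completion)
     (auto intro!: mono_borel_measurable wnorm_mono_AE simp: mono_def)

section \<open>The case of infinite p1: an extremal function\<close>

lemma Lp_norm_inverse_weight:
  fixes v :: "'a::euclidean_space \<Rightarrow> real"
  assumes "v \<in> weights"
  shows "Lp_norm top v (\<lambda>x. inverse (v x)) = 1"
proof -
  have pos: "AE x in lebesgue. 0 < v x" using assms by (simp add: weights_def)
  have "AE x in lebesgue. ennreal \<bar>inverse (v x)\<bar> * ennreal (v x) = 1"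
    using pos by eventually_elim (simp flip: ennreal_mult)
  then have "Lp_norm top v (\<lambda>x. inverse (v x)) = ess_sup_on lebesgue UNIV (\<lambda>x::'a. 1)"
    unfolding Lp_norm_def wnorm_top by (intro ess_sup_on_cong_AE) simp
  also have "\<dots> = 1"
  proof (rule antisym)
    \<comment> \<open>An a.e. statement in which x does not occur is simply true, because the whole
      space is not a null set.\<close>
    have "AE x in (lebesgue :: 'a measure). 1 \<le> ess_sup_on lebesgue UNIV (\<lambda>x::'a. 1)"
      using AE_le_ess_sup_on[of UNIV "\<lambda>x::'a. 1" lebesgue] by simp
    then show "1 \<le> ess_sup_on lebesgue UNIV (\<lambda>x::'a. 1)"
      using ae_filter_eq_bot_iff[of "lebesgue :: 'a measure"]
      by (simp add: eventually_const_iff)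
  qed (simp add: ess_sup_on_le_iff)
  finally show ?thesis .
qed

text \<open>A function of norm N satisfies |f| <= N / v1 a.e., and the target norm is monotone and
  homogeneous; so 1/v1, of norm 1, attains the supremum.\<close>

lemma embed_const_p1_top:
  fixes v1 v2 :: "'a::euclidean_space \<Rightarrow> real"
  assumes v: "v1 \<in> weights" "v2 \<in> weights" and p: "0 < p2" "0 < \<theta>"
    and [measurable]: "\<omega> \<in> borel_measurable lebesgue"
  shows "embed_const top v1 p2 \<theta> \<omega> v2 = LM_norm p2 \<theta> \<omega> v2 (\<lambda>x. inverse (v1 x))"
proof -
  note [measurable] = weights_measurable[OF v(1)] weights_measurable[OF v(2)]
  let ?g = "\<lambda>x. inverse (v1 x)"
  have g: "?g \<in> admissible top v1"
  proof -
    have "\<not> (AE x in lebesgue. ?g x = 0)"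
    proof
      assume 0: "AE x in lebesgue. ?g x = 0"
      have "AE x in lebesgue. 0 < v1 x" using v(1) by (simp add: weights_def)
      with 0 have "AE x in (lebesgue :: 'a measure). False"
        by eventually_elim simp
      then show False
        using ae_filter_eq_bot_iff[of "lebesgue :: 'a measure"] by (simp add: trivial_limit_def)
    qed
    then show ?thesis
      unfolding admissible_def by (simp add: Lp_norm_inverse_weight[OF v(1)] weights_measurable[OF v(1)])
  qed
  show ?thesis
  proof (rule antisym)
    have "LM_norm p2 \<theta> \<omega> v2 ?g / Lp_norm top v1 ?g \<le> embed_const top v1 p2 \<theta> \<omega> v2"
      unfolding embed_const_eq by (rule SUP_upper[OF g])
    then show "LM_norm p2 \<theta> \<omega> v2 ?g \<le> embed_const top v1 p2 \<theta> \<omega> v2"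
      by (simp add: Lp_norm_inverse_weight[OF v(1)] divide_ennreal_def)
    show "embed_const top v1 p2 \<theta> \<omega> v2 \<le> LM_norm p2 \<theta> \<omega> v2 ?g"
      unfolding embed_const_eq
    proof (rule SUP_least)
      fix f assume f: "f \<in> admissible top v1"
      define N where "N = Lp_norm top v1 f"
      have [measurable]: "f \<in> borel_measurable lebesgue" and N: "0 < N" "N < top"
        using admissibleD[OF f v(1)] by (simp_all add: N_def)
      let ?B = "\<lambda>r f. wnorm lebesgue p2 (ball 0 r) (\<lambda>x. ennreal (v2 x)) (\<lambda>x. ennreal \<bar>f x\<bar>)"
      have "AE x in lebesgue. ennreal \<bar>f x\<bar> * ennreal (v1 x) \<le> N"
        using AE_le_ess_sup_on[of UNIV "\<lambda>x. ennreal \<bar>f x\<bar> * ennreal (v1 x)" lebesgue]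
        by (simp add: N_def Lp_norm_def wnorm_top)
      moreover have "AE x in lebesgue. 0 < v1 x" using v(1) by (simp add: weights_def)
      ultimately have le: "AE x in lebesgue. ennreal \<bar>f x\<bar> \<le> ennreal \<bar>?g x\<bar> * N"
      proof eventually_elim
        case (elim x)
        have "ennreal \<bar>f x\<bar> = ennreal \<bar>?g x\<bar> * (ennreal \<bar>f x\<bar> * ennreal (v1 x))"
          using elim(2) by (simp add: field_simps flip: ennreal_mult)
        also have "\<dots> \<le> ennreal \<bar>?g x\<bar> * N"
          using elim(1) by (rule mult_left_mono) simp
        finally show ?case .
      qed
      have B: "?B r f \<le> ?B r ?g * N" for r
      proof -
        have "?B r f \<le> wnorm lebesgue p2 (ball 0 r) (\<lambda>x. ennreal (v2 x)) (\<lambda>x. ennreal \<bar>?g x\<bar> * N)"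
          by (rule wnorm_mono_AE) (use le in \<open>auto elim!: eventually_mono\<close>)
        also have "\<dots> = ?B r ?g * N"
          by (rule wnorm_mult_const) (use N p in auto)
        finally show ?thesis .
      qed
      have "LM_norm p2 \<theta> \<omega> v2 f \<le> wnorm lebesgue \<theta> {0<..} (\<lambda>_. 1) (\<lambda>r. \<omega> r * ?B r ?g * N)"
        unfolding LM_norm_def
        by (intro wnorm_mono_AE AE_I2) (use B in \<open>auto simp: mult.assoc intro!: mult_left_mono\<close>)
      also have "\<dots> = LM_norm p2 \<theta> \<omega> v2 ?g * N"
        unfolding LM_norm_def by (rule wnorm_mult_const) (use N p in auto)
      finally show "LM_norm p2 \<theta> \<omega> v2 f / Lp_norm top v1 f \<le> LM_norm p2 \<theta> \<omega> v2 ?g"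
        using N by (simp add: ennreal_divide_le_iff flip: N_def)
    qed
  qed
qed

lemma wnorm_inverse_weight:
  assumes v: "v1 \<in> weights" "v2 \<in> weights" and p: "0 < p" "p < top"
  shows "wnorm lebesgue p A (\<lambda>x. ennreal (v2 x)) (\<lambda>x. ennreal \<bar>inverse (v1 x)\<bar>)
    = wnorm lebesgue p A (\<lambda>_. 1) (\<lambda>x. ennreal (inverse (v1 x) * v2 x powr (1 / enn2real p)))"
proof -
  define q where "q = enn2real p"
  have q: "q > 0" using p by (simp add: q_def enn2real_positive_iff)
  have "AE x in lebesgue. 0 < v1 x" "AE x in lebesgue. 0 < v2 x"
    using v by (auto simp: weights_def)
  then have "AE x in lebesgue. enn_powr (ennreal \<bar>inverse (v1 x)\<bar>) q * ennreal (v2 x)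
     = enn_powr (ennreal (inverse (v1 x) * v2 x powr (1 / q))) q"
    by eventually_elim (use q in \<open>simp add: enn_powr_ennreal powr_mult powr_powr flip: ennreal_mult\<close>)
  then have "(\<integral>\<^sup>+x\<in>A. enn_powr (ennreal \<bar>inverse (v1 x)\<bar>) q * ennreal (v2 x) \<partial>lebesgue)
     = (\<integral>\<^sup>+x\<in>A. enn_powr (ennreal (inverse (v1 x) * v2 x powr (1 / q))) q \<partial>lebesgue)"
    by (intro nn_integral_cong_AE) (auto elim!: eventually_mono)
  then show ?thesis
    using p by (simp add: wnorm_def less_imp_neq flip: q_def)
qed

lemma wnorm_top_inverse_weight:
  assumes v: "v1 \<in> weights" "v2 \<in> weights"
  shows "wnorm lebesgue top A (\<lambda>x. ennreal (v2 x)) (\<lambda>x. ennreal \<bar>inverse (v1 x)\<bar>)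
    = wnorm lebesgue top A (\<lambda>_. 1) (\<lambda>x. ennreal (inverse (v1 x) * v2 x))"
proof -
  have "AE x in lebesgue. 0 < v1 x" "AE x in lebesgue. 0 < v2 x"
    using v by (auto simp: weights_def)
  then have "AE x in lebesgue. ennreal \<bar>inverse (v1 x)\<bar> * ennreal (v2 x) = ennreal (inverse (v1 x) * v2 x)"
    by eventually_elim (simp flip: ennreal_mult)
  then show ?thesis
    unfolding wnorm_top mult_1_right by (intro ess_sup_on_cong_AE) (auto elim!: eventually_mono)
qed

section \<open>Explicit form of the local constant\<close>

lemma Lp_norm_ennreal:
  "0 < p \<Longrightarrow> Lp_norm (ennreal p) v f = enn_powr (\<integral>\<^sup>+x. enn_powr (ennreal \<bar>f x\<bar>) p * ennreal (v x) \<partial>lebesgue) (1 / p)"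
  by (simp add: Lp_norm_def wnorm_ennreal)

text \<open>Hoelder with exponent p1/p2 gives the upper bound. It is sharp for f =
  (v2/v1)^(1/(p1-p2)), where |f|^p1 v1 and |f|^p2 v2 both equal u^\<rho>; truncation makes this f
  admissible.\<close>

lemma local_const_Hoelder:
  fixes v1 v2 :: "'a::euclidean_space \<Rightarrow> real" and p1 p2 :: real
  assumes v: "v1 \<in> weights" "v2 \<in> weights" and p: "0 < p2" "p2 < p1"
    and A [measurable]: "A \<in> sets lebesgue"
  defines "\<rho> \<equiv> p1 * p2 / (p1 - p2)"
  defines "u \<equiv> (\<lambda>x. v1 x powr (- 1 / p1) * v2 x powr (1 / p2))"
  shows "local_const (ennreal p1) v1 (ennreal p2) v2 A = enn_powr (\<integral>\<^sup>+x\<in>A. enn_powr (ennreal (u x)) \<rho> \<partial>lebesgue) (1 / \<rho>)"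
proof (rule antisym)
  note [measurable] = weights_measurable[OF v(1)] weights_measurable[OF v(2)]
  have [measurable]: "u \<in> borel_measurable lebesgue" unfolding u_def by measurable
  have vpos: "AE x in lebesgue. 0 < v1 x" "AE x in lebesgue. 0 < v2 x"
    using v by (auto simp: weights_def)
  have p1: "p1 > 0" and \<rho>: "\<rho> > 0" using p by (auto simp: \<rho>_def)
  have e1: "1 / \<rho> + 1 / p1 = 1 / p2" "1 - p2 / p1 = p2 / \<rho>"
    using p p1 by (auto simp: \<rho>_def field_simps)
  define S where "S = (\<integral>\<^sup>+x\<in>A. enn_powr (ennreal (u x)) \<rho> \<partial>lebesgue)"
  show "local_const (ennreal p1) v1 (ennreal p2) v2 A \<le> enn_powr S (1 / \<rho>)"
    unfolding local_const_def
  proof (rule SUP_least)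
    fix f assume f: "f \<in> admissible (ennreal p1) v1"
    have [measurable]: "f \<in> borel_measurable lebesgue" and N: "0 < Lp_norm (ennreal p1) v1 f" "Lp_norm (ennreal p1) v1 f < top"
      using admissibleD[OF f v(1)] p1 by simp_all
    define N where "N = (\<integral>\<^sup>+x. enn_powr (ennreal \<bar>f x\<bar>) p1 * ennreal (v1 x) \<partial>lebesgue)"
    \<comment> \<open>Factorisation |f|^p2 v2 = (|f|^p1 v1)^(p2/p1) * u^p2; since 1 - p2/p1 =
      p2/\<rho>, the last factor is (u^\<rho>)^(1 - p2/p1).\<close>
    have "(\<integral>\<^sup>+x\<in>A. enn_powr (ennreal \<bar>f x\<bar>) p2 * ennreal (v2 x) \<partial>lebesgue)
      = (\<integral>\<^sup>+x. enn_powr (enn_powr (ennreal \<bar>f x\<bar>) p1 * ennreal (v1 x)) (p2 / p1)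
          * enn_powr (enn_powr (ennreal (u x)) \<rho> * indicator A x) (1 - p2 / p1) \<partial>lebesgue)"
    proof (rule nn_integral_cong_AE)
      show "AE x in lebesgue. enn_powr (ennreal \<bar>f x\<bar>) p2 * ennreal (v2 x) * indicator A x
        = enn_powr (enn_powr (ennreal \<bar>f x\<bar>) p1 * ennreal (v1 x)) (p2 / p1)
          * enn_powr (enn_powr (ennreal (u x)) \<rho> * indicator A x) (1 - p2 / p1)"
        using vpos
      proof eventually_elim
        case (elim x)
        have "\<bar>f x\<bar> powr p2 * v2 x = (\<bar>f x\<bar> powr p2 * v1 x powr (p2 / p1)) * (v1 x powr (- p2 / p1) * v2 x)"
          using elim by (simp add: powr_minus field_simps)
        also have "v1 x powr (- p2 / p1) * v2 x = u x powr p2"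
          using p elim by (simp add: u_def powr_mult powr_powr)
        finally have "\<bar>f x\<bar> powr p2 * v2 x = (\<bar>f x\<bar> powr p2 * v1 x powr (p2 / p1)) * u x powr p2" .
        moreover have "0 \<le> u x" by (simp add: u_def)
        ultimately show ?case
          using p p1 \<rho> elim unfolding e1
          by (cases "x \<in> A") (auto simp: enn_powr_mult enn_powr_powr enn_powr_ennreal powr_mult powr_powr simp flip: ennreal_mult)
      qed
    qed
    also have "\<dots> \<le> enn_powr N (p2 / p1) * enn_powr S (1 - p2 / p1)"
      unfolding N_def S_def using p p1 by (intro nn_integral_Hoelder) auto
    finally have "enn_powr (\<integral>\<^sup>+x\<in>A. enn_powr (ennreal \<bar>f x\<bar>) p2 * ennreal (v2 x) \<partial>lebesgue) (1 / p2)
      \<le> enn_powr (enn_powr N (p2 / p1) * enn_powr S (1 - p2 / p1)) (1 / p2)"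
      using p by (intro enn_powr_mono) auto
    also have "\<dots> = enn_powr S (1 / \<rho>) * enn_powr N (1 / p1)"
      using p unfolding e1 by (simp add: enn_powr_mult enn_powr_powr mult.commute)
    finally show "wnorm lebesgue (ennreal p2) A (\<lambda>x. ennreal (v2 x)) (\<lambda>x. ennreal \<bar>f x\<bar>) / Lp_norm (ennreal p1) v1 f
      \<le> enn_powr S (1 / \<rho>)"
      using N p p1 by (simp add: ennreal_divide_le_iff wnorm_ennreal Lp_norm_ennreal N_def)
  qed
  \<comment> \<open>Bounded sets on which u^\<rho> is bounded: they exhaust A and give u^\<rho>
    finite integral even if its integral over A is infinite.\<close>
  define B where "B n = A \<inter> ball 0 (real n) \<inter> {x. u x powr \<rho> \<le> real n}" for n :: nat
  have [measurable]: "B n \<in> sets lebesgue" for n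
    unfolding B_def by measurable
  define T where "T n = (\<integral>\<^sup>+x\<in>B n. enn_powr (ennreal (u x)) \<rho> \<partial>lebesgue)" for n
  have "S = (\<integral>\<^sup>+x. (SUP n. enn_powr (ennreal (u x)) \<rho> * indicator (B n) x) \<partial>lebesgue)"
    unfolding S_def
  proof (rule nn_integral_cong)
    fix x
    show "enn_powr (ennreal (u x)) \<rho> * indicator A x = (SUP n. enn_powr (ennreal (u x)) \<rho> * indicator (B n) x)"
    proof (cases "x \<in> A")
      case True
      obtain n where "max (norm x) (u x powr \<rho>) < real n" using reals_Archimedean2 by blast
      then have "x \<in> B n" using True by (auto simp: B_def)
      then have "enn_powr (ennreal (u x)) \<rho> * indicator A x \<le> (SUP n. enn_powr (ennreal (u x)) \<rho> * indicator (B n) x)"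
        using True by (intro SUP_upper2[of n]) auto
      moreover have "(SUP n. enn_powr (ennreal (u x)) \<rho> * indicator (B n) x) \<le> enn_powr (ennreal (u x)) \<rho> * indicator A x"
        by (intro SUP_least mult_left_mono indicator_leI) (auto simp: B_def)
      ultimately show ?thesis by order
    qed (simp add: B_def)
  qed
  also have "\<dots> = (SUP n. T n)"
    unfolding T_def
    by (intro nn_integral_monotone_convergence_SUP incseq_SucI le_funI mult_left_mono indicator_leI)
       (auto simp: B_def)
  finally have ST: "S = (SUP n. T n)" .
  show "enn_powr S (1 / \<rho>) \<le> local_const (ennreal p1) v1 (ennreal p2) v2 A"
    unfolding ST using \<rho>
  proof (subst enn_powr_SUP, simp, intro SUP_least)
    fix n
    define f where "f x = (v2 x / v1 x) powr (1 / (p1 - p2)) * indicator (B n) x" for x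
    have [measurable]: "f \<in> borel_measurable lebesgue" unfolding f_def by measurable
    have T: "(\<integral>\<^sup>+x. enn_powr (ennreal \<bar>f x\<bar>) p1 * ennreal (v1 x) \<partial>lebesgue) = T n"
            "(\<integral>\<^sup>+x\<in>A. enn_powr (ennreal \<bar>f x\<bar>) p2 * ennreal (v2 x) \<partial>lebesgue) = T n"
    proof -
      have up: "u x powr \<rho> = exp ((p1 * ln (v2 x) - p2 * ln (v1 x)) / (p1 - p2))" if "0 < v1 x" "0 < v2 x" for x
      proof -
        have "u x = exp (ln (v2 x) / p2 - ln (v1 x) / p1)"
          using that by (simp add: u_def powr_def flip: exp_add)
        then have "u x powr \<rho> = exp (\<rho> * (ln (v2 x) / p2 - ln (v1 x) / p1))"
          by (simp add: powr_def)
        also have "\<rho> * (ln (v2 x) / p2 - ln (v1 x) / p1) = (p1 * ln (v2 x) - p2 * ln (v1 x)) / (p1 - p2)"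
          using p p1 by (simp add: \<rho>_def field_simps)
        finally show ?thesis .
      qed
      have f1: "f x powr p1 * v1 x = u x powr \<rho>" "f x powr p2 * v2 x = u x powr \<rho>" if "x \<in> B n" "0 < v1 x" "0 < v2 x" for x
      proof -
        have fe: "f x = exp ((ln (v2 x) - ln (v1 x)) / (p1 - p2))"
          using that by (simp add: f_def powr_def ln_div)
        have "f x powr p1 * v1 x = exp (p1 * ((ln (v2 x) - ln (v1 x)) / (p1 - p2)) + ln (v1 x))"
          using that by (simp add: fe powr_def exp_add)
        also have "p1 * ((ln (v2 x) - ln (v1 x)) / (p1 - p2)) + ln (v1 x) = (p1 * ln (v2 x) - p2 * ln (v1 x)) / (p1 - p2)"
          using p by (simp add: field_simps)
        finally show "f x powr p1 * v1 x = u x powr \<rho>" using up that by simp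
        have "f x powr p2 * v2 x = exp (p2 * ((ln (v2 x) - ln (v1 x)) / (p1 - p2)) + ln (v2 x))"
          using that by (simp add: fe powr_def exp_add)
        also have "p2 * ((ln (v2 x) - ln (v1 x)) / (p1 - p2)) + ln (v2 x) = (p1 * ln (v2 x) - p2 * ln (v1 x)) / (p1 - p2)"
          using p by (simp add: field_simps)
        finally show "f x powr p2 * v2 x = u x powr \<rho>" using up that by simp
      qed
      have f0: "0 \<le> f x" "0 \<le> u x" for x by (simp_all add: f_def u_def)
      show "(\<integral>\<^sup>+x. enn_powr (ennreal \<bar>f x\<bar>) p1 * ennreal (v1 x) \<partial>lebesgue) = T n"
        unfolding T_def using vpos
        by (intro nn_integral_cong_AE, eventually_elim)
           (auto simp: indicator_def f0 f1 enn_powr_ennreal abs_of_nonneg simp flip: ennreal_mult, auto simp: f_def)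
      show "(\<integral>\<^sup>+x\<in>A. enn_powr (ennreal \<bar>f x\<bar>) p2 * ennreal (v2 x) \<partial>lebesgue) = T n"
        unfolding T_def using vpos
        by (intro nn_integral_cong_AE, eventually_elim)
           (auto simp: indicator_def f0 f1 enn_powr_ennreal abs_of_nonneg simp flip: ennreal_mult, auto simp: f_def B_def)
    qed
    have "T n \<le> (\<integral>\<^sup>+x. ennreal (real n) * indicator (ball (0::'a) (real n)) x \<partial>lebesgue)"
      unfolding T_def
      by (intro nn_integral_mono) (auto simp: indicator_def B_def enn_powr_ennreal u_def intro!: ennreal_leI)
    also have "\<dots> < top"
      using emeasure_bounded_finite[of "ball (0::'a) (real n)"]
      by (simp add: nn_integral_cmult ennreal_mult_less_top less_top)
    finally have Tfin: "T n < top" .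
    show "enn_powr (T n) (1 / \<rho>) \<le> local_const (ennreal p1) v1 (ennreal p2) v2 A"
    proof (cases "T n = 0")
      case False
      then have T0: "0 < T n" by (simp add: zero_less_iff_neq_zero)
      have Lp: "Lp_norm (ennreal p1) v1 f = enn_powr (T n) (1 / p1)"
        using p1 T by (simp add: Lp_norm_ennreal)
      have "wnorm lebesgue (ennreal p2) A (\<lambda>x. ennreal (v2 x)) (\<lambda>x. ennreal \<bar>f x\<bar>) = enn_powr (T n) (1 / p2)"
        using p T by (simp add: wnorm_ennreal)
      \<comment> \<open>The common factor T^(1/p1) is cancelled below; this is where 0 < T n <
        \<open>top\<close> enters.\<close>
      also have "\<dots> = enn_powr (T n) (1 / \<rho>) * enn_powr (T n) (1 / p1)"
        by (simp flip: e1 add: enn_powr_add)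
      finally have w: "wnorm lebesgue (ennreal p2) A (\<lambda>x. ennreal (v2 x)) (\<lambda>x. ennreal \<bar>f x\<bar>) = enn_powr (T n) (1 / \<rho>) * enn_powr (T n) (1 / p1)" .
      have "wnorm lebesgue (ennreal p2) A (\<lambda>x. ennreal (v2 x)) (\<lambda>x. ennreal \<bar>f x\<bar>) \<le> local_const (ennreal p1) v1 (ennreal p2) v2 A * Lp_norm (ennreal p1) v1 f"
        using v p p1 Tfin by (intro local_const_bound) (auto simp: Lp)
      then show ?thesis
        unfolding w Lp using T0 Tfin
        by (simp add: mult.commute[of _ "enn_powr (T n) (1 / p1)"] ennreal_mult_le_mult_iff)
    qed simp
  qed
qed

text \<open>Here v2 = u^p v1 a.e., so the upper bound is pointwise. Conversely, if u exceeded the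
  constant K on a set of positive measure, the indicator of a suitable part of that set would
  violate the definition of K.\<close>

lemma local_const_diagonal:
  fixes v1 v2 :: "'a::euclidean_space \<Rightarrow> real" and p :: real
  assumes v: "v1 \<in> weights" "v2 \<in> weights" and p: "0 < p"
    and A [measurable]: "A \<in> sets lebesgue"
  defines "u \<equiv> (\<lambda>x. v1 x powr (- 1 / p) * v2 x powr (1 / p))"
  shows "local_const (ennreal p) v1 (ennreal p) v2 A = ess_sup_on lebesgue A (\<lambda>x. ennreal (u x))"
proof (rule antisym)
  note [measurable] = weights_measurable[OF v(1)] weights_measurable[OF v(2)]
  have vpos: "AE x in lebesgue. 0 < v1 x" "AE x in lebesgue. 0 < v2 x"
    using v by (auto simp: weights_def)
  have u: "ennreal (v2 x) = enn_powr (ennreal (u x)) p * ennreal (v1 x)" if "0 < v1 x" "0 < v2 x" for x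
  proof -
    have "u x powr p = v1 x powr (-1) * v2 x"
      using that p by (simp add: u_def powr_mult powr_powr)
    then have "v2 x = u x powr p * v1 x"
      using that by (simp add: powr_minus)
    moreover have "0 \<le> u x" by (simp add: u_def)
    ultimately show ?thesis
      using that by (simp add: enn_powr_ennreal flip: ennreal_mult)
  qed
  define S where "S = ess_sup_on lebesgue A (\<lambda>x. ennreal (u x))"
  define K where "K = local_const (ennreal p) v1 (ennreal p) v2 A"
  show "local_const (ennreal p) v1 (ennreal p) v2 A \<le> S"
    unfolding local_const_def
  proof (rule SUP_least)
    fix f assume f: "f \<in> admissible (ennreal p) v1"
    have [measurable]: "f \<in> borel_measurable lebesgue" and N: "0 < Lp_norm (ennreal p) v1 f" "Lp_norm (ennreal p) v1 f < top"
      using admissibleD[OF f v(1)] p by simp_all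
    define N where "N = (\<integral>\<^sup>+x. enn_powr (ennreal \<bar>f x\<bar>) p * ennreal (v1 x) \<partial>lebesgue)"
    have "AE x in lebesgue. x \<in> A \<longrightarrow> ennreal (u x) \<le> S"
      unfolding S_def by (rule AE_le_ess_sup_on)
    with vpos have "AE x in lebesgue. enn_powr (ennreal \<bar>f x\<bar>) p * ennreal (v2 x) * indicator A x
       \<le> enn_powr S p * (enn_powr (ennreal \<bar>f x\<bar>) p * ennreal (v1 x))"
    proof eventually_elim
      case (elim x)
      show ?case
      proof (cases "x \<in> A")
        case True
        then have "enn_powr (ennreal (u x)) p \<le> enn_powr S p" using elim p by (intro enn_powr_mono) auto
        then have "enn_powr (ennreal (u x)) p * (enn_powr (ennreal \<bar>f x\<bar>) p * ennreal (v1 x))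
            \<le> enn_powr S p * (enn_powr (ennreal \<bar>f x\<bar>) p * ennreal (v1 x))"
          by (rule mult_right_mono) simp
        then show ?thesis using True elim by (simp add: u ac_simps)
      qed simp
    qed
    then have "(\<integral>\<^sup>+x\<in>A. enn_powr (ennreal \<bar>f x\<bar>) p * ennreal (v2 x) \<partial>lebesgue)
      \<le> (\<integral>\<^sup>+x. enn_powr S p * (enn_powr (ennreal \<bar>f x\<bar>) p * ennreal (v1 x)) \<partial>lebesgue)"
      by (rule nn_integral_mono_AE)
    also have "\<dots> = enn_powr S p * N"
      unfolding N_def by (rule nn_integral_cmult) measurable
    finally have "enn_powr (\<integral>\<^sup>+x\<in>A. enn_powr (ennreal \<bar>f x\<bar>) p * ennreal (v2 x) \<partial>lebesgue) (1 / p)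
      \<le> enn_powr (enn_powr S p * N) (1 / p)"
      using p by (intro enn_powr_mono) auto
    also have "\<dots> = S * enn_powr N (1 / p)"
      using p by (simp add: enn_powr_mult enn_powr_powr)
    finally show "wnorm lebesgue (ennreal p) A (\<lambda>x. ennreal (v2 x)) (\<lambda>x. ennreal \<bar>f x\<bar>) / Lp_norm (ennreal p) v1 f \<le> S"
      using N p by (simp add: ennreal_divide_le_iff wnorm_ennreal Lp_norm_ennreal N_def)
  qed
  \<comment> \<open>The bounds by n on the norm of x and on v1 make the indicator of this set an
    element of the source space; n is removed at the end by a countable union.\<close>
  have *: "AE x in lebesgue. \<not> (x \<in> A \<and> norm x < real n \<and> v1 x \<le> real n \<and> enn_powr K p * ennreal (v1 x) < ennreal (v2 x))"
    for n :: nat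
  proof (rule ccontr)
    define B where "B = A \<inter> ball 0 (real n) \<inter> {x. v1 x \<le> real n \<and> enn_powr K p * ennreal (v1 x) < ennreal (v2 x)}"
    have [measurable]: "B \<in> sets lebesgue" unfolding B_def by measurable
    assume "\<not> (AE x in lebesgue. \<not> (x \<in> A \<and> norm x < real n \<and> v1 x \<le> real n \<and> enn_powr K p * ennreal (v1 x) < ennreal (v2 x)))"
    then have B: "\<not> (AE x in lebesgue. x \<notin> B)" by (simp add: B_def)
    \<comment> \<open>For infinite K the strict inequality in B would read \<open>top\<close> < v2 x
      wherever v1 > 0, so B would be null. Finiteness is required by
      \<open>nn_integral_less\<close>.\<close>
    have Kfin: "K < top"
    proof (rule ccontr)
      assume "\<not> K < top"
      then have "K = top" by (simp add: not_less top_unique)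
      then have "AE x in lebesgue. x \<notin> B"
        using vpos by (auto elim!: eventually_mono simp: B_def ennreal_top_mult)
      with B show False by simp
    qed
    define f :: "'a \<Rightarrow> real" where "f = indicator B"
    have [measurable]: "f \<in> borel_measurable lebesgue" unfolding f_def by measurable
    have fi: "enn_powr (ennreal \<bar>f x\<bar>) p = indicator B x" for x by (simp add: f_def indicator_def)
    define N where "N = (\<integral>\<^sup>+x. ennreal (v1 x) * indicator B x \<partial>lebesgue)"
    have Lp: "Lp_norm (ennreal p) v1 f = enn_powr N (1 / p)"
      using p by (simp add: Lp_norm_ennreal fi N_def mult.commute)
    have "N \<le> (\<integral>\<^sup>+x. ennreal (real n) * indicator (ball (0::'a) (real n)) x \<partial>lebesgue)"
      unfolding N_def by (intro nn_integral_mono) (auto simp: indicator_def B_def intro!: ennreal_leI)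
    also have "\<dots> < top"
      using emeasure_bounded_finite[of "ball (0::'a) (real n)"]
      by (simp add: nn_integral_cmult ennreal_mult_less_top less_top)
    finally have Nfin: "N < top" .
    have "(\<integral>\<^sup>+x. enn_powr K p * (ennreal (v1 x) * indicator B x) \<partial>lebesgue) < (\<integral>\<^sup>+x. ennreal (v2 x) * indicator B x \<partial>lebesgue)"
    proof (rule nn_integral_less)
      show "(\<integral>\<^sup>+x. enn_powr K p * (ennreal (v1 x) * indicator B x) \<partial>lebesgue) \<noteq> \<infinity>"
        using Nfin Kfin by (subst nn_integral_cmult) (auto simp: N_def ennreal_mult_eq_top_iff)
      show "AE x in lebesgue. enn_powr K p * (ennreal (v1 x) * indicator B x) \<le> ennreal (v2 x) * indicator B x"
        by (auto simp: B_def indicator_def)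
      show "\<not> (AE x in lebesgue. ennreal (v2 x) * indicator B x \<le> enn_powr K p * (ennreal (v1 x) * indicator B x))"
      proof
        assume "AE x in lebesgue. ennreal (v2 x) * indicator B x \<le> enn_powr K p * (ennreal (v1 x) * indicator B x)"
        then have "AE x in lebesgue. x \<notin> B"
          by eventually_elim (auto simp: B_def indicator_def)
        with B show False by simp
      qed
    qed measurable
    also have "(\<integral>\<^sup>+x. ennreal (v2 x) * indicator B x \<partial>lebesgue) = (\<integral>\<^sup>+x\<in>A. enn_powr (ennreal \<bar>f x\<bar>) p * ennreal (v2 x) \<partial>lebesgue)"
      unfolding fi by (intro nn_integral_cong) (auto simp: indicator_def B_def)
    also have "(\<integral>\<^sup>+x\<in>A. enn_powr (ennreal \<bar>f x\<bar>) p * ennreal (v2 x) \<partial>lebesgue) \<le> enn_powr (K * Lp_norm (ennreal p) v1 f) p"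
    proof -
      have "wnorm lebesgue (ennreal p) A (\<lambda>x. ennreal (v2 x)) (\<lambda>x. ennreal \<bar>f x\<bar>) \<le> K * Lp_norm (ennreal p) v1 f"
        unfolding K_def using p Nfin v by (intro local_const_bound) (auto simp: Lp)
      then have "enn_powr (\<integral>\<^sup>+x\<in>A. enn_powr (ennreal \<bar>f x\<bar>) p * ennreal (v2 x) \<partial>lebesgue) (1 / p) \<le> K * Lp_norm (ennreal p) v1 f"
        using p by (simp add: wnorm_ennreal)
      then show ?thesis
        using p enn_powr_le_iff[of "1 / p"] by simp
    qed
    also have "\<dots> = enn_powr K p * N"
      using p by (simp add: Lp enn_powr_mult enn_powr_powr)
    also have "\<dots> = (\<integral>\<^sup>+x. enn_powr K p * (ennreal (v1 x) * indicator B x) \<partial>lebesgue)"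
      unfolding N_def by (rule nn_integral_cmult[symmetric]) measurable
    finally show False by simp
  qed
  have "AE x in lebesgue. \<forall>n. \<not> (x \<in> A \<and> norm x < real n \<and> v1 x \<le> real n \<and> enn_powr K p * ennreal (v1 x) < ennreal (v2 x))"
    using * by (subst AE_all_countable) blast
  with vpos have "AE x in lebesgue. x \<in> A \<longrightarrow> ennreal (u x) \<le> K"
  proof (eventually_elim, intro impI)
    fix x
    assume x: "0 < v1 x" "0 < v2 x" "x \<in> A"
      and n: "\<forall>n. \<not> (x \<in> A \<and> norm x < real n \<and> v1 x \<le> real n \<and> enn_powr K p * ennreal (v1 x) < ennreal (v2 x))"
    obtain m where "max (norm x) (v1 x) < real m" using reals_Archimedean2 by blast
    with n x have "ennreal (v2 x) \<le> enn_powr K p * ennreal (v1 x)"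
      by (auto simp: not_less dest!: spec[of _ m])
    then have "ennreal (v1 x) * enn_powr (ennreal (u x)) p \<le> ennreal (v1 x) * enn_powr K p"
      using x by (simp add: u mult.commute)
    then have "enn_powr (ennreal (u x)) p \<le> enn_powr K p"
      using x by (subst (asm) ennreal_mult_le_mult_iff) auto
    then show "ennreal (u x) \<le> K" using p by (simp add: enn_powr_le_cancel)
  qed
  then show "S \<le> local_const (ennreal p) v1 (ennreal p) v2 A"
    unfolding S_def K_def by (simp add: ess_sup_on_le_iff)
qed

section \<open>Upper bounds\<close>

lemma AE_norm_neq: "AE x::'a::euclidean_space in lebesgue. norm x \<noteq> r"
proof -
  have "sphere (0::'a) r \<in> null_sets lebesgue"
    using negligible_sphere by (simp add: negligible_iff_null_sets)
  then show ?thesis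
    by (rule AE_I') (auto simp: sphere_def)
qed

lemma borel_measurable_lebesgueI: "f \<in> borel_measurable borel \<Longrightarrow> f \<in> borel_measurable lebesgue"
  by (intro measurable_completion) simp

lemma ident_borel_measurable_lebesgue [measurable]: "(\<lambda>x. x) \<in> borel_measurable lebesgue"
  by (intro borel_measurable_lebesgueI) simp

lemma indicator_lessThan_norm: "indicator {..<r} (norm x) = (indicator (ball 0 r) x :: ennreal)"
  by (simp add: indicator_def)

text \<open>The W of the overview. It may be infinite at t = 0, but for weights in
  \<open>Omega\<close> it is positive and finite at every t > 0.\<close>

definition tail_mass :: "real \<Rightarrow> (real \<Rightarrow> ennreal) \<Rightarrow> real \<Rightarrow> ennreal" where
  "tail_mass \<theta> \<omega> t = (\<integral>\<^sup>+r. enn_powr (\<omega> r) \<theta> * indicator {t<..} r \<partial>lebesgue)"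

lemma wnorm_tail: "0 < \<theta> \<Longrightarrow> wnorm lebesgue (ennreal \<theta>) {t<..} (\<lambda>_. 1) \<omega> = enn_powr (tail_mass \<theta> \<omega> t) (1 / \<theta>)"
  by (simp add: wnorm_ennreal tail_mass_def)

lemma OmegaD:
  assumes "\<omega> \<in> Omega \<theta>"
  shows "\<omega> \<in> borel_measurable lebesgue"
  using assms by (simp add: Omega_def)

lemma Omega_tail_mass:
  assumes "\<omega> \<in> Omega (ennreal \<theta>)" "0 < \<theta>" "0 < t"
  shows "0 < tail_mass \<theta> \<omega> t" "tail_mass \<theta> \<omega> t < top"
  using assms by (auto simp: Omega_def wnorm_tail)

lemma tail_mass_antimono: "s \<le> t \<Longrightarrow> tail_mass \<theta> \<omega> t \<le> tail_mass \<theta> \<omega> s"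
  unfolding tail_mass_def by (intro nn_integral_mono) (auto simp: indicator_def)

lemma borel_measurable_tail_mass [measurable]: "tail_mass \<theta> \<omega> \<in> borel_measurable borel"
proof -
  have "(\<lambda>t. tail_mass \<theta> \<omega> (- t)) \<in> borel_measurable borel"
    by (rule mono_borel_measurable) (auto simp: mono_def intro!: tail_mass_antimono)
  then have "(\<lambda>t. tail_mass \<theta> \<omega> (- (- t))) \<in> borel_measurable borel"
    by measurable
  then show ?thesis by simp
qed

text \<open>Reflection makes W the distribution function of h x = -x, so the results on increasing
  distribution functions apply to it.\<close>

lemma tail_mass_uminus: "tail_mass \<theta> \<omega> (- r) = (\<integral>\<^sup>+x. enn_powr (\<omega> x) \<theta> * indicator {..<r} (- x) \<partial>lebesgue)"
  unfolding tail_mass_def by (intro nn_integral_cong) (simp add: indicator_def)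

lemma AE_uminus_neq: "AE x in lebesgue. - x \<noteq> (r :: real)"
  using AE_norm_neq[of 0] by (intro AE_I'[of "{- r}"]) auto

lemma tail_mass_sublevel_le:
  assumes [measurable]: "\<omega> \<in> borel_measurable lebesgue"
  shows "(\<integral>\<^sup>+s. enn_powr (\<omega> s) \<theta> * indicator {..c} (tail_mass \<theta> \<omega> s) \<partial>lebesgue) \<le> c"
proof -
  have eq: "tail_mass \<theta> \<omega> s = (\<integral>\<^sup>+x. enn_powr (\<omega> x) \<theta> * indicator {..< - s} (- x) \<partial>lebesgue)" for s
    using tail_mass_uminus[of \<theta> \<omega> "- s"] by simp
  show ?thesis
    unfolding eq by (rule nn_integral_sublevel_le[OF _ _ AE_uminus_neq]) measurable
qed

text \<open>With F = |f|^p2 v2 this is the g of the overview; it is the distribution function of h x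
  = \<open>norm x\<close>.\<close>

definition ball_mass :: "('a::euclidean_space \<Rightarrow> ennreal) \<Rightarrow> real \<Rightarrow> ennreal" where
  "ball_mass F r = (\<integral>\<^sup>+x. F x * indicator (ball 0 r) x \<partial>lebesgue)"

lemma ball_mass_mono: "r \<le> s \<Longrightarrow> ball_mass F r \<le> ball_mass F s"
  unfolding ball_mass_def by (intro nn_integral_mono) (auto simp: indicator_def)

lemma ball_mass_0 [simp]: "ball_mass F 0 = 0"
  by (simp add: ball_mass_def)

lemma borel_measurable_ball_mass [measurable]: "ball_mass F \<in> borel_measurable borel"
  by (rule mono_borel_measurable) (simp add: mono_def ball_mass_mono)

lemma ball_mass_sublevel_le:
  assumes [measurable]: "F \<in> borel_measurable lebesgue"
  shows "(\<integral>\<^sup>+x. F x * indicator {..c} (ball_mass F (norm x)) \<partial>lebesgue) \<le> c"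
  unfolding ball_mass_def indicator_lessThan_norm[symmetric]
  by (rule nn_integral_sublevel_le[OF assms borel_measurable_lebesgueI AE_norm_neq]) simp

lemma continuous_on_ball_mass:
  assumes [measurable]: "F \<in> borel_measurable lebesgue" and "ball_mass F b < top"
  shows "continuous_on {..b} (ball_mass F)"
  using continuous_on_distribution[OF assms(1) borel_measurable_lebesgueI AE_norm_neq, of b] assms(2)
  by (simp add: ball_mass_def indicator_lessThan_norm)

text \<open>The mass 2^(k+1) of \<open>ball 0 r\<close> splits into the part where g(|x|) <= 2^k, of
  mass at most 2^k, and the part in layer k, which must carry the rest. The definition of K is then
  applied to f restricted to that layer.\<close>

lemma ball_block:
  fixes v1 v2 f :: "'a::euclidean_space \<Rightarrow> real" and p1 p2 :: real and F :: "'a \<Rightarrow> ennreal"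
  assumes v: "v1 \<in> weights" "v2 \<in> weights" and p: "0 < p1" "0 < p2"
    and [measurable]: "f \<in> borel_measurable lebesgue" and fin: "Lp_norm (ennreal p1) v1 f < top"
    and F: "F = (\<lambda>x. enn_powr (ennreal \<bar>f x\<bar>) p2 * ennreal (v2 x))"
    and a_def: "a = (\<integral>\<^sup>+x. enn_powr (ennreal \<bar>f x\<bar>) p1 * ennreal (v1 x) * indicator (dyadic k) (ball_mass F (norm x)) \<partial>lebesgue)"
    and s: "0 < s" "ball_mass F s \<in> dyadic (k + 1)"
  obtains r where "0 < r" "ball_mass F r = ennreal (2 powr real_of_int (k + 1))"
    "ennreal (2 powr real_of_int k) \<le> enn_powr (local_const (ennreal p1) v1 (ennreal p2) v2 (ball 0 r)) p2 * enn_powr a (p2 / p1)"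
proof -
  note [measurable] = weights_measurable[OF v(1)] weights_measurable[OF v(2)]
  have [measurable]: "F \<in> borel_measurable lebesgue" unfolding F by measurable
  have "ball_mass F s < top"
    using s(2) unfolding dyadic_def by (auto intro: le_less_trans)
  then have "continuous_on {0..s} (ball_mass F)"
    using continuous_on_ball_mass[of F s] by (auto intro: continuous_on_subset)
  \<comment> \<open>Intermediate values between g(0) = 0 and g(s) > 2^(k+1).\<close>
  then obtain r where r: "0 \<le> r" "r \<le> s" "ball_mass F r = ennreal (2 powr real_of_int (k + 1))"
    using IVT'[of "ball_mass F" 0 "ennreal (2 powr real_of_int (k + 1))" s] s
    unfolding dyadic_def greaterThanAtMost_iff by (auto dest: less_imp_le)
  have r0: "0 < r" using r by (cases "r = 0") auto
  define D :: "'a set" where "D = {x. ball_mass F (norm x) \<in> dyadic k}"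
  have [measurable]: "D \<in> sets lebesgue"
  proof -
    have "(\<lambda>x. ball_mass F (norm x)) \<in> borel_measurable lebesgue" by measurable
    from measurable_sets[OF this dyadic_measurable[of k]] show ?thesis
      by (simp add: D_def vimage_def)
  qed
  define X where "X = (\<integral>\<^sup>+x. F x * indicator D x * indicator (ball 0 r) x \<partial>lebesgue)"
  have two: "ennreal (2 powr real_of_int (k + 1)) = ennreal (2 powr real_of_int k) + ennreal (2 powr real_of_int k)"
    by (simp add: powr_add flip: ennreal_plus)
  have "ennreal (2 powr real_of_int (k + 1)) \<le> (\<integral>\<^sup>+x. F x * indicator {..ennreal (2 powr real_of_int k)} (ball_mass F (norm x)) + F x * indicator D x * indicator (ball 0 r) x \<partial>lebesgue)"
    unfolding r(3)[symmetric] ball_mass_def[of F r]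
  proof (rule nn_integral_mono)
    fix x :: 'a
    show "F x * indicator (ball 0 r) x \<le> F x * indicator {..ennreal (2 powr real_of_int k)} (ball_mass F (norm x)) + F x * indicator D x * indicator (ball 0 r) x"
    proof (cases "x \<in> ball 0 r")
      case True
      then have "ball_mass F (norm x) \<le> ennreal (2 powr real_of_int (k + 1))"
        unfolding r(3)[symmetric] by (intro ball_mass_mono) simp
      then have "ball_mass F (norm x) \<le> ennreal (2 powr real_of_int k) \<or> x \<in> D"
        by (auto simp: D_def dyadic_def)
      with True show ?thesis by (auto simp: indicator_def)
    qed simp
  qed
  also have "\<dots> = (\<integral>\<^sup>+x. F x * indicator {..ennreal (2 powr real_of_int k)} (ball_mass F (norm x)) \<partial>lebesgue) + X"
    unfolding X_def by (rule nn_integral_add) measurable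
  also have "\<dots> \<le> ennreal (2 powr real_of_int k) + X"
    by (intro add_right_mono ball_mass_sublevel_le) measurable
  finally have "ennreal (2 powr real_of_int k) \<le> X"
    unfolding two by (simp add: ennreal_add_left_cancel_le)
  also have "X \<le> enn_powr (local_const (ennreal p1) v1 (ennreal p2) v2 (ball 0 r)) p2 * enn_powr a (p2 / p1)"
  proof -
    \<comment> \<open>The source norm of the restriction over the whole space is a^(1/p1); the a for
      different k add up to at most the full integral of |f|^p1 v1.\<close>
    define fD where "fD x = f x * indicator D x" for x
    have [measurable]: "fD \<in> borel_measurable lebesgue" unfolding fD_def by measurable
    have fD: "enn_powr (ennreal \<bar>fD x\<bar>) q = enn_powr (ennreal \<bar>f x\<bar>) q * indicator D x" for x q
      by (simp add: fD_def indicator_def)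
    have Lp: "Lp_norm (ennreal p1) v1 fD = enn_powr a (1 / p1)"
      using p by (simp add: Lp_norm_ennreal a_def fD) (simp add: D_def indicator_def ac_simps)
    have "Lp_norm (ennreal p1) v1 fD \<le> Lp_norm (ennreal p1) v1 f"
      unfolding Lp_norm_def by (intro wnorm_mono_AE AE_I2) (auto simp: fD_def indicator_def)
    then have "wnorm lebesgue (ennreal p2) (ball 0 r) (\<lambda>x. ennreal (v2 x)) (\<lambda>x. ennreal \<bar>fD x\<bar>)
      \<le> local_const (ennreal p1) v1 (ennreal p2) v2 (ball 0 r) * Lp_norm (ennreal p1) v1 fD"
      using fin p v by (intro local_const_bound) auto
    moreover have "wnorm lebesgue (ennreal p2) (ball 0 r) (\<lambda>x. ennreal (v2 x)) (\<lambda>x. ennreal \<bar>fD x\<bar>) = enn_powr X (1 / p2)"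
      using p by (simp add: wnorm_ennreal fD X_def F ac_simps)
    ultimately have "enn_powr X (1 / p2) \<le> local_const (ennreal p1) v1 (ennreal p2) v2 (ball 0 r) * enn_powr a (1 / p1)"
      by (simp add: Lp)
    then have "X \<le> enn_powr (local_const (ennreal p1) v1 (ennreal p2) v2 (ball 0 r) * enn_powr a (1 / p1)) p2"
      using p enn_powr_le_iff[of "1 / p2" X] by simp
    then show ?thesis
      using p by (simp add: enn_powr_mult enn_powr_powr)
  qed
  finally show ?thesis
    using that r0 r by blast
qed

lemma LM_norm_ennreal:
  fixes p2 \<theta> :: real
  assumes "0 < p2" "0 < \<theta>"
  shows "LM_norm (ennreal p2) (ennreal \<theta>) \<omega> v f = enn_powr
    (\<integral>\<^sup>+s. enn_powr (\<omega> s) \<theta> * enn_powr (ball_mass (\<lambda>x. enn_powr (ennreal \<bar>f x\<bar>) p2 * ennreal (v x)) s) (\<theta> / p2)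
      * indicator {0<..} s \<partial>lebesgue) (1 / \<theta>)"
  using assms unfolding LM_norm_def
  by (simp add: wnorm_ennreal ball_mass_def enn_powr_mult enn_powr_powr)

text \<open>Carries \<open>ball_block\<close> over to the radii of level k + 1. They all lie beyond
  r, so their \<omega>-mass can be compared with W(r), and K(r) with K(s).\<close>

lemma LM_block:
  fixes v1 v2 f :: "'a::euclidean_space \<Rightarrow> real" and p1 p2 \<theta> :: real and F :: "'a \<Rightarrow> ennreal"
  assumes v: "v1 \<in> weights" "v2 \<in> weights" and p: "0 < p1" "0 < p2" "0 < \<theta>"
    and [measurable]: "f \<in> borel_measurable lebesgue" "\<omega> \<in> borel_measurable lebesgue"
    and fin: "Lp_norm (ennreal p1) v1 f < top"
    and F: "F = (\<lambda>x. enn_powr (ennreal \<bar>f x\<bar>) p2 * ennreal (v2 x))"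
    and a_def: "a = (\<integral>\<^sup>+x. enn_powr (ennreal \<bar>f x\<bar>) p1 * ennreal (v1 x) * indicator (dyadic k) (ball_mass F (norm x)) \<partial>lebesgue)"
  obtains r where "0 < r" "\<And>s. 0 < s \<Longrightarrow> ball_mass F s \<in> dyadic (k + 1) \<Longrightarrow> r < s"
    "(\<integral>\<^sup>+s. enn_powr (\<omega> s) \<theta> * enn_powr (ball_mass F s) (\<theta> / p2) * indicator {0<..} s
        * indicator (dyadic (k + 1)) (ball_mass F s) \<partial>lebesgue)
     \<le> ennreal (4 powr (\<theta> / p2)) * (enn_powr (local_const (ennreal p1) v1 (ennreal p2) v2 (ball 0 r)) \<theta> * enn_powr a (\<theta> / p1)
        * (\<integral>\<^sup>+s. enn_powr (\<omega> s) \<theta> * indicator {0<..} s * indicator (dyadic (k + 1)) (ball_mass F s) \<partial>lebesgue))"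
proof (cases "\<exists>s>0. ball_mass F s \<in> dyadic (k + 1)")
  case False
  then have "(\<integral>\<^sup>+s. enn_powr (\<omega> s) \<theta> * enn_powr (ball_mass F s) (\<theta> / p2) * indicator {0<..} s
        * indicator (dyadic (k + 1)) (ball_mass F s) \<partial>lebesgue) = integral\<^sup>N lebesgue (\<lambda>s::real. 0)"
    by (intro nn_integral_cong) (auto simp: indicator_def)
  with False show ?thesis
    \<comment> \<open>No radius has this level: the integral is 0 and any positive r will
      do.\<close>
    by (intro that[of 1]) auto
next
  case True
  then obtain s where s: "0 < s" "ball_mass F s \<in> dyadic (k + 1)" by blast
  obtain r where r: "0 < r" "ball_mass F r = ennreal (2 powr real_of_int (k + 1))"
    "ennreal (2 powr real_of_int k) \<le> enn_powr (local_const (ennreal p1) v1 (ennreal p2) v2 (ball 0 r)) p2 * enn_powr a (p2 / p1)"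
    by (rule ball_block[OF v p(1,2) assms(6) fin F a_def s])
  define K where "K = local_const (ennreal p1) v1 (ennreal p2) v2 (ball 0 r)"
  have rs: "r < s" if "0 < s" "ball_mass F s \<in> dyadic (k + 1)" for s
  proof (rule ccontr)
    assume "\<not> r < s"
    then have "ball_mass F s \<le> ennreal (2 powr real_of_int (k + 1))"
      unfolding r(2)[symmetric] by (intro ball_mass_mono) simp
    then have "\<not> ennreal (2 powr real_of_int (k + 1)) < ball_mass F s" by (simp only: not_less)
    then show False using that by (auto simp only: dyadic_def greaterThanAtMost_iff)
  qed
  \<comment> \<open>At these radii g is at most 2^(k+2) = 4 * 2^k, four times the lower bound for
    the layer mass.\<close>
  have "enn_powr (ennreal (2 powr real_of_int (k + 2))) (\<theta> / p2) = ennreal (4 powr (\<theta> / p2)) * enn_powr (ennreal (2 powr real_of_int k)) (\<theta> / p2)"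
    by (simp add: powr_add enn_powr_mult enn_powr_ennreal powr_mult mult.commute flip: ennreal_mult)
  also have "\<dots> \<le> ennreal (4 powr (\<theta> / p2)) * enn_powr (enn_powr K p2 * enn_powr a (p2 / p1)) (\<theta> / p2)"
    unfolding K_def using p by (intro mult_left_mono enn_powr_mono r(3)) auto
  also have "\<dots> = ennreal (4 powr (\<theta> / p2)) * (enn_powr K \<theta> * enn_powr a (\<theta> / p1))"
    using p by (simp add: enn_powr_mult enn_powr_powr)
  finally have C: "enn_powr (ennreal (2 powr real_of_int (k + 2))) (\<theta> / p2) \<le> ennreal (4 powr (\<theta> / p2)) * (enn_powr K \<theta> * enn_powr a (\<theta> / p1))" .
  have "(\<integral>\<^sup>+s. enn_powr (\<omega> s) \<theta> * enn_powr (ball_mass F s) (\<theta> / p2) * indicator {0<..} s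
        * indicator (dyadic (k + 1)) (ball_mass F s) \<partial>lebesgue)
    \<le> (\<integral>\<^sup>+s. (ennreal (4 powr (\<theta> / p2)) * (enn_powr K \<theta> * enn_powr a (\<theta> / p1))) * (enn_powr (\<omega> s) \<theta> * indicator {0<..} s
        * indicator (dyadic (k + 1)) (ball_mass F s)) \<partial>lebesgue)"
  proof (rule nn_integral_mono)
    fix s
    show "enn_powr (\<omega> s) \<theta> * enn_powr (ball_mass F s) (\<theta> / p2) * indicator {0<..} s * indicator (dyadic (k + 1)) (ball_mass F s)
      \<le> (ennreal (4 powr (\<theta> / p2)) * (enn_powr K \<theta> * enn_powr a (\<theta> / p1))) * (enn_powr (\<omega> s) \<theta> * indicator {0<..} s
        * indicator (dyadic (k + 1)) (ball_mass F s))"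
    proof (cases "ball_mass F s \<in> dyadic (k + 1)")
      case True
      then have "enn_powr (ball_mass F s) (\<theta> / p2) \<le> enn_powr (ennreal (2 powr real_of_int (k + 2))) (\<theta> / p2)"
        using p by (intro enn_powr_mono) (auto simp: dyadic_def add.commute)
      also note C
      finally have "enn_powr (ball_mass F s) (\<theta> / p2) * (enn_powr (\<omega> s) \<theta> * indicator {0<..} s)
        \<le> (ennreal (4 powr (\<theta> / p2)) * (enn_powr K \<theta> * enn_powr a (\<theta> / p1))) * (enn_powr (\<omega> s) \<theta> * indicator {0<..} s)"
        by (rule mult_right_mono) simp
      then show ?thesis using True by (simp add: ac_simps)
    qed simp
  qed
  also have "\<dots> = (ennreal (4 powr (\<theta> / p2)) * (enn_powr K \<theta> * enn_powr a (\<theta> / p1))) * (\<integral>\<^sup>+s. enn_powr (\<omega> s) \<theta> * indicator {0<..} s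
        * indicator (dyadic (k + 1)) (ball_mass F s) \<partial>lebesgue)"
    by (rule nn_integral_cmult) measurable
  finally show ?thesis
    using that[OF r(1) rs] by (simp add: K_def ac_simps)
qed

text \<open>Radii with g(s) = 0 contribute nothing and g(s) = \<open>top\<close> is excluded by
  \<open>fin\<close>, so the dyadic levels account for the whole integral.\<close>

lemma LM_integral_dyadic:
  assumes [measurable]: "\<omega> \<in> borel_measurable lebesgue"
    and fin: "\<And>s. 0 < s \<Longrightarrow> ball_mass F s < top" and p: "0 < p2" "0 < \<theta>"
  shows "(\<integral>\<^sup>+s. enn_powr (\<omega> s) \<theta> * enn_powr (ball_mass F s) (\<theta> / p2) * indicator {0<..} s \<partial>lebesgue)
    = (\<integral>\<^sup>+k. (\<integral>\<^sup>+s. enn_powr (\<omega> s) \<theta> * enn_powr (ball_mass F s) (\<theta> / p2) * indicator {0<..} s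
        * indicator (dyadic (k + 1)) (ball_mass F s) \<partial>lebesgue) \<partial>count_space UNIV)"
proof -
  have "(\<integral>\<^sup>+s. enn_powr (\<omega> s) \<theta> * enn_powr (ball_mass F s) (\<theta> / p2) * indicator {0<..} s \<partial>lebesgue)
    = (\<integral>\<^sup>+s. enn_powr (\<omega> s) \<theta> * enn_powr (ball_mass F s) (\<theta> / p2) * indicator {0<..} s
        * indicator {0<..<top} (ball_mass F s) \<partial>lebesgue)"
    using fin by (intro nn_integral_cong) (auto simp: indicator_def zero_less_iff_neq_zero)
  also have "\<dots> = (\<integral>\<^sup>+k. (\<integral>\<^sup>+s. enn_powr (\<omega> s) \<theta> * enn_powr (ball_mass F s) (\<theta> / p2) * indicator {0<..} s
        * indicator (dyadic (k + 1)) (ball_mass F s) \<partial>lebesgue) \<partial>count_space UNIV)"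
    by (rule nn_integral_dyadic[symmetric]) measurable
  finally show ?thesis .
qed

section \<open>Summation of the block estimates\<close>

lemma sum_dyadic_le:
  assumes [measurable]: "H \<in> borel_measurable M" "G \<in> borel_measurable M"
  shows "(\<integral>\<^sup>+k. (\<integral>\<^sup>+x. H x * indicator (dyadic (k + j)) (G x) \<partial>M) \<partial>count_space UNIV) \<le> (\<integral>\<^sup>+x. H x \<partial>M)"
  by (simp add: nn_integral_dyadic) (intro nn_integral_mono, simp add: indicator_def)

text \<open>Each term is at most the sum S, so a^q <= a * S^(q-1); summation gives S^q.\<close>

lemma nn_integral_count_space_powr_le:
  assumes "1 \<le> q"
  shows "(\<integral>\<^sup>+k. enn_powr (a k) q \<partial>count_space A) \<le> enn_powr (\<integral>\<^sup>+k. a k \<partial>count_space A) q"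
proof -
  define S where "S = (\<integral>\<^sup>+k. a k \<partial>count_space A)"
  have split: "enn_powr x q = x * enn_powr x (q - 1)" for x
    using enn_powr_add[of x 1 "q - 1"] by simp
  have "(\<integral>\<^sup>+k. enn_powr (a k) q \<partial>count_space A) \<le> (\<integral>\<^sup>+k. a k * enn_powr S (q - 1) \<partial>count_space A)"
    unfolding split S_def using assms
    by (intro nn_integral_mono mult_left_mono enn_powr_mono nn_integral_ge_point) auto
  also have "\<dots> = enn_powr S q"
    by (simp add: nn_integral_multc split S_def)
  finally show ?thesis by (simp add: S_def)
qed

text \<open>Excludes infinite local masses: where f of finite norm has infinite mass in a ball, K is
  infinite there, and then so is the right-hand side of the upper bound.\<close>

lemma local_const_top:
  assumes v: "v1 \<in> weights" and p: "0 < p1" "0 < p2"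
    and "f \<in> borel_measurable lebesgue" and fin: "Lp_norm (ennreal p1) v1 f < top"
    and "ball_mass (\<lambda>x. enn_powr (ennreal \<bar>f x\<bar>) p2 * ennreal (v2 x)) s = top"
  shows "local_const (ennreal p1) v1 (ennreal p2) v2 (ball 0 s) = top"
proof -
  have "wnorm lebesgue (ennreal p2) (ball 0 s) (\<lambda>x. ennreal (v2 x)) (\<lambda>x. ennreal \<bar>f x\<bar>)
      \<le> local_const (ennreal p1) v1 (ennreal p2) v2 (ball 0 s) * Lp_norm (ennreal p1) v1 f"
    using assms by (intro local_const_bound) auto
  also have "wnorm lebesgue (ennreal p2) (ball 0 s) (\<lambda>x. ennreal (v2 x)) (\<lambda>x. ennreal \<bar>f x\<bar>) = top"
    using assms by (simp add: wnorm_ennreal ball_mass_def)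
  finally show ?thesis
    using fin by (auto simp: top_unique ennreal_mult_eq_top_iff)
qed

lemma embed_const_upper_p1_le_theta:
  fixes v1 v2 :: "'a::euclidean_space \<Rightarrow> real" and p1 p2 \<theta> :: real
  assumes v: "v1 \<in> weights" "v2 \<in> weights" and p: "0 < p1" "0 < p2" "p1 \<le> \<theta>"
    and \<omega>: "\<omega> \<in> Omega (ennreal \<theta>)"
  defines "A \<equiv> (SUP t\<in>{0<..}. wnorm lebesgue (ennreal \<theta>) {t<..} (\<lambda>_. 1) \<omega> * local_const (ennreal p1) v1 (ennreal p2) v2 (ball 0 t))"
  shows "embed_const (ennreal p1) v1 (ennreal p2) (ennreal \<theta>) \<omega> v2 \<le> ennreal (4 powr (1 / p2)) * A"
  unfolding embed_const_eq
proof (rule SUP_least)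
  note [measurable] = weights_measurable[OF v(1)] weights_measurable[OF v(2)] OmegaD[OF \<omega>]
  have \<theta>: "0 < \<theta>" using p by simp
  let ?K = "\<lambda>t. local_const (ennreal p1) v1 (ennreal p2) v2 (ball 0 t)"
  fix f assume f: "f \<in> admissible (ennreal p1) v1"
  have [measurable]: "f \<in> borel_measurable lebesgue" and N: "0 < Lp_norm (ennreal p1) v1 f" "Lp_norm (ennreal p1) v1 f < top"
    using admissibleD[OF f v(1)] p by simp_all
  define N where "N = (\<integral>\<^sup>+x. enn_powr (ennreal \<bar>f x\<bar>) p1 * ennreal (v1 x) \<partial>lebesgue)"
  have LpN: "Lp_norm (ennreal p1) v1 f = enn_powr N (1 / p1)" using p by (simp add: Lp_norm_ennreal N_def)
  define F where "F = (\<lambda>x. enn_powr (ennreal \<bar>f x\<bar>) p2 * ennreal (v2 x))"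
  have A: "wnorm lebesgue (ennreal \<theta>) {t<..} (\<lambda>_. 1) \<omega> * ?K t \<le> A" if "0 < t" for t
    unfolding A_def using that by (intro SUP_upper) simp
  have "LM_norm (ennreal p2) (ennreal \<theta>) \<omega> v2 f \<le> ennreal (4 powr (1 / p2)) * A * Lp_norm (ennreal p1) v1 f"
  proof (cases "A = top")
    case True
    then show ?thesis using N by (simp add: ennreal_mult_top ennreal_top_mult)
  next
    case False
    have fin: "ball_mass F s < top" if "0 < s" for s
    proof (rule ccontr)
      assume "\<not> ball_mass F s < top"
      then have "ball_mass F s = top" by (simp add: not_less top_unique)
      then have "?K s = top"
        using v p N by (intro local_const_top[where f=f]) (auto simp: F_def)
      moreover have "0 < wnorm lebesgue (ennreal \<theta>) {s<..} (\<lambda>_. 1) \<omega>"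
        using \<omega> that by (simp add: Omega_def)
      ultimately show False
        using A[OF that] False by (simp add: ennreal_mult_top top_unique split: if_splits)
    qed
    define a where "a k = (\<integral>\<^sup>+x. enn_powr (ennreal \<bar>f x\<bar>) p1 * ennreal (v1 x) * indicator (dyadic k) (ball_mass F (norm x)) \<partial>lebesgue)" for k
    have block: "(\<integral>\<^sup>+s. enn_powr (\<omega> s) \<theta> * enn_powr (ball_mass F s) (\<theta> / p2) * indicator {0<..} s
        * indicator (dyadic (k + 1)) (ball_mass F s) \<partial>lebesgue)
      \<le> ennreal (4 powr (\<theta> / p2)) * enn_powr A \<theta> * enn_powr (a k) (\<theta> / p1)" for k
    proof -
      obtain r where r: "0 < r" "\<And>s. 0 < s \<Longrightarrow> ball_mass F s \<in> dyadic (k + 1) \<Longrightarrow> r < s"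
        "(\<integral>\<^sup>+s. enn_powr (\<omega> s) \<theta> * enn_powr (ball_mass F s) (\<theta> / p2) * indicator {0<..} s
          * indicator (dyadic (k + 1)) (ball_mass F s) \<partial>lebesgue)
        \<le> ennreal (4 powr (\<theta> / p2)) * (enn_powr (?K r) \<theta> * enn_powr (a k) (\<theta> / p1)
          * (\<integral>\<^sup>+s. enn_powr (\<omega> s) \<theta> * indicator {0<..} s * indicator (dyadic (k + 1)) (ball_mass F s) \<partial>lebesgue))"
        by (rule LM_block[OF v p(1,2) \<theta> _ _ N(2) F_def a_def, of \<omega> k]) auto
      note r(3)
      \<comment> \<open>All radii of the block exceed r, so their mass is at most W(r), and W(r)
        K(r)^\<theta> <= A^\<theta> by the definition of A.\<close>
      also have "(\<integral>\<^sup>+s. enn_powr (\<omega> s) \<theta> * indicator {0<..} s * indicator (dyadic (k + 1)) (ball_mass F s) \<partial>lebesgue) \<le> tail_mass \<theta> \<omega> r"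
        unfolding tail_mass_def using r(2) by (intro nn_integral_mono) (auto simp: indicator_def)
      also have "ennreal (4 powr (\<theta> / p2)) * (enn_powr (?K r) \<theta> * enn_powr (a k) (\<theta> / p1) * tail_mass \<theta> \<omega> r)
        = ennreal (4 powr (\<theta> / p2)) * enn_powr (wnorm lebesgue (ennreal \<theta>) {r<..} (\<lambda>_. 1) \<omega> * ?K r) \<theta> * enn_powr (a k) (\<theta> / p1)"
        using \<theta> by (simp add: wnorm_tail enn_powr_mult enn_powr_powr ac_simps)
      also have "\<dots> \<le> ennreal (4 powr (\<theta> / p2)) * enn_powr A \<theta> * enn_powr (a k) (\<theta> / p1)"
        using A[OF r(1)] \<theta> by (intro mult_right_mono mult_left_mono enn_powr_mono) auto
      finally show ?thesis by (simp add: mult_left_mono)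
    qed
    have "(\<integral>\<^sup>+s. enn_powr (\<omega> s) \<theta> * enn_powr (ball_mass F s) (\<theta> / p2) * indicator {0<..} s \<partial>lebesgue)
      \<le> (\<integral>\<^sup>+k. ennreal (4 powr (\<theta> / p2)) * enn_powr A \<theta> * enn_powr (a k) (\<theta> / p1) \<partial>count_space UNIV)"
      using p \<theta> by (subst LM_integral_dyadic[OF _ fin]) (auto intro!: nn_integral_mono block)
    also have "\<dots> = ennreal (4 powr (\<theta> / p2)) * enn_powr A \<theta> * (\<integral>\<^sup>+k. enn_powr (a k) (\<theta> / p1) \<partial>count_space UNIV)"
      by (simp add: nn_integral_cmult)
    \<comment> \<open>This is where p1 <= \<theta> enters: the exponent \<theta>/p1 is at least
      1.\<close>
    also have "\<dots> \<le> ennreal (4 powr (\<theta> / p2)) * enn_powr A \<theta> * enn_powr (\<integral>\<^sup>+k. a k \<partial>count_space UNIV) (\<theta> / p1)"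
      using p by (intro mult_left_mono nn_integral_count_space_powr_le) auto
    also have "\<dots> \<le> ennreal (4 powr (\<theta> / p2)) * enn_powr A \<theta> * enn_powr N (\<theta> / p1)"
    proof -
      have "(\<integral>\<^sup>+k. a (k + 0) \<partial>count_space UNIV) \<le> N"
        unfolding a_def N_def by (rule sum_dyadic_le) measurable
      then show ?thesis
        using p \<theta> by (intro mult_left_mono enn_powr_mono) auto
    qed
    finally have "LM_norm (ennreal p2) (ennreal \<theta>) \<omega> v2 f
      \<le> enn_powr (ennreal (4 powr (\<theta> / p2)) * enn_powr A \<theta> * enn_powr N (\<theta> / p1)) (1 / \<theta>)"
      using p \<theta> by (simp add: LM_norm_ennreal enn_powr_mono F_def)
    also have "\<dots> = ennreal (4 powr (1 / p2)) * A * Lp_norm (ennreal p1) v1 f"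
      using \<theta> unfolding LpN by (simp add: enn_powr_mult enn_powr_powr enn_powr_ennreal powr_powr)
    finally show ?thesis .
  qed
  then show "LM_norm (ennreal p2) (ennreal \<theta>) \<omega> v2 f / Lp_norm (ennreal p1) v1 f \<le> ennreal (4 powr (1 / p2)) * A"
    using N by (simp add: ennreal_divide_le_iff)
qed

lemma borel_measurable_local_const [measurable]:
  "(\<lambda>t. local_const p1 v1 p2 v2 (ball 0 t)) \<in> borel_measurable borel"
  by (intro mono_borel_measurable) (auto simp: mono_def intro!: local_const_mono)

text \<open>By \<open>tail_mass_sublevel_le\<close>, at most half of the mass \<open>m\<close> of \<open>E\<close> sits where the tail is below \<open>m / 2\<close>.\<close>

lemma half_mass_block:
  assumes \<omega>: "\<omega> \<in> borel_measurable lebesgue" and [measurable]: "E \<in> sets lebesgue" and \<alpha>: "0 \<le> \<alpha>"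
    and m: "m = (\<integral>\<^sup>+s. enn_powr (\<omega> s) \<theta> * indicator E s \<partial>lebesgue)" "m < top"
  shows "enn_powr (m / 2) (1 + \<alpha>) \<le> (\<integral>\<^sup>+s. enn_powr (tail_mass \<theta> \<omega> s) \<alpha> * enn_powr (\<omega> s) \<theta> * indicator E s \<partial>lebesgue)"
proof -
  note [measurable] = \<omega>
  have "2 * (m / 2) = m"
    by (simp add: ennreal_times_divide mult.commute[of 2] ennreal_mult_divide_eq)
  then have half: "m / 2 + m / 2 = m" by (simp add: mult_2)
  define Y where "Y = (\<integral>\<^sup>+s. enn_powr (\<omega> s) \<theta> * indicator E s * indicator {m / 2<..} (tail_mass \<theta> \<omega> s) \<partial>lebesgue)"
  note half
  also have "m \<le> (\<integral>\<^sup>+s. enn_powr (\<omega> s) \<theta> * indicator {..m / 2} (tail_mass \<theta> \<omega> s)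
      + enn_powr (\<omega> s) \<theta> * indicator E s * indicator {m / 2<..} (tail_mass \<theta> \<omega> s) \<partial>lebesgue)"
    unfolding m(1) by (intro nn_integral_mono) (auto simp: indicator_def)
  also have "\<dots> = (\<integral>\<^sup>+s. enn_powr (\<omega> s) \<theta> * indicator {..m / 2} (tail_mass \<theta> \<omega> s) \<partial>lebesgue) + Y"
    unfolding Y_def by (rule nn_integral_add) measurable
  also have "\<dots> \<le> m / 2 + Y"
    by (intro add_right_mono tail_mass_sublevel_le \<omega>)
  finally have "m / 2 \<le> Y"
    using m(2) by (subst (asm) ennreal_add_left_cancel_le) (auto simp: ennreal_divide_eq_top_iff)
  then have "enn_powr (m / 2) \<alpha> * (m / 2) \<le> enn_powr (m / 2) \<alpha> * Y"
    by (rule mult_left_mono) simp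
  also have "\<dots> = (\<integral>\<^sup>+s. enn_powr (m / 2) \<alpha> * (enn_powr (\<omega> s) \<theta> * indicator E s * indicator {m / 2<..} (tail_mass \<theta> \<omega> s)) \<partial>lebesgue)"
    unfolding Y_def by (rule nn_integral_cmult[symmetric]) measurable
  also have "\<dots> \<le> (\<integral>\<^sup>+s. enn_powr (tail_mass \<theta> \<omega> s) \<alpha> * enn_powr (\<omega> s) \<theta> * indicator E s \<partial>lebesgue)"
    using \<alpha> by (intro nn_integral_mono) (auto simp: indicator_def intro!: mult_right_mono enn_powr_mono)
  finally show ?thesis
    by (simp add: enn_powr_add mult.commute)
qed

text \<open>Without a supremum to pull out, K(r)^\<theta> times the mass m of a block is bounded by
  the block j of J to the power \<theta>/R, and Hoelder sums the products. The factor 4^(1/p2) comes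
  from \<open>LM_block\<close>, 2^(1/\<theta>) from replacing m by m/2.\<close>

lemma embed_const_upper_theta_less_p1:
  fixes v1 v2 :: "'a::euclidean_space \<Rightarrow> real" and p1 p2 \<theta> :: real
  assumes v: "v1 \<in> weights" "v2 \<in> weights" and p: "0 < p2" "0 < \<theta>" "\<theta> < p1"
    and \<omega>: "\<omega> \<in> Omega (ennreal \<theta>)"
  defines "R \<equiv> \<theta> * p1 / (p1 - \<theta>)"
  defines "J \<equiv> (\<integral>\<^sup>+t. enn_powr (tail_mass \<theta> \<omega> t) (R / p1) * enn_powr (\<omega> t) \<theta>
    * enn_powr (local_const (ennreal p1) v1 (ennreal p2) v2 (ball 0 t)) R * indicator {0<..} t \<partial>lebesgue)"
  shows "embed_const (ennreal p1) v1 (ennreal p2) (ennreal \<theta>) \<omega> v2 \<le> ennreal (2 powr (1 / \<theta>) * 4 powr (1 / p2)) * enn_powr J (1 / R)"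
  unfolding embed_const_eq
proof (rule SUP_least)
  note [measurable] = weights_measurable[OF v(1)] weights_measurable[OF v(2)] OmegaD[OF \<omega>]
  have p1: "0 < p1" using p by simp
  have R: "0 < R" "(1 + R / p1) * (\<theta> / R) = 1" "\<theta> / R + \<theta> / p1 = 1"
    using p p1 by (auto simp: R_def field_simps)
  let ?K = "\<lambda>t. local_const (ennreal p1) v1 (ennreal p2) v2 (ball 0 t)"
  fix f assume f: "f \<in> admissible (ennreal p1) v1"
  have [measurable]: "f \<in> borel_measurable lebesgue" and N: "0 < Lp_norm (ennreal p1) v1 f" "Lp_norm (ennreal p1) v1 f < top"
    using admissibleD[OF f v(1)] p p1 by simp_all
  define N where "N = (\<integral>\<^sup>+x. enn_powr (ennreal \<bar>f x\<bar>) p1 * ennreal (v1 x) \<partial>lebesgue)"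
  have LpN: "Lp_norm (ennreal p1) v1 f = enn_powr N (1 / p1)" using p p1 by (simp add: Lp_norm_ennreal N_def)
  define F where "F = (\<lambda>x. enn_powr (ennreal \<bar>f x\<bar>) p2 * ennreal (v2 x))"
  define C where "C = ennreal (2 powr (1 / \<theta>) * 4 powr (1 / p2))"
  have "LM_norm (ennreal p2) (ennreal \<theta>) \<omega> v2 f \<le> C * enn_powr J (1 / R) * Lp_norm (ennreal p1) v1 f"
  proof (cases "J = top")
    case True
    then show ?thesis using N by (simp add: C_def ennreal_mult_top ennreal_top_mult)
  next
    case False
    have fin: "ball_mass F s < top" if "0 < s" for s
    proof (rule ccontr)
      assume "\<not> ball_mass F s < top"
      then have "ball_mass F s = top" by (simp add: not_less top_unique)
      then have "?K s = top"
        using v p p1 N by (intro local_const_top[where f=f]) (auto simp: F_def)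
      then have K: "?K t = top" if "s \<le> t" for t
        using local_const_mono[of "ball 0 s" "ball 0 t" "ennreal p1" v1 "ennreal p2" v2] that
        by (simp add: subset_ball top_unique)
      \<comment> \<open>Beyond s, K is infinite and W positive, so the integrand of J is infinite
        wherever \<omega> > 0; since W(s) > 0 this forces J = \<open>top\<close>.\<close>
      have "top * tail_mass \<theta> \<omega> s = (\<integral>\<^sup>+t. top * (enn_powr (\<omega> t) \<theta> * indicator {s<..} t) \<partial>lebesgue)"
        unfolding tail_mass_def by (rule nn_integral_cmult[symmetric]) measurable
      also have "\<dots> \<le> J"
        unfolding J_def
      proof (rule nn_integral_mono)
        fix t
        show "top * (enn_powr (\<omega> t) \<theta> * indicator {s<..} t) \<le> enn_powr (tail_mass \<theta> \<omega> t) (R / p1) * enn_powr (\<omega> t) \<theta> * enn_powr (?K t) R * indicator {0<..} t"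
        proof (cases "s < t")
          case True
          then have "tail_mass \<theta> \<omega> t \<noteq> 0" using Omega_tail_mass(1)[OF \<omega> p(2), of t] \<open>0 < s\<close> by simp
          then show ?thesis using True \<open>0 < s\<close> K[of t] by (simp add: ennreal_top_mult ennreal_mult_top)
        qed simp
      qed
      finally show False
        using False Omega_tail_mass(1)[OF \<omega> p(2) that] by (simp add: ennreal_top_mult top_unique split: if_splits)
    qed
    define a where "a k = (\<integral>\<^sup>+x. enn_powr (ennreal \<bar>f x\<bar>) p1 * ennreal (v1 x) * indicator (dyadic k) (ball_mass F (norm x)) \<partial>lebesgue)" for k
    define j where "j k = (\<integral>\<^sup>+t. enn_powr (tail_mass \<theta> \<omega> t) (R / p1) * enn_powr (\<omega> t) \<theta>
      * enn_powr (?K t) R * indicator {0<..} t * indicator (dyadic (k + 1)) (ball_mass F t) \<partial>lebesgue)" for k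
    have block: "(\<integral>\<^sup>+s. enn_powr (\<omega> s) \<theta> * enn_powr (ball_mass F s) (\<theta> / p2) * indicator {0<..} s
        * indicator (dyadic (k + 1)) (ball_mass F s) \<partial>lebesgue)
      \<le> ennreal (4 powr (\<theta> / p2)) * 2 * (enn_powr (j k) (\<theta> / R) * enn_powr (a k) (\<theta> / p1))" for k
    proof -
      obtain r where r: "0 < r" "\<And>s. 0 < s \<Longrightarrow> ball_mass F s \<in> dyadic (k + 1) \<Longrightarrow> r < s"
        "(\<integral>\<^sup>+s. enn_powr (\<omega> s) \<theta> * enn_powr (ball_mass F s) (\<theta> / p2) * indicator {0<..} s
          * indicator (dyadic (k + 1)) (ball_mass F s) \<partial>lebesgue)
        \<le> ennreal (4 powr (\<theta> / p2)) * (enn_powr (?K r) \<theta> * enn_powr (a k) (\<theta> / p1)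
          * (\<integral>\<^sup>+s. enn_powr (\<omega> s) \<theta> * indicator {0<..} s * indicator (dyadic (k + 1)) (ball_mass F s) \<partial>lebesgue))"
        by (rule LM_block[OF v p1 p(1,2) _ _ N(2) F_def a_def, of \<omega> k]) auto
      define E where "E = {0<..} \<inter> {s. ball_mass F s \<in> dyadic (k + 1)}"
      have [measurable]: "E \<in> sets lebesgue"
      proof -
        have "(\<lambda>s. ball_mass F s) \<in> borel_measurable lebesgue" by measurable
        from measurable_sets[OF this dyadic_measurable[of "k + 1"]] show ?thesis
          by (auto simp: E_def vimage_def)
      qed
      have ind: "indicator {0<..} s * indicator (dyadic (k + 1)) (ball_mass F s) = (indicator E s :: ennreal)" for s
        by (simp add: E_def indicator_def)
      define m where "m = (\<integral>\<^sup>+s. enn_powr (\<omega> s) \<theta> * indicator E s \<partial>lebesgue)"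
      have "m \<le> tail_mass \<theta> \<omega> r"
        unfolding m_def tail_mass_def using r(2) by (intro nn_integral_mono) (auto simp: indicator_def E_def)
      also have "\<dots> < top" using Omega_tail_mass(2)[OF \<omega> p(2) r(1)] .
      finally have mfin: "m < top" .
      \<comment> \<open>As (1 + R/p1) * (\<theta>/R) = 1, the power \<theta>/R taken below returns
        m/2 to the first power and turns K^R into K^\<theta>.\<close>
      have "enn_powr (m / 2) (1 + R / p1) * enn_powr (?K r) R
        \<le> (\<integral>\<^sup>+s. enn_powr (tail_mass \<theta> \<omega> s) (R / p1) * enn_powr (\<omega> s) \<theta> * indicator E s \<partial>lebesgue) * enn_powr (?K r) R"
        using mfin R p1 by (intro mult_right_mono half_mass_block[OF OmegaD[OF \<omega>] _ _ m_def]) auto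
      also have "\<dots> = (\<integral>\<^sup>+s. enn_powr (tail_mass \<theta> \<omega> s) (R / p1) * enn_powr (\<omega> s) \<theta> * indicator E s * enn_powr (?K r) R \<partial>lebesgue)"
        by (rule nn_integral_multc[symmetric]) measurable
      also have "\<dots> \<le> j k"
        unfolding j_def
      proof (rule nn_integral_mono)
        fix s
        show "enn_powr (tail_mass \<theta> \<omega> s) (R / p1) * enn_powr (\<omega> s) \<theta> * indicator E s * enn_powr (?K r) R
          \<le> enn_powr (tail_mass \<theta> \<omega> s) (R / p1) * enn_powr (\<omega> s) \<theta> * enn_powr (?K s) R * indicator {0<..} s * indicator (dyadic (k + 1)) (ball_mass F s)"
        proof (cases "s \<in> E")
          case True
          then have "enn_powr (?K r) R \<le> enn_powr (?K s) R"
            using R r(2)[of s] by (intro enn_powr_mono local_const_mono subset_ball) (auto simp: E_def)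
          then show ?thesis using True by (simp add: E_def mult_left_mono)
        qed simp
      qed
      finally have "enn_powr (enn_powr (m / 2) (1 + R / p1) * enn_powr (?K r) R) (\<theta> / R) \<le> enn_powr (j k) (\<theta> / R)"
        using R p by (intro enn_powr_mono) auto
      then have "(m / 2) * enn_powr (?K r) \<theta> \<le> enn_powr (j k) (\<theta> / R)"
        using R by (simp add: enn_powr_mult enn_powr_powr)
      then have "2 * ((m / 2) * enn_powr (?K r) \<theta>) \<le> 2 * enn_powr (j k) (\<theta> / R)"
        by (rule mult_left_mono) simp
      moreover have "2 * (m / 2) = m"
        by (simp add: ennreal_times_divide mult.commute[of 2] ennreal_mult_divide_eq)
      ultimately have "enn_powr (?K r) \<theta> * m \<le> 2 * enn_powr (j k) (\<theta> / R)"
        by (metis mult.assoc mult.commute)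
      then have "ennreal (4 powr (\<theta> / p2)) * enn_powr (a k) (\<theta> / p1) * (enn_powr (?K r) \<theta> * m)
        \<le> ennreal (4 powr (\<theta> / p2)) * enn_powr (a k) (\<theta> / p1) * (2 * enn_powr (j k) (\<theta> / R))"
        by (rule mult_left_mono) simp
      then show ?thesis
        using r(3) by (simp add: m_def ind[symmetric] ac_simps)
    qed
    have "(\<integral>\<^sup>+s. enn_powr (\<omega> s) \<theta> * enn_powr (ball_mass F s) (\<theta> / p2) * indicator {0<..} s \<partial>lebesgue)
      \<le> (\<integral>\<^sup>+k. ennreal (4 powr (\<theta> / p2)) * 2 * (enn_powr (j k) (\<theta> / R) * enn_powr (a k) (\<theta> / p1)) \<partial>count_space UNIV)"
      using p by (subst LM_integral_dyadic[OF _ fin]) (auto intro!: nn_integral_mono block)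
    also have "\<dots> = ennreal (4 powr (\<theta> / p2)) * 2 * (\<integral>\<^sup>+k. enn_powr (j k) (\<theta> / R) * enn_powr (a k) (\<theta> / p1) \<partial>count_space UNIV)"
      by (simp add: nn_integral_cmult)
    \<comment> \<open>Hoelder for sums over k, with the conjugate exponents \<theta>/R + \<theta>/p1
      = 1.\<close>
    also have "\<dots> \<le> ennreal (4 powr (\<theta> / p2)) * 2 * (enn_powr (\<integral>\<^sup>+k. j k \<partial>count_space UNIV) (\<theta> / R) * enn_powr (\<integral>\<^sup>+k. a k \<partial>count_space UNIV) (\<theta> / p1))"
      using p p1 R by (intro mult_left_mono nn_integral_Hoelder) auto
    also have "\<dots> \<le> ennreal (4 powr (\<theta> / p2)) * 2 * (enn_powr J (\<theta> / R) * enn_powr N (\<theta> / p1))"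
    proof -
      have "(\<integral>\<^sup>+k. j k \<partial>count_space UNIV) \<le> J"
        unfolding j_def J_def by (rule sum_dyadic_le) measurable
      moreover have "(\<integral>\<^sup>+k. a (k + 0) \<partial>count_space UNIV) \<le> N"
        unfolding a_def N_def by (rule sum_dyadic_le) measurable
      ultimately show ?thesis
        using p p1 R by (intro mult_left_mono mult_mono enn_powr_mono) auto
    qed
    finally have "LM_norm (ennreal p2) (ennreal \<theta>) \<omega> v2 f
      \<le> enn_powr (ennreal (4 powr (\<theta> / p2)) * 2 * (enn_powr J (\<theta> / R) * enn_powr N (\<theta> / p1))) (1 / \<theta>)"
      using p by (simp add: LM_norm_ennreal enn_powr_mono F_def)
    also have "\<dots> = enn_powr (ennreal (4 powr (\<theta> / p2)) * ennreal 2) (1 / \<theta>) * enn_powr J (1 / R) * Lp_norm (ennreal p1) v1 f"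
      using p R unfolding LpN by (simp add: enn_powr_mult enn_powr_powr ac_simps)
    also have "enn_powr (ennreal (4 powr (\<theta> / p2)) * ennreal 2) (1 / \<theta>) = C"
      using p by (simp add: C_def enn_powr_mult enn_powr_ennreal powr_powr ennreal_mult mult.commute del: ennreal_numeral)
    finally show ?thesis .
  qed
  then show "LM_norm (ennreal p2) (ennreal \<theta>) \<omega> v2 f / Lp_norm (ennreal p1) v1 f
    \<le> ennreal (2 powr (1 / \<theta>) * 4 powr (1 / p2)) * enn_powr J (1 / R)"
    using N by (simp add: ennreal_divide_le_iff C_def)
qed

section \<open>Lower bound for \<open>\<theta> < p1\<close>\<close>

text \<open>Reduction to finite sets of levels, so that the superposed test function is a finite sum
  of finite norm.\<close>

lemma nn_integral_count_space_int_le: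
  fixes a :: "int \<Rightarrow> ennreal"
  assumes "\<And>T. finite T \<Longrightarrow> (\<Sum>k\<in>T. a k) \<le> y"
  shows "(\<integral>\<^sup>+k. a k \<partial>count_space UNIV) \<le> y"
proof -
  have "(\<integral>\<^sup>+k. a k \<partial>count_space UNIV) = (\<integral>\<^sup>+n. a (int_decode n) \<partial>count_space UNIV)"
    by (rule nn_integral_bij_count_space[symmetric]) (rule bij_int_decode)
  also have "\<dots> = (SUP n. \<Sum>i<n. a (int_decode i))"
    by (simp add: nn_integral_count_space_nat suminf_eq_SUP)
  also have "\<dots> = (SUP n. \<Sum>k\<in>int_decode ` {..<n}. a k)"
    by (simp add: sum.reindex inj_int_decode)
  also have "\<dots> \<le> y"
    by (intro SUP_least assms) simp
  finally show ?thesis .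
qed

lemma continuous_on_tail_mass:
  assumes [measurable]: "\<omega> \<in> borel_measurable lebesgue" and fin: "tail_mass \<theta> \<omega> t < top"
  shows "continuous_on {t..} (tail_mass \<theta> \<omega>)"
proof -
  have "continuous_on {..- t} (\<lambda>r. tail_mass \<theta> \<omega> (- r))"
    unfolding tail_mass_uminus
    by (rule continuous_on_distribution[OF _ _ AE_uminus_neq])
       (use fin tail_mass_uminus[of \<theta> \<omega> "- t"] in \<open>auto\<close>)
  then have "continuous_on {t..} (\<lambda>r. tail_mass \<theta> \<omega> (- (- r)))"
    by (rule continuous_on_compose2) (auto intro: continuous_intros)
  then show ?thesis by simp
qed

lemma tail_mass_tendsto_0:
  assumes [measurable]: "\<omega> \<in> borel_measurable lebesgue" and fin: "tail_mass \<theta> \<omega> t < top"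
  shows "(\<lambda>n. tail_mass \<theta> \<omega> (t + real n)) \<longlonglongrightarrow> 0"
proof -
  have "(\<lambda>n. \<integral>\<^sup>+x. enn_powr (\<omega> x) \<theta> * indicator {t + real n<..} x \<partial>lebesgue) \<longlonglongrightarrow> integral\<^sup>N lebesgue (\<lambda>x::real. 0)"
  proof (rule nn_integral_dominated_convergence[where w="\<lambda>x. enn_powr (\<omega> x) \<theta> * indicator {t<..} x"])
    show "AE x in lebesgue. (\<lambda>n. enn_powr (\<omega> x) \<theta> * indicator {t + real n<..} x) \<longlonglongrightarrow> 0"
    proof (intro AE_I2 tendsto_eventually)
      fix x :: real
      obtain m where "x - t < real m" using reals_Archimedean2 by blast
      then have "\<not> t + real n < x" if "m \<le> n" for n using that by linarith
      then show "\<forall>\<^sub>F n in sequentially. enn_powr (\<omega> x) \<theta> * indicator {t + real n<..} x = 0"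
        unfolding eventually_sequentially by (intro exI[of _ m]) simp
    qed
  qed (use fin in \<open>auto simp: tail_mass_def indicator_def\<close>)
  then show ?thesis by (simp add: tail_mass_def)
qed

text \<open>W is continuous on (0, inf) and tends to 0, so every positive value below W(t) is taken
  further out.\<close>

lemma tail_mass_attains:
  assumes \<omega>: "\<omega> \<in> Omega (ennreal \<theta>)" and \<theta>: "0 < \<theta>" and t: "0 < t" "c \<le> tail_mass \<theta> \<omega> t" and c: "0 < c"
  obtains s where "0 < s" "tail_mass \<theta> \<omega> s = c"
proof -
  note [measurable] = OmegaD[OF \<omega>]
  note fin = Omega_tail_mass(2)[OF \<omega> \<theta> t(1)]
  have "\<forall>\<^sub>F n in sequentially. tail_mass \<theta> \<omega> (t + real n) < c"
    using tail_mass_tendsto_0[OF OmegaD[OF \<omega>] fin] c by (rule order_tendstoD)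
  then obtain n where n: "tail_mass \<theta> \<omega> (t + real n) < c"
    by (auto simp: eventually_sequentially)
  have "continuous_on {t..t + real n} (tail_mass \<theta> \<omega>)"
    using continuous_on_tail_mass[OF OmegaD[OF \<omega>] fin] by (rule continuous_on_subset) auto
  then obtain s where "t \<le> s" "tail_mass \<theta> \<omega> s = c"
    using IVT2'[of "tail_mass \<theta> \<omega>" "t + real n" c t] n t by (auto dest: less_imp_le)
  then show ?thesis using that[of s] t by simp
qed

text \<open>Counterpart of \<open>ball_block\<close> for W: the part of the tail beyond t where W <=
  2^(k-1) has mass at most 2^(k-1), half of W(t); the other half lies on level k - 1.\<close>

lemma tail_mass_half_block:
  assumes [measurable]: "\<omega> \<in> borel_measurable lebesgue" and t: "tail_mass \<theta> \<omega> t = ennreal (2 powr real_of_int k)"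
  shows "ennreal (2 powr real_of_int (k - 1)) \<le> (\<integral>\<^sup>+s. enn_powr (\<omega> s) \<theta> * indicator {t<..} s * indicator (dyadic (k - 1)) (tail_mass \<theta> \<omega> s) \<partial>lebesgue)"
    (is "?h \<le> ?I")
proof -
  have "?h + ?h = ennreal (2 powr real_of_int k)"
    by (simp add: powr_diff flip: ennreal_plus)
  also have "\<dots> = tail_mass \<theta> \<omega> t" using t by simp
  also have "tail_mass \<theta> \<omega> t \<le> (\<integral>\<^sup>+s. enn_powr (\<omega> s) \<theta> * indicator {..?h} (tail_mass \<theta> \<omega> s)
      + enn_powr (\<omega> s) \<theta> * indicator {t<..} s * indicator (dyadic (k - 1)) (tail_mass \<theta> \<omega> s) \<partial>lebesgue)"
    unfolding tail_mass_def[of \<theta> \<omega> t]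
  proof (rule nn_integral_mono)
    fix s
    show "enn_powr (\<omega> s) \<theta> * indicator {t<..} s \<le> enn_powr (\<omega> s) \<theta> * indicator {..?h} (tail_mass \<theta> \<omega> s)
      + enn_powr (\<omega> s) \<theta> * indicator {t<..} s * indicator (dyadic (k - 1)) (tail_mass \<theta> \<omega> s)"
    proof (cases "t < s")
      case True
      then have "tail_mass \<theta> \<omega> s \<le> ennreal (2 powr real_of_int k)"
        unfolding t[symmetric] by (intro tail_mass_antimono) simp
      then have "tail_mass \<theta> \<omega> s \<le> ?h \<or> tail_mass \<theta> \<omega> s \<in> dyadic (k - 1)"
        by (auto simp: dyadic_def)
      then show ?thesis using True by (elim disjE) (auto simp: indicator_def)
    qed simp
  qed
  also have "\<dots> = (\<integral>\<^sup>+s. enn_powr (\<omega> s) \<theta> * indicator {..?h} (tail_mass \<theta> \<omega> s) \<partial>lebesgue) + ?I"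
    by (rule nn_integral_add) measurable
  also have "\<dots> \<le> ?h + ?I"
    by (intro add_right_mono tail_mass_sublevel_le) measurable
  finally show ?thesis
    by (subst (asm) ennreal_add_left_cancel_le) simp
qed

text \<open>Exponent bookkeeping for one term of the lower bound, with y in the role of K at the
  radius where W = 2^k.\<close>

lemma powr_block_identity:
  fixes k :: int and y R \<theta> p1 :: real
  assumes "0 < y" "0 < \<theta>" "\<theta> < p1"
  shows "(2 powr (real_of_int k * (R / \<theta>)) * y powr R) powr (\<theta> / p1) * (y / 2) powr \<theta> * 2 powr real_of_int (k - 1)
    = 2 powr (real_of_int k * (R / p1) + (- \<theta>) + (real_of_int k - 1)) * y powr (\<theta> + R * \<theta> / p1)"
proof -
  have a1: "(2 powr (real_of_int k * (R / \<theta>)) * y powr R) powr (\<theta> / p1) = 2 powr (real_of_int k * (R / p1)) * y powr (R * \<theta> / p1)"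
    using assms by (simp add: powr_mult powr_powr)
  have a2: "(y / 2) powr \<theta> = y powr \<theta> * 2 powr (- \<theta>)"
    using assms by (simp add: powr_divide powr_minus_divide)
  have a3: "2 powr (real_of_int k * (R / p1) + (- \<theta>) + (real_of_int k - 1)) = 2 powr (real_of_int k * (R / p1)) * 2 powr (- \<theta>) * 2 powr real_of_int (k - 1)"
    by (simp flip: powr_add)
  have a4: "y powr (\<theta> + R * \<theta> / p1) = y powr \<theta> * y powr (R * \<theta> / p1)"
    by (rule powr_add)
  show ?thesis
    unfolding a1 a2 a3 a4 by (simp only: mult_ac)
qed
text \<open>J is first dominated by a dyadic sum of \<sigma> k, which is then tested by a
  superposition. The factor 2^(1/\<theta>) comes from replacing W <= 2^(k+1) by 2^k;
  2^((1+\<theta>)/\<theta>) is the root of 2^\<theta> (functions extremal up to 1/2) times 2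
  (\<open>tail_mass_half_block\<close>).\<close>

lemma embed_const_lower_theta_less_p1:
  fixes v1 v2 :: "'a::euclidean_space \<Rightarrow> real" and p1 p2 \<theta> :: real
  assumes v: "v1 \<in> weights" "v2 \<in> weights" and p: "0 < p2" "0 < \<theta>" "\<theta> < p1"
    and \<omega>: "\<omega> \<in> Omega (ennreal \<theta>)"
  defines "R \<equiv> \<theta> * p1 / (p1 - \<theta>)"
  defines "J \<equiv> (\<integral>\<^sup>+t. enn_powr (tail_mass \<theta> \<omega> t) (R / p1) * enn_powr (\<omega> t) \<theta>
    * enn_powr (local_const (ennreal p1) v1 (ennreal p2) v2 (ball 0 t)) R * indicator {0<..} t \<partial>lebesgue)"
  shows "enn_powr J (1 / R) \<le> ennreal (2 powr ((2 + \<theta>) / \<theta>)) * embed_const (ennreal p1) v1 (ennreal p2) (ennreal \<theta>) \<omega> v2"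
proof -
  note [measurable] = weights_measurable[OF v(1)] weights_measurable[OF v(2)] OmegaD[OF \<omega>]
  have p1: "0 < p1" using p by simp
  have R: "0 < R" "1 + R / p1 = R / \<theta>" "1 / R + 1 / p1 = 1 / \<theta>" "\<theta> + R * \<theta> / p1 = R"
    using p p1 by (auto simp: R_def field_simps)
  let ?K = "\<lambda>t. local_const (ennreal p1) v1 (ennreal p2) v2 (ball 0 t)"
  define I where "I = embed_const (ennreal p1) v1 (ennreal p2) (ennreal \<theta>) \<omega> v2"
  let ?B = "\<lambda>t f. wnorm lebesgue (ennreal p2) (ball 0 t) (\<lambda>x. ennreal (v2 x)) (\<lambda>x. ennreal \<bar>f x\<bar>)"
  show ?thesis
  proof (cases "\<exists>t>0. ?K t = top")
    case True
    then obtain t where t: "0 < t" "?K t = top" by blast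
    have "wnorm lebesgue (ennreal \<theta>) {t<..} (\<lambda>_. 1) \<omega> * ?K t \<le> I"
      unfolding I_def using p t by (intro embed_const_ge) auto
    moreover have "0 < wnorm lebesgue (ennreal \<theta>) {t<..} (\<lambda>_. 1) \<omega>"
      using \<omega> t by (simp add: Omega_def)
    ultimately have "I = top"
      using t by (auto simp: ennreal_mult_top top_unique split: if_splits)
    then show ?thesis by (simp add: I_def[symmetric] ennreal_mult_top)
  next
    case False
    \<comment> \<open>The levels that occur: W may be bounded on (0, inf), in which case large k are
      absent.\<close>
    define S where "S = {k. \<exists>t>0. tail_mass \<theta> \<omega> t \<in> dyadic k}"
    have "\<exists>t>0. tail_mass \<theta> \<omega> t = ennreal (2 powr real_of_int k)" if k: "k \<in> S" for k
    proof -
      from k obtain s where s: "0 < s" "tail_mass \<theta> \<omega> s \<in> dyadic k" by (auto simp: S_def)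
      show ?thesis
        by (rule tail_mass_attains[OF \<omega> p(2) s(1), of "ennreal (2 powr real_of_int k)"])
           (use s(2) in \<open>auto simp: dyadic_def\<close>)
    qed
    then obtain \<tau> where \<tau>: "\<And>k. k \<in> S \<Longrightarrow> 0 < \<tau> k" "\<And>k. k \<in> S \<Longrightarrow> tail_mass \<theta> \<omega> (\<tau> k) = ennreal (2 powr real_of_int k)"
      by metis
    \<comment> \<open>W decreases, so all radii of level k lie before \<tau> k, where W has reached
      the lower end 2^k; hence K(t) <= K(\<tau> k) on the block.\<close>
    have less: "t < \<tau> k" if "k \<in> S" "tail_mass \<theta> \<omega> t \<in> dyadic k" for k t
    proof (rule ccontr)
      assume "\<not> t < \<tau> k"
      then have "tail_mass \<theta> \<omega> t \<le> ennreal (2 powr real_of_int k)"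
        unfolding \<tau>(2)[OF that(1), symmetric] by (intro tail_mass_antimono) simp
      then have "\<not> ennreal (2 powr real_of_int k) < tail_mass \<theta> \<omega> t" by (simp only: not_less)
      then show False using that(2) by (auto simp only: dyadic_def greaterThanAtMost_iff)
    qed
    \<comment> \<open>Size of block k of J: W^(R/p1) times the mass of the block is about 2^(k(1 +
      R/p1)) = 2^(k R/\<theta>).\<close>
    define \<sigma> where "\<sigma> k = (if k \<in> S then enn_powr (ennreal (2 powr real_of_int k)) (R / \<theta>) * enn_powr (?K (\<tau> k)) R else 0)" for k
    have block: "(\<integral>\<^sup>+t. enn_powr (tail_mass \<theta> \<omega> t) (R / p1) * enn_powr (\<omega> t) \<theta> * enn_powr (?K t) R * indicator {0<..} t
        * indicator (dyadic (k + 0)) (tail_mass \<theta> \<omega> t) \<partial>lebesgue) \<le> ennreal (2 powr (R / \<theta>)) * \<sigma> k" for k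
    proof (cases "k \<in> S")
      case False
      then have "(\<integral>\<^sup>+t. enn_powr (tail_mass \<theta> \<omega> t) (R / p1) * enn_powr (\<omega> t) \<theta> * enn_powr (?K t) R * indicator {0<..} t
        * indicator (dyadic (k + 0)) (tail_mass \<theta> \<omega> t) \<partial>lebesgue) = integral\<^sup>N lebesgue (\<lambda>t::real. 0)"
        by (intro nn_integral_cong) (auto simp: indicator_def S_def)
      then show ?thesis by simp
    next
      case True
      define M where "M = ennreal (2 powr real_of_int (k + 1))"
      have "(\<integral>\<^sup>+t. enn_powr (tail_mass \<theta> \<omega> t) (R / p1) * enn_powr (\<omega> t) \<theta> * enn_powr (?K t) R * indicator {0<..} t
        * indicator (dyadic (k + 0)) (tail_mass \<theta> \<omega> t) \<partial>lebesgue)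
        \<le> (\<integral>\<^sup>+t. (enn_powr M (R / p1) * enn_powr (?K (\<tau> k)) R) * (enn_powr (\<omega> t) \<theta> * indicator {..M} (tail_mass \<theta> \<omega> t)) \<partial>lebesgue)"
      proof (rule nn_integral_mono)
        fix t
        show "enn_powr (tail_mass \<theta> \<omega> t) (R / p1) * enn_powr (\<omega> t) \<theta> * enn_powr (?K t) R * indicator {0<..} t
          * indicator (dyadic (k + 0)) (tail_mass \<theta> \<omega> t)
          \<le> (enn_powr M (R / p1) * enn_powr (?K (\<tau> k)) R) * (enn_powr (\<omega> t) \<theta> * indicator {..M} (tail_mass \<theta> \<omega> t))"
        proof (cases "tail_mass \<theta> \<omega> t \<in> dyadic k")
          case in_dy: True
          then have tM: "tail_mass \<theta> \<omega> t \<le> M" by (simp add: dyadic_def M_def)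
          have "enn_powr (tail_mass \<theta> \<omega> t) (R / p1) * enn_powr (?K t) R \<le> enn_powr M (R / p1) * enn_powr (?K (\<tau> k)) R"
            using less[OF True in_dy] R p1 tM
            by (intro mult_mono enn_powr_mono local_const_mono subset_ball) auto
          then have "enn_powr (tail_mass \<theta> \<omega> t) (R / p1) * enn_powr (?K t) R * (enn_powr (\<omega> t) \<theta> * indicator {0<..} t)
            \<le> enn_powr M (R / p1) * enn_powr (?K (\<tau> k)) R * enn_powr (\<omega> t) \<theta>"
            by (rule mult_mono) (auto simp: indicator_def)
          then show ?thesis using in_dy tM by (simp add: ac_simps)
        qed simp
      qed
      also have "\<dots> = (enn_powr M (R / p1) * enn_powr (?K (\<tau> k)) R) * (\<integral>\<^sup>+t. enn_powr (\<omega> t) \<theta> * indicator {..M} (tail_mass \<theta> \<omega> t) \<partial>lebesgue)"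
        by (rule nn_integral_cmult) measurable
      also have "\<dots> \<le> (enn_powr M (R / p1) * enn_powr (?K (\<tau> k)) R) * M"
        by (intro mult_left_mono tail_mass_sublevel_le) auto
      also have "\<dots> = enn_powr M (R / \<theta>) * enn_powr (?K (\<tau> k)) R"
        unfolding R(2)[symmetric] enn_powr_add by (simp add: ac_simps)
      also have "enn_powr M (R / \<theta>) = ennreal (2 powr (R / \<theta>)) * enn_powr (ennreal (2 powr real_of_int k)) (R / \<theta>)"
        by (simp add: M_def enn_powr_ennreal powr_add powr_mult mult.commute flip: ennreal_mult)
      finally show ?thesis using True by (simp add: \<sigma>_def mult.assoc)
    qed
    have "J = (\<integral>\<^sup>+t. enn_powr (tail_mass \<theta> \<omega> t) (R / p1) * enn_powr (\<omega> t) \<theta> * enn_powr (?K t) R * indicator {0<..} t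
        * indicator {0<..<top} (tail_mass \<theta> \<omega> t) \<partial>lebesgue)"
      unfolding J_def using Omega_tail_mass[OF \<omega> p(2)] by (intro nn_integral_cong) (auto simp: indicator_def)
    also have "\<dots> = (\<integral>\<^sup>+k. (\<integral>\<^sup>+t. enn_powr (tail_mass \<theta> \<omega> t) (R / p1) * enn_powr (\<omega> t) \<theta> * enn_powr (?K t) R * indicator {0<..} t
        * indicator (dyadic (k + 0)) (tail_mass \<theta> \<omega> t) \<partial>lebesgue) \<partial>count_space UNIV)"
      by (rule nn_integral_dyadic[symmetric]) measurable
    also have "\<dots> \<le> (\<integral>\<^sup>+k. ennreal (2 powr (R / \<theta>)) * \<sigma> k \<partial>count_space UNIV)"
      by (intro nn_integral_mono block)
    also have "\<dots> = ennreal (2 powr (R / \<theta>)) * (\<integral>\<^sup>+k. \<sigma> k \<partial>count_space UNIV)"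
      by (rule nn_integral_cmult) simp
    also have "(\<integral>\<^sup>+k. \<sigma> k \<partial>count_space UNIV) \<le> enn_powr (ennreal (2 powr ((1 + \<theta>) / \<theta>)) * I) R"
    proof (rule nn_integral_count_space_int_le)
      fix T0 :: "int set" assume "finite T0"
      \<comment> \<open>Indices with K(\<tau> k) = 0 have \<sigma> k = 0 and do not change the sum;
        dropping them makes K(\<tau> k) / 2 strictly smaller than K(\<tau> k).\<close>
      define T where "T = {k\<in>T0 \<inter> S. 0 < ?K (\<tau> k)}"
      have [simp]: "finite T" using \<open>finite T0\<close> by (simp add: T_def)
      have T: "k \<in> S" "0 < ?K (\<tau> k)" "?K (\<tau> k) < top" "0 < \<tau> k" "tail_mass \<theta> \<omega> (\<tau> k) = ennreal (2 powr real_of_int k)" if "k \<in> T" for k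
        using that \<tau> False by (auto simp: T_def less_top)
      have \<sigma>: "\<sigma> k = enn_powr (ennreal (2 powr real_of_int k)) (R / \<theta>) * enn_powr (?K (\<tau> k)) R" "0 < \<sigma> k" "\<sigma> k < top" if "k \<in> T" for k
        using T[OF that] by (auto simp: \<sigma>_def ennreal_zero_less_mult_iff ennreal_mult_less_top enn_powr_ennreal)
      define \<Sigma> where "\<Sigma> = (\<Sum>k\<in>T. \<sigma> k)"
      have sum_eq: "(\<Sum>k\<in>T0. \<sigma> k) = \<Sigma>"
        unfolding \<Sigma>_def using \<open>finite T0\<close>
        by (intro sum.mono_neutral_right) (auto simp: T_def \<sigma>_def)
      have "\<exists>h\<in>admissible (ennreal p1) v1. ?K (\<tau> k) / 2 * Lp_norm (ennreal p1) v1 h \<le> ?B (\<tau> k) h" if k: "k \<in> T" for k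
      proof -
        have "?K (\<tau> k) / 2 < ?K (\<tau> k)"
          using T(2,3)[OF k] by (cases "?K (\<tau> k)") (auto simp: divide_ennreal_def[symmetric] ennreal_less_iff simp flip: ennreal_numeral simp: divide_ennreal)
        then obtain h where h: "h \<in> admissible (ennreal p1) v1" "?K (\<tau> k) / 2 < ?B (\<tau> k) h / Lp_norm (ennreal p1) v1 h"
          unfolding less_SUP_iff local_const_def[of _ _ _ _ "ball 0 (\<tau> k)"] by blast
        note hD = admissibleD[OF h(1) v(1)]
        have "?K (\<tau> k) / 2 * Lp_norm (ennreal p1) v1 h \<le> ?B (\<tau> k) h"
          using h(2) hD p1 by (subst ennreal_le_divide_iff[symmetric]) (auto intro: less_imp_le)
        with h(1) show ?thesis by blast
      qed
      then obtain h where h: "\<And>k. k \<in> T \<Longrightarrow> h k \<in> admissible (ennreal p1) v1"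
        "\<And>k. k \<in> T \<Longrightarrow> ?K (\<tau> k) / 2 * Lp_norm (ennreal p1) v1 (h k) \<le> ?B (\<tau> k) (h k)"
        by metis
      have hD: "h k \<in> borel_measurable lebesgue" "0 < Lp_norm (ennreal p1) v1 (h k)" "Lp_norm (ennreal p1) v1 (h k) < top" if "k \<in> T" for k
        using admissibleD[OF h(1)[OF that] v(1)] p1 by auto
      define c where "c k = enn2real (enn_powr (\<sigma> k) (1 / p1) / Lp_norm (ennreal p1) v1 (h k))" for k
      have c: "ennreal (c k) * Lp_norm (ennreal p1) v1 (h k) = enn_powr (\<sigma> k) (1 / p1)" "0 < ennreal (c k)" "0 \<le> c k" if "k \<in> T" for k
      proof -
        have "enn_powr (\<sigma> k) (1 / p1) / Lp_norm (ennreal p1) v1 (h k) < top"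
          using \<sigma>(2,3)[OF that] hD[OF that] by (auto simp: less_top[symmetric] ennreal_divide_eq_top_iff)
        then have e: "ennreal (c k) = enn_powr (\<sigma> k) (1 / p1) / Lp_norm (ennreal p1) v1 (h k)"
          by (simp add: c_def)
        show "ennreal (c k) * Lp_norm (ennreal p1) v1 (h k) = enn_powr (\<sigma> k) (1 / p1)"
          unfolding e using hD[OF that] by (simp add: ennreal_divide_times ennreal_divide_self)
        show "0 < ennreal (c k)"
          unfolding e using \<sigma>(2)[OF that] hD[OF that] by (simp add: ennreal_zero_less_divide)
        show "0 \<le> c k" by (simp add: c_def)
      qed
      \<comment> \<open>The weights \<open>c k\<close> give the \<open>k\<close>-th summand of \<open>|f|\<^sup>p\<^sup>1 v\<^sub>1\<close> the integral \<open>\<sigma> k\<close>, the choice for which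
        equality holds in the discrete Hoelder inequality.\<close>
      define f where "f x = (\<Sum>k\<in>T. (c k * \<bar>h k x\<bar>) powr p1) powr (1 / p1)" for x
      have [measurable]: "f \<in> borel_measurable lebesgue"
      proof -
        have "(\<lambda>x. \<Sum>k\<in>T. (c k * \<bar>h k x\<bar>) powr p1) \<in> borel_measurable lebesgue"
        proof (rule borel_measurable_sum)
          fix k assume "k \<in> T"
          note [measurable] = hD(1)[OF this]
          show "(\<lambda>x. (c k * \<bar>h k x\<bar>) powr p1) \<in> borel_measurable lebesgue" by measurable
        qed
        then show ?thesis unfolding f_def by measurable
      qed
      have f0: "0 \<le> f x" for x by (simp add: f_def)
      \<comment> \<open>The p1-sum dominates each of its terms, while the integrals of |f|^p1 v1 add
        exactly; so f is large on every ball and its source norm is still computable.\<close>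
      have fge: "ennreal \<bar>h k x\<bar> * ennreal (c k) \<le> ennreal \<bar>f x\<bar>" if k: "k \<in> T" for k x
      proof -
        have "(c k * \<bar>h k x\<bar>) powr p1 \<le> (\<Sum>k\<in>T. (c k * \<bar>h k x\<bar>) powr p1)"
          using k by (intro member_le_sum) auto
        then have "((c k * \<bar>h k x\<bar>) powr p1) powr (1 / p1) \<le> f x"
          unfolding f_def using p1 by (intro powr_mono2) auto
        then have "c k * \<bar>h k x\<bar> \<le> f x"
          using p1 c(3)[OF k] by (simp add: powr_powr)
        then show ?thesis
          using c(3)[OF k] f0[of x] by (auto simp: mult.commute simp flip: ennreal_mult intro!: ennreal_leI)
      qed
      have fp: "enn_powr (ennreal \<bar>f x\<bar>) p1 = (\<Sum>k\<in>T. enn_powr (ennreal (c k)) p1 * enn_powr (ennreal \<bar>h k x\<bar>) p1)" for x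
      proof -
        have "enn_powr (ennreal \<bar>f x\<bar>) p1 = ennreal (\<Sum>k\<in>T. (c k * \<bar>h k x\<bar>) powr p1)"
          using p1 f0[of x] by (simp add: enn_powr_ennreal f_def powr_powr sum_nonneg)
        also have "\<dots> = (\<Sum>k\<in>T. ennreal ((c k * \<bar>h k x\<bar>) powr p1))"
          by (simp add: sum_ennreal)
        also have "\<dots> = (\<Sum>k\<in>T. enn_powr (ennreal (c k)) p1 * enn_powr (ennreal \<bar>h k x\<bar>) p1)"
          using c(3) by (intro sum.cong) (auto simp: enn_powr_ennreal powr_mult ennreal_mult)
        finally show ?thesis .
      qed
      have Lp: "Lp_norm (ennreal p1) v1 f = enn_powr \<Sigma> (1 / p1)"
      proof -
        have "(\<integral>\<^sup>+x. enn_powr (ennreal \<bar>f x\<bar>) p1 * ennreal (v1 x) \<partial>lebesgue)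
          = (\<integral>\<^sup>+x. (\<Sum>k\<in>T. enn_powr (ennreal (c k)) p1 * (enn_powr (ennreal \<bar>h k x\<bar>) p1 * ennreal (v1 x))) \<partial>lebesgue)"
          by (simp add: fp sum_distrib_right mult.assoc)
        also have "\<dots> = (\<Sum>k\<in>T. \<integral>\<^sup>+x. enn_powr (ennreal (c k)) p1 * (enn_powr (ennreal \<bar>h k x\<bar>) p1 * ennreal (v1 x)) \<partial>lebesgue)"
        proof (rule nn_integral_sum)
          fix k assume "k \<in> T"
          note [measurable] = hD(1)[OF this]
          show "(\<lambda>x. enn_powr (ennreal (c k)) p1 * (enn_powr (ennreal \<bar>h k x\<bar>) p1 * ennreal (v1 x))) \<in> borel_measurable lebesgue"
            by measurable
        qed
        also have "\<dots> = \<Sigma>"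
          unfolding \<Sigma>_def
        proof (rule sum.cong)
          fix k assume k: "k \<in> T"
          note [measurable] = hD(1)[OF this]
          have "(\<integral>\<^sup>+x. enn_powr (ennreal (c k)) p1 * (enn_powr (ennreal \<bar>h k x\<bar>) p1 * ennreal (v1 x)) \<partial>lebesgue)
            = enn_powr (ennreal (c k)) p1 * (\<integral>\<^sup>+x. enn_powr (ennreal \<bar>h k x\<bar>) p1 * ennreal (v1 x) \<partial>lebesgue)"
            by (rule nn_integral_cmult) measurable
          also have "(\<integral>\<^sup>+x. enn_powr (ennreal \<bar>h k x\<bar>) p1 * ennreal (v1 x) \<partial>lebesgue) = enn_powr (Lp_norm (ennreal p1) v1 (h k)) p1"
            using p1 by (simp add: Lp_norm_ennreal enn_powr_powr)
          also have "enn_powr (ennreal (c k)) p1 * enn_powr (Lp_norm (ennreal p1) v1 (h k)) p1 = \<sigma> k"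
            unfolding enn_powr_mult[symmetric] c(1)[OF k] using p1 by (simp add: enn_powr_powr)
          finally show "(\<integral>\<^sup>+x. enn_powr (ennreal (c k)) p1 * (enn_powr (ennreal \<bar>h k x\<bar>) p1 * ennreal (v1 x)) \<partial>lebesgue) = \<sigma> k" .
        qed simp
        finally show ?thesis using p1 by (simp add: Lp_norm_ennreal)
      qed
      show "(\<Sum>k\<in>T0. \<sigma> k) \<le> enn_powr (ennreal (2 powr ((1 + \<theta>) / \<theta>)) * I) R"
      proof (cases "\<Sigma> = 0")
        case True
        then show ?thesis by (simp add: sum_eq)
      next
        case nz: False
        have \<Sigma>fin: "\<Sigma> < top"
          unfolding \<Sigma>_def using \<sigma>(3) by simp
        have \<Sigma>0: "0 < \<Sigma>" using nz by (simp add: zero_less_iff_neq_zero)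
        have Lp_pos: "0 < Lp_norm (ennreal p1) v1 f" "Lp_norm (ennreal p1) v1 f < top"
          using \<Sigma>0 \<Sigma>fin by (simp_all add: Lp)
        have "\<not> (AE x in lebesgue. f x = 0)"
        proof
          assume "AE x in lebesgue. f x = 0"
          then have "AE x in lebesgue. enn_powr (ennreal \<bar>f x\<bar>) p1 * ennreal (v1 x) = 0"
            by eventually_elim simp
          then have "(\<integral>\<^sup>+x. enn_powr (ennreal \<bar>f x\<bar>) p1 * ennreal (v1 x) \<partial>lebesgue) = 0"
            by (subst nn_integral_0_iff_AE) auto
          then show False using Lp_pos p1 by (simp add: Lp_norm_ennreal)
        qed
        then have f_adm: "f \<in> admissible (ennreal p1) v1"
          using Lp_pos by (simp add: admissible_def)
        have Bf: "enn_powr (\<sigma> k) (1 / p1) * (?K (\<tau> k) / 2) \<le> ?B t f" if k: "k \<in> T" and t: "\<tau> k \<le> t" for k t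
        proof -
          note [measurable] = hD(1)[OF k]
          have "enn_powr (\<sigma> k) (1 / p1) * (?K (\<tau> k) / 2) = ?K (\<tau> k) / 2 * Lp_norm (ennreal p1) v1 (h k) * ennreal (c k)"
            unfolding c(1)[OF k, symmetric] by (simp add: ac_simps)
          also have "\<dots> \<le> ?B (\<tau> k) (h k) * ennreal (c k)"
            by (intro mult_right_mono h(2)[OF k]) simp
          also have "\<dots> \<le> wnorm lebesgue (ennreal p2) (ball 0 (\<tau> k)) (\<lambda>x. ennreal (v2 x)) (\<lambda>x. ennreal \<bar>h k x\<bar> * ennreal (c k))"
            using p by (intro wnorm_mult_const_le) auto
          also have "\<dots> \<le> ?B t f"
            using t fge[OF k] by (intro wnorm_mono_AE AE_I2) auto
          finally show ?thesis .
        qed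
        define b where "b k = enn_powr (\<sigma> k) (\<theta> / p1) * enn_powr (?K (\<tau> k) / 2) \<theta>" for k
        have Bf\<theta>: "b k \<le> enn_powr (?B t f) \<theta>" if "k \<in> T" "\<tau> k \<le> t" for k t
        proof -
          have "enn_powr (enn_powr (\<sigma> k) (1 / p1) * (?K (\<tau> k) / 2)) \<theta> \<le> enn_powr (?B t f) \<theta>"
            using p by (intro enn_powr_mono Bf that) simp
          then show ?thesis by (simp add: b_def enn_powr_mult enn_powr_powr)
        qed
        \<comment> \<open>The choice of \<sigma> is balanced: \<sigma>^(\<theta>/p1) K^\<theta> 2^k
          = \<sigma>, because 1 + R/p1 = R/\<theta> and \<theta> + R \<theta>/p1 = R. The lost
          factor is 2^\<theta> from K/2 and 2 from 2^(k-1).\<close>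
        have bk: "ennreal (2 powr (- 1 - \<theta>)) * \<sigma> k = b k * ennreal (2 powr real_of_int (k - 1))" if k: "k \<in> T" for k
        proof -
          obtain y where y: "?K (\<tau> k) = ennreal y" "0 < y"
            using T(2,3)[OF k] by (cases "?K (\<tau> k)") auto
          have s: "\<sigma> k = ennreal (2 powr (real_of_int k * (R / \<theta>)) * y powr R)"
            using y by (simp add: \<sigma>(1)[OF k] enn_powr_ennreal powr_powr flip: ennreal_mult)
          have "?K (\<tau> k) / 2 = ennreal (y / 2)"
            using y by (simp add: ennreal_divide_numeral)
          then have "b k * ennreal (2 powr real_of_int (k - 1))
            = ennreal ((2 powr (real_of_int k * (R / \<theta>)) * y powr R) powr (\<theta> / p1) * (y / 2) powr \<theta> * 2 powr real_of_int (k - 1))"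
            using y by (simp add: b_def s enn_powr_ennreal flip: ennreal_mult)
          also have "(2 powr (real_of_int k * (R / \<theta>)) * y powr R) powr (\<theta> / p1) * (y / 2) powr \<theta> * 2 powr real_of_int (k - 1)
            = 2 powr (real_of_int k * (R / p1) + (- \<theta>) + (real_of_int k - 1)) * y powr (\<theta> + R * \<theta> / p1)"
            by (rule powr_block_identity) (use y p in auto)
          also have "real_of_int k * (R / p1) + (- \<theta>) + (real_of_int k - 1) = (- 1 - \<theta>) + real_of_int k * (1 + R / p1)"
            by (simp add: algebra_simps)
          also have "2 powr ((- 1 - \<theta>) + real_of_int k * (1 + R / p1)) * y powr (\<theta> + R * \<theta> / p1)
            = 2 powr (- 1 - \<theta>) * (2 powr (real_of_int k * (R / \<theta>)) * y powr R)"
            unfolding R(2,4) powr_add by simp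
          finally show ?thesis
            by (simp add: s ennreal_mult)
        qed
        have "ennreal (2 powr (- 1 - \<theta>)) * \<Sigma> = (\<Sum>k\<in>T. b k * ennreal (2 powr real_of_int (k - 1)))"
          unfolding \<Sigma>_def sum_distrib_left by (intro sum.cong bk) auto
        \<comment> \<open>The number 2^(k-1) is realised as \<omega>-mass on level k - 1, beyond
          \<tau> k, where the bound b k for the norm of f is available.\<close>
        also have "\<dots> \<le> (\<Sum>k\<in>T. b k * (\<integral>\<^sup>+s. enn_powr (\<omega> s) \<theta> * indicator {\<tau> k<..} s * indicator (dyadic (k - 1)) (tail_mass \<theta> \<omega> s) \<partial>lebesgue))"
          by (intro sum_mono mult_left_mono tail_mass_half_block T(5)) auto
        also have "\<dots> = (\<integral>\<^sup>+s. (\<Sum>k\<in>T. b k * (enn_powr (\<omega> s) \<theta> * indicator {\<tau> k<..} s * indicator (dyadic (k - 1)) (tail_mass \<theta> \<omega> s))) \<partial>lebesgue)"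
          by (subst nn_integral_sum) (auto simp: nn_integral_cmult)
        also have "\<dots> \<le> (\<integral>\<^sup>+s. enn_powr (\<omega> s * ?B s f) \<theta> * indicator {0<..} s \<partial>lebesgue)"
        proof (rule nn_integral_mono)
          fix s
          show "(\<Sum>k\<in>T. b k * (enn_powr (\<omega> s) \<theta> * indicator {\<tau> k<..} s * indicator (dyadic (k - 1)) (tail_mass \<theta> \<omega> s)))
            \<le> enn_powr (\<omega> s * ?B s f) \<theta> * indicator {0<..} s"
          \<comment> \<open>Levels are disjoint, so at each radius s at most one summand is
            nonzero.\<close>
          proof (cases "\<exists>k\<in>T. \<tau> k < s \<and> tail_mass \<theta> \<omega> s \<in> dyadic (k - 1)")
            case True
            then obtain k where k: "k \<in> T" "\<tau> k < s" "tail_mass \<theta> \<omega> s \<in> dyadic (k - 1)" by blast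
            have "indicator (dyadic (l - 1)) (tail_mass \<theta> \<omega> s) = (if l = k then 1 else 0 :: ennreal)" for l
            proof (cases "l = k")
              case False
              then have "tail_mass \<theta> \<omega> s \<notin> dyadic (l - 1)"
                using dyadic_unique[OF k(3)] by (metis add_diff_cancel_right' diff_add_cancel)
              with False show ?thesis by simp
            qed (use k in simp)
            then have "(\<Sum>l\<in>T. b l * (enn_powr (\<omega> s) \<theta> * indicator {\<tau> l<..} s * indicator (dyadic (l - 1)) (tail_mass \<theta> \<omega> s)))
              = (\<Sum>l\<in>T. if l = k then b l * (enn_powr (\<omega> s) \<theta> * indicator {\<tau> l<..} s) else 0)"
              by (intro sum.cong) auto
            also have "\<dots> = b k * enn_powr (\<omega> s) \<theta>"
              using k by simp
            also have "\<dots> \<le> enn_powr (?B s f) \<theta> * enn_powr (\<omega> s) \<theta>"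
              using k by (intro mult_right_mono Bf\<theta>) auto
            also have "\<dots> = enn_powr (\<omega> s * ?B s f) \<theta> * indicator {0<..} s"
              using k T(4)[OF k(1)] by (simp add: enn_powr_mult mult.commute)
            finally show ?thesis .
          next
            case False
            then have "(\<Sum>k\<in>T. b k * (enn_powr (\<omega> s) \<theta> * indicator {\<tau> k<..} s * indicator (dyadic (k - 1)) (tail_mass \<theta> \<omega> s))) = 0"
              by (intro sum.neutral) (auto simp: indicator_def)
            then show ?thesis by (simp only: zero_le)
          qed
        qed
        finally have "enn_powr (ennreal (2 powr (- 1 - \<theta>)) * \<Sigma>) (1 / \<theta>) \<le> LM_norm (ennreal p2) (ennreal \<theta>) \<omega> v2 f"
          unfolding LM_norm_def using p by (simp add: wnorm_ennreal enn_powr_mono)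
        also have "\<dots> \<le> I * Lp_norm (ennreal p1) v1 f"
        proof -
          have "LM_norm (ennreal p2) (ennreal \<theta>) \<omega> v2 f / Lp_norm (ennreal p1) v1 f \<le> I"
            unfolding I_def embed_const_eq by (rule SUP_upper[OF f_adm])
          then show ?thesis using Lp_pos by (simp add: ennreal_divide_le_iff)
        qed
        also have "\<dots> = I * enn_powr \<Sigma> (1 / p1)" by (simp add: Lp)
        finally have le: "enn_powr (ennreal (2 powr (- 1 - \<theta>)) * \<Sigma>) (1 / \<theta>) \<le> I * enn_powr \<Sigma> (1 / p1)" .
        define d where "d = ennreal (2 powr (- ((1 + \<theta>) / \<theta>)))"
        have "enn_powr (ennreal (2 powr (- 1 - \<theta>)) * \<Sigma>) (1 / \<theta>) = d * enn_powr \<Sigma> (1 / R) * enn_powr \<Sigma> (1 / p1)"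
        proof -
          have "enn_powr (ennreal (2 powr (- 1 - \<theta>))) (1 / \<theta>) = d"
            using minus_divide_left[of "1 + \<theta>" \<theta>] by (simp add: d_def enn_powr_ennreal powr_powr)
          moreover have "enn_powr \<Sigma> (1 / \<theta>) = enn_powr \<Sigma> (1 / R) * enn_powr \<Sigma> (1 / p1)"
            unfolding R(3)[symmetric] by (rule enn_powr_add)
          ultimately show ?thesis
            by (simp add: enn_powr_mult mult.assoc)
        qed
        with le have "enn_powr \<Sigma> (1 / p1) * (d * enn_powr \<Sigma> (1 / R)) \<le> enn_powr \<Sigma> (1 / p1) * I"
          by (simp add: mult.commute)
        \<comment> \<open>The division by \<Sigma>^(1/p1) relies on \<Sigma> being finite, which the
          passage to finite T guarantees.\<close>
        then have "d * enn_powr \<Sigma> (1 / R) \<le> I"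
          using \<Sigma>0 \<Sigma>fin by (subst (asm) ennreal_mult_le_mult_iff) auto
        then have "ennreal (2 powr ((1 + \<theta>) / \<theta>)) * (d * enn_powr \<Sigma> (1 / R)) \<le> ennreal (2 powr ((1 + \<theta>) / \<theta>)) * I"
          by (rule mult_left_mono) simp
        moreover have "ennreal (2 powr ((1 + \<theta>) / \<theta>)) * d = 1"
          by (simp add: d_def flip: ennreal_mult powr_add)
        ultimately have "enn_powr \<Sigma> (1 / R) \<le> ennreal (2 powr ((1 + \<theta>) / \<theta>)) * I"
          by (simp add: mult.assoc[symmetric])
        then show ?thesis
          unfolding sum_eq using R enn_powr_le_iff[of "1 / R" \<Sigma>] by simp
      qed
    qed
    finally have "J \<le> ennreal (2 powr (R / \<theta>)) * enn_powr (ennreal (2 powr ((1 + \<theta>) / \<theta>)) * I) R"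
      by (simp add: mult_left_mono)
    then have "enn_powr J (1 / R) \<le> enn_powr (ennreal (2 powr (R / \<theta>)) * enn_powr (ennreal (2 powr ((1 + \<theta>) / \<theta>)) * I) R) (1 / R)"
      using R by (intro enn_powr_mono) auto
    also have "\<dots> = ennreal (2 powr (1 / \<theta>)) * (ennreal (2 powr ((1 + \<theta>) / \<theta>)) * I)"
      using R by (simp add: enn_powr_mult enn_powr_powr enn_powr_ennreal powr_powr)
    also have "\<dots> = ennreal (2 powr ((2 + \<theta>) / \<theta>)) * I"
    proof -
      have "ennreal (2 powr (1 / \<theta>)) * ennreal (2 powr ((1 + \<theta>) / \<theta>)) = ennreal (2 powr ((2 + \<theta>) / \<theta>))"
        by (simp flip: ennreal_mult powr_add add: add_divide_distrib[symmetric])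
      then show ?thesis by (simp add: mult.assoc[symmetric])
    qed
    finally show ?thesis by (simp add: I_def)
  qed
qed

section \<open>The characterization\<close>

lemma unif_equivI:
  assumes "0 < a" "0 < b"
    and le: "\<And>\<omega>. \<omega> \<in> Omega \<theta> \<Longrightarrow> A \<omega> \<le> ennreal a * B \<omega>" "\<And>\<omega>. \<omega> \<in> Omega \<theta> \<Longrightarrow> B \<omega> \<le> ennreal b * A \<omega>"
  shows "unif_equiv \<theta> B A"
  unfolding unif_equiv_def
\<comment> \<open>The maximum secures the ordering c <= C demanded by
  \<open>unif_equiv\<close>.\<close>
proof (rule exI[of _ "1 / a"], rule exI[of _ "max b (1 / a)"], intro conjI ballI)
  fix \<omega> assume \<omega>: "\<omega> \<in> Omega \<theta>"
  have "ennreal (1 / a) * A \<omega> \<le> ennreal (1 / a) * (ennreal a * B \<omega>)"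
    by (intro mult_left_mono le \<omega>) simp
  also have "\<dots> = B \<omega>"
    using assms by (simp add: mult.assoc[symmetric] flip: ennreal_mult)
  finally show "ennreal (1 / a) * A \<omega> \<le> B \<omega>" .
  have "B \<omega> \<le> ennreal b * A \<omega>" by (rule le(2)[OF \<omega>])
  also have "\<dots> \<le> ennreal (max b (1 / a)) * A \<omega>"
    by (intro mult_right_mono ennreal_leI) auto
  finally show "B \<omega> \<le> ennreal (max b (1 / a)) * A \<omega>" .
qed (use assms in auto)

lemma unif_equiv_eqI:
  assumes "\<And>\<omega>. \<omega> \<in> Omega \<theta> \<Longrightarrow> B \<omega> = A \<omega>"
  shows "unif_equiv \<theta> B A"
  using assms by (intro unif_equivI[of 1 1]) auto

section \<open>From real to extended exponents\<close>

lemma ennreal_pos_cases: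
  assumes "0 < p" "p < (top :: ennreal)"
  obtains r where "0 < r" "p = ennreal r" "enn2real p = r"
  using assms by (cases p) auto

text \<open>Subtraction of extended reals is truncated at 0; for b < a it agrees with the real
  one.\<close>

lemma ennreal_conjugate_exponent:
  "0 < b \<Longrightarrow> b < a \<Longrightarrow> ennreal a * ennreal b / (ennreal a - ennreal b) = ennreal (a * b / (a - b))"
  by (simp add: ennreal_minus divide_ennreal flip: ennreal_mult)

lemma local_const_eq_wnorm:
  assumes v: "v1 \<in> weights" "v2 \<in> weights" and p: "0 < p2" "p2 < p1" "p1 < top"
  shows "wnorm lebesgue (p1 * p2 / (p1 - p2)) (ball 0 t) (\<lambda>_. 1)
      (\<lambda>x. ennreal (v1 x powr (- 1 / enn2real p1) * v2 x powr (1 / enn2real p2)))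
    = local_const p1 v1 p2 v2 (ball 0 t)"
proof -
  have "0 < p1" "p2 < top" using p by (auto intro: less_trans)
  obtain a where a: "p1 = ennreal a" "0 < a" "enn2real p1 = a" using ennreal_pos_cases \<open>0 < p1\<close> p(3) by metis
  obtain b where b: "p2 = ennreal b" "0 < b" "enn2real p2 = b" using ennreal_pos_cases \<open>p2 < top\<close> p(1) by metis
  have "b < a" using p a b by (simp add: ennreal_less_iff)
  then show ?thesis
    using v a b by (simp add: ennreal_conjugate_exponent wnorm_ennreal local_const_Hoelder)
qed

lemma local_const_eq_wnorm_top:
  assumes v: "v1 \<in> weights" "v2 \<in> weights" and p: "0 < p" "p < top"
  shows "wnorm lebesgue top (ball 0 t) (\<lambda>_. 1)
      (\<lambda>x. ennreal (v1 x powr (- 1 / enn2real p) * v2 x powr (1 / enn2real p)))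
    = local_const p v1 p v2 (ball 0 t)"
proof -
  obtain a where a: "p = ennreal a" "0 < a" "enn2real p = a" using ennreal_pos_cases p by metis
  then show ?thesis
    using v by (simp add: wnorm_top local_const_diagonal)
qed

text \<open>Serves p2 < p1 and p2 = p1 alike; the two cases of the theorem differ only in the
  explicit formula substituted for \<open>local_const\<close>.\<close>

lemma unif_equiv_p1_le_theta:
  assumes v: "v1 \<in> weights" "v2 \<in> weights" and p: "0 < p1" "0 < p2" "p2 < top" "p1 \<le> \<theta>" "\<theta> < top"
  shows "unif_equiv \<theta> (\<lambda>\<omega>. embed_const p1 v1 p2 \<theta> \<omega> v2)
    (\<lambda>\<omega>. SUP t\<in>{0<..}. wnorm lebesgue \<theta> {t<..} (\<lambda>_. 1) \<omega> * local_const p1 v1 p2 v2 (ball 0 t))"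
proof -
  have "0 < \<theta>" "p1 < top" using p by auto
  obtain a where a: "p1 = ennreal a" "0 < a" using ennreal_pos_cases \<open>p1 < top\<close> p(1) by metis
  obtain b where b: "p2 = ennreal b" "0 < b" using ennreal_pos_cases p(2,3) by metis
  obtain c where c: "\<theta> = ennreal c" "0 < c" using ennreal_pos_cases \<open>0 < \<theta>\<close> p(5) by metis
  have "a \<le> c" using p a c by simp
  show ?thesis
  proof (rule unif_equivI)
    fix \<omega> assume \<omega>: "\<omega> \<in> Omega \<theta>"
    show "(SUP t\<in>{0<..}. wnorm lebesgue \<theta> {t<..} (\<lambda>_. 1) \<omega> * local_const p1 v1 p2 v2 (ball 0 t))
      \<le> ennreal 1 * embed_const p1 v1 p2 \<theta> \<omega> v2"
      using OmegaD[OF \<omega>] \<open>0 < \<theta>\<close> by (auto intro!: SUP_least embed_const_ge)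
    show "embed_const p1 v1 p2 \<theta> \<omega> v2 \<le> ennreal (4 powr (1 / b)) *
      (SUP t\<in>{0<..}. wnorm lebesgue \<theta> {t<..} (\<lambda>_. 1) \<omega> * local_const p1 v1 p2 v2 (ball 0 t))"
      unfolding a b c by (rule embed_const_upper_p1_le_theta) (use v a b c \<omega> \<open>a \<le> c\<close> in auto)
  qed auto
qed

lemma unif_equiv_theta_less_p1:
  assumes v: "v1 \<in> weights" "v2 \<in> weights" and p: "0 < \<theta>" "0 < p2" "p2 < top" "\<theta> < p1" "p1 < top"
  shows "unif_equiv \<theta> (\<lambda>\<omega>. embed_const p1 v1 p2 \<theta> \<omega> v2)
    (\<lambda>\<omega>. wnorm lebesgue (\<theta> * p1 / (p1 - \<theta>)) {0<..} (\<lambda>t. enn_powr (\<omega> t) (enn2real \<theta>))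
      (\<lambda>t. enn_powr (wnorm lebesgue \<theta> {t<..} (\<lambda>_. 1) \<omega>) (enn2real \<theta> / enn2real p1) * local_const p1 v1 p2 v2 (ball 0 t)))"
proof -
  have "0 < p1" "\<theta> < top" using p by auto
  obtain a where a: "p1 = ennreal a" "0 < a" using ennreal_pos_cases \<open>0 < p1\<close> p(5) by metis
  obtain b where b: "p2 = ennreal b" "0 < b" using ennreal_pos_cases p(2,3) by metis
  obtain c where c: "\<theta> = ennreal c" "0 < c" using ennreal_pos_cases p(1) \<open>\<theta> < top\<close> by metis
  have ca: "c < a" using p a c by (simp add: ennreal_less_iff)
  define R where "R = c * a / (a - c)"
  have R: "0 < R" using ca a c by (simp add: R_def)
  have e: "\<theta> * p1 / (p1 - \<theta>) = ennreal R"
    using ennreal_conjugate_exponent[OF c(2) ca] by (simp add: a c R_def mult.commute)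
  have eq: "wnorm lebesgue (\<theta> * p1 / (p1 - \<theta>)) {0<..} (\<lambda>t. enn_powr (\<omega> t) (enn2real \<theta>))
      (\<lambda>t. enn_powr (wnorm lebesgue \<theta> {t<..} (\<lambda>_. 1) \<omega>) (enn2real \<theta> / enn2real p1) * local_const p1 v1 p2 v2 (ball 0 t))
    = enn_powr (\<integral>\<^sup>+t. enn_powr (tail_mass c \<omega> t) (R / a) * enn_powr (\<omega> t) c
      * enn_powr (local_const (ennreal a) v1 (ennreal b) v2 (ball 0 t)) R * indicator {0<..} t \<partial>lebesgue) (1 / R)" for \<omega>
    unfolding e using R a c
    by (simp add: wnorm_ennreal tail_mass_def enn_powr_mult enn_powr_powr b ac_simps)
  show ?thesis
  proof (rule unif_equivI)
    fix \<omega> assume \<omega>: "\<omega> \<in> Omega \<theta>"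
    show "wnorm lebesgue (\<theta> * p1 / (p1 - \<theta>)) {0<..} (\<lambda>t. enn_powr (\<omega> t) (enn2real \<theta>))
      (\<lambda>t. enn_powr (wnorm lebesgue \<theta> {t<..} (\<lambda>_. 1) \<omega>) (enn2real \<theta> / enn2real p1) * local_const p1 v1 p2 v2 (ball 0 t))
      \<le> ennreal (2 powr ((2 + c) / c)) * embed_const p1 v1 p2 \<theta> \<omega> v2"
      unfolding eq unfolding a b c R_def
      by (rule embed_const_lower_theta_less_p1) (use v a b c \<omega> ca in auto)
    show "embed_const p1 v1 p2 \<theta> \<omega> v2 \<le> ennreal (2 powr (1 / c) * 4 powr (1 / b)) *
      wnorm lebesgue (\<theta> * p1 / (p1 - \<theta>)) {0<..} (\<lambda>t. enn_powr (\<omega> t) (enn2real \<theta>))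
      (\<lambda>t. enn_powr (wnorm lebesgue \<theta> {t<..} (\<lambda>_. 1) \<omega>) (enn2real \<theta> / enn2real p1) * local_const p1 v1 p2 v2 (ball 0 t))"
      unfolding eq unfolding a b c R_def
      by (rule embed_const_upper_theta_less_p1) (use v a b c \<omega> ca in auto)
  qed auto
qed

lemma unif_equiv_theta_top:
  assumes "v1 \<in> weights" "v2 \<in> weights" "0 < p1" "0 < p2"
  shows "unif_equiv top (\<lambda>\<omega>. embed_const p1 v1 p2 top \<omega> v2)
    (\<lambda>\<omega>. SUP t\<in>{0<..}. wnorm lebesgue top {t<..} (\<lambda>_. 1) \<omega> * local_const p1 v1 p2 v2 (ball 0 t))"
  using assms by (intro unif_equiv_eqI embed_const_theta_top OmegaD)

theorem theorem3p1:
  fixes v1 v2 :: "'a::euclidean_space \<Rightarrow> real"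
    and p1 p2 \<theta> :: ennreal
  assumes "0 < p1" "0 < p2" "0 < \<theta>"
    and "v1 \<in> weights" "v2 \<in> weights"
  defines "I \<equiv> embed_const p1 v1 p2 \<theta>"
  shows
   "(p2 < p1 \<and> p1 \<le> \<theta> \<and> \<theta> < top \<longrightarrow>
      unif_equiv \<theta> (\<lambda>\<omega>. I \<omega> v2) (\<lambda>\<omega>. SUP t \<in> {0<..}.
        wnorm lebesgue \<theta> {t<..} (\<lambda>_. 1) \<omega> *
        wnorm lebesgue (p1 * p2 / (p1 - p2)) (ball 0 t) (\<lambda>_. 1)
          (\<lambda>x. ennreal (v1 x powr (- 1 / enn2real p1) * v2 x powr (1 / enn2real p2)))))
  \<and> (p2 < p1 \<and> p1 < top \<and> \<theta> < p1 \<longrightarrow>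
      unif_equiv \<theta> (\<lambda>\<omega>. I \<omega> v2) (\<lambda>\<omega>.
        wnorm lebesgue (\<theta> * p1 / (p1 - \<theta>)) {0<..} (\<lambda>t. enn_powr (\<omega> t) (enn2real \<theta>))
          (\<lambda>t. enn_powr (wnorm lebesgue \<theta> {t<..} (\<lambda>_. 1) \<omega>) (enn2real \<theta> / enn2real p1) *
               wnorm lebesgue (p1 * p2 / (p1 - p2)) (ball 0 t) (\<lambda>_. 1)
                 (\<lambda>x. ennreal (v1 x powr (- 1 / enn2real p1) * v2 x powr (1 / enn2real p2))))))
  \<and> (p2 < p1 \<and> p1 < top \<and> \<theta> = top \<longrightarrow>
      unif_equiv \<theta> (\<lambda>\<omega>. I \<omega> v2) (\<lambda>\<omega>. SUP t \<in> {0<..}.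
        wnorm lebesgue \<theta> {t<..} (\<lambda>_. 1) \<omega> *
        wnorm lebesgue (p1 * p2 / (p1 - p2)) (ball 0 t) (\<lambda>_. 1)
          (\<lambda>x. ennreal (v1 x powr (- 1 / enn2real p1) * v2 x powr (1 / enn2real p2)))))
  \<and> (p1 = top \<and> \<theta> = top \<and> p2 < top \<longrightarrow>
      unif_equiv \<theta> (\<lambda>\<omega>. I \<omega> v2) (\<lambda>\<omega>. SUP t \<in> {0<..}.
        wnorm lebesgue \<theta> {t<..} (\<lambda>_. 1) \<omega> *
        wnorm lebesgue p2 (ball 0 t) (\<lambda>_. 1)
          (\<lambda>x. ennreal (inverse (v1 x) * v2 x powr (1 / enn2real p2)))))
  \<and> (p1 = top \<and> p2 < top \<and> \<theta> < top \<longrightarrow>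
      unif_equiv \<theta> (\<lambda>\<omega>. I \<omega> v2) (\<lambda>\<omega>.
        wnorm lebesgue \<theta> {0<..} (\<lambda>_. 1)
          (\<lambda>t. \<omega> t * wnorm lebesgue p2 (ball 0 t) (\<lambda>_. 1)
                 (\<lambda>x. ennreal (inverse (v1 x) * v2 x powr (1 / enn2real p2))))))
  \<and> (p1 = p2 \<and> p1 \<le> \<theta> \<and> \<theta> < top \<longrightarrow>
      unif_equiv \<theta> (\<lambda>\<omega>. I \<omega> v2) (\<lambda>\<omega>. SUP t \<in> {0<..}.
        wnorm lebesgue \<theta> {t<..} (\<lambda>_. 1) \<omega> *
        wnorm lebesgue top (ball 0 t) (\<lambda>_. 1)
          (\<lambda>x. ennreal (v1 x powr (- 1 / enn2real p1) * v2 x powr (1 / enn2real p1)))))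
  \<and> (p1 = p2 \<and> p1 < top \<and> \<theta> < p1 \<longrightarrow>
      unif_equiv \<theta> (\<lambda>\<omega>. I \<omega> v2) (\<lambda>\<omega>.
        wnorm lebesgue (\<theta> * p1 / (p1 - \<theta>)) {0<..} (\<lambda>t. enn_powr (\<omega> t) (enn2real \<theta>))
          (\<lambda>t. enn_powr (wnorm lebesgue \<theta> {t<..} (\<lambda>_. 1) \<omega>) (enn2real \<theta> / enn2real p1) *
               wnorm lebesgue top (ball 0 t) (\<lambda>_. 1)
                 (\<lambda>x. ennreal (v1 x powr (- 1 / enn2real p1) * v2 x powr (1 / enn2real p1))))))
  \<and> (p1 = p2 \<and> p1 < top \<and> \<theta> = top \<longrightarrow>
      unif_equiv \<theta> (\<lambda>\<omega>. I \<omega> v2) (\<lambda>\<omega>. SUP t \<in> {0<..}.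
        wnorm lebesgue \<theta> {t<..} (\<lambda>_. 1) \<omega> *
        wnorm lebesgue top (ball 0 t) (\<lambda>_. 1)
          (\<lambda>x. ennreal (v1 x powr (- 1 / enn2real p1) * v2 x powr (1 / enn2real p1)))))
  \<and> (p1 = top \<and> p2 = top \<and> \<theta> < top \<longrightarrow>
      unif_equiv \<theta> (\<lambda>\<omega>. I \<omega> v2) (\<lambda>\<omega>.
        wnorm lebesgue \<theta> {0<..} (\<lambda>_. 1)
          (\<lambda>t. \<omega> t * wnorm lebesgue top (ball 0 t) (\<lambda>_. 1)
                 (\<lambda>x. ennreal (inverse (v1 x) * v2 x)))))"
proof (intro conjI impI, goal_cases)
  note v = assms(4,5)
  case 1
  then have p: "p2 < p1" "p1 \<le> \<theta>" "\<theta> < top" "p1 < top" "p2 < top" by auto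
  show ?case
    unfolding I_def local_const_eq_wnorm[OF v assms(2) p(1,4)]
    by (intro unif_equiv_p1_le_theta v assms p)
next
  note v = assms(4,5)
  case 2
  then have p: "p2 < p1" "p1 < top" "\<theta> < p1" "p2 < top" by auto
  show ?case
    unfolding I_def local_const_eq_wnorm[OF v assms(2) p(1,2)]
    by (intro unif_equiv_theta_less_p1 v assms p)
next
  note v = assms(4,5)
  case 3
  then have p: "p2 < p1" "p1 < top" and \<theta>: "\<theta> = top" by auto
  show ?case
    unfolding I_def \<theta> local_const_eq_wnorm[OF v assms(2) p]
    by (intro unif_equiv_theta_top v assms)
next
  note v = assms(4,5)
  case 4
  then have p: "p2 < top" and top: "p1 = top" "\<theta> = top" by auto
  show ?case
    \<comment> \<open>Both reductions combine: 1/v1 is extremal, and \<open>LM_norm_top\<close>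
      rewrites its norm as the supremum over t, so equality holds.\<close>
    unfolding I_def top wnorm_inverse_weight[OF v assms(2) p, symmetric]
  proof (rule unif_equiv_eqI)
    fix \<omega> :: "real \<Rightarrow> ennreal" assume "\<omega> \<in> Omega top"
    then have \<omega>: "\<omega> \<in> borel_measurable lebesgue" by (rule OmegaD)
    have f: "(\<lambda>x. inverse (v1 x)) \<in> borel_measurable lebesgue"
      using weights_measurable[OF v(1)] by simp
    have "embed_const top v1 p2 top \<omega> v2 = LM_norm p2 top \<omega> v2 (\<lambda>x. inverse (v1 x))"
      using v \<omega> assms(2) by (intro embed_const_p1_top) auto
    also have "\<dots> = (SUP t\<in>{0<..}. wnorm lebesgue top {t<..} (\<lambda>_. 1) \<omega>
        * wnorm lebesgue p2 (ball 0 t) (\<lambda>x. ennreal (v2 x)) (\<lambda>x. ennreal \<bar>inverse (v1 x)\<bar>))"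
      by (rule LM_norm_top[OF \<omega> v(2) f assms(2)])
    finally show "embed_const top v1 p2 top \<omega> v2 = (SUP t\<in>{0<..}. wnorm lebesgue top {t<..} (\<lambda>_. 1) \<omega>
        * wnorm lebesgue p2 (ball 0 t) (\<lambda>x. ennreal (v2 x)) (\<lambda>x. ennreal \<bar>inverse (v1 x)\<bar>))" .
  qed
next
  note v = assms(4,5)
  case 5
  then have p: "p2 < top" and top: "p1 = top" by auto
  show ?case
    unfolding I_def top wnorm_inverse_weight[OF v assms(2) p, symmetric] LM_norm_def[symmetric]
    by (intro unif_equiv_eqI embed_const_p1_top v assms OmegaD)
next
  note v = assms(4,5)
  case 6
  then have eq: "p2 = p1" and p: "p1 \<le> \<theta>" "\<theta> < top" "p1 < top" by auto
  show ?case
    unfolding I_def eq local_const_eq_wnorm_top[OF v assms(1) p(3)]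
    by (intro unif_equiv_p1_le_theta v assms p)
next
  note v = assms(4,5)
  case 7
  then have eq: "p2 = p1" and p: "p1 < top" "\<theta> < p1" by auto
  show ?case
    unfolding I_def eq local_const_eq_wnorm_top[OF v assms(1) p(1)]
    by (intro unif_equiv_theta_less_p1 v assms p)
next
  note v = assms(4,5)
  case 8
  then have eq: "p2 = p1" "\<theta> = top" and p: "p1 < top" by auto
  show ?case
    unfolding I_def eq local_const_eq_wnorm_top[OF v assms(1) p]
    by (intro unif_equiv_theta_top v assms)
next
  note v = assms(4,5)
  case 9
  then have top: "p1 = top" "p2 = top" by auto
  show ?case
    unfolding I_def top wnorm_top_inverse_weight[OF v, symmetric] LM_norm_def[symmetric]
    by (intro unif_equiv_eqI embed_const_p1_top v assms OmegaD) simp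
qed

end
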